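(* Let $d\in\mathbb{N}$. There are a constant $c_d>0$ depending only on $d$, constants $C(\alpha,d)>0$ for all $\alpha\in(1/2,\infty)^d$, and, for each $s\in\mathbb{N}$, a choice of $\Lambda\subseteq\mathbb{Z}^d$ (independent of $\alpha$) with $$ n=|\Lambda|\leq s\log^{d-1}(e s), $$ such that the following holds. Let $\varepsilon\in(0,1)$ and let $x_1,\ldots,x_m$ be drawn i.i.d. from the uniform measure on $\mathbb{T}^d$, where $$ m\geq c_d\cdot s\cdot\left(\log^3(2s)+\log(2/\varepsilon)\right). $$ Then with probability at least $1-\varepsilon$ the following holds: for any $\alpha\in(1/2,\infty)^d$ and $f\in H^\alpha_{\mathsf{mix}}(\mathbb{T}^d)$, the approximation $\hat f=\mathcal{R}_{s,\Lambda}(f)$ is at most $2s$-sparse (a linear combination of at most $2s$ of the functions $\psi_k$, $k\in\Lambda$) and satisfies $$ \|f-\hat f\|_{L^2(\mathbb{T}^d)}\leq C(\alpha,d)\left(\frac{\log^{p(\alpha)-1}(s)}{s}\right)^{h(\alpha)}\|f\|_{H^\alpha_{\mathsf{mix}}}. $$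
   Context: $\mathbb{T}^d=[0,1)^d$ is the $d$-dimensional torus, $\psi_k(x)=e^{2\pi i k\cdot x}$ for $k\in\mathbb{Z}^d$, and $\hat f_k=\int_{\mathbb{T}^d}f(x)\psi_{-k}(x)\,dx$. For $\alpha=(\alpha_1,\dots,\alpha_d)$ with positive entries, the anisotropic dominating mixed smoothness Sobolev space is $H^\alpha_{\mathsf{mix}}(\mathbb{T}^d)=\{f\in L^2(\mathbb{T}^d):\|f\|_{H^\alpha_{\mathsf{mix}}}<\infty\}$, where $\|f\|^2_{H^\alpha_{\mathsf{mix}}}=\sum_{k\in\mathbb{Z}^d}\prod_{j=1}^d(1+|k_j|)^{2\alpha_j}|\hat f_k|^2$. Also $h(\alpha)=\min_{1\le i\le d}\alpha_i$ and $p(\alpha)=|\{j\in\{1,\dots,d\}:\alpha_j=h(\alpha)\}|$; the convention is $\log^0(\cdot)=1$. If all $\alpha_j>1/2$ then $H^\alpha_{\mathsf{mix}}(\mathbb{T}^d)\hookrightarrow C(\mathbb{T}^d)$, so that samples $f(x_i)$ are well defined. The sparse recovery procedure $\mathcal{R}_{s,\Lambda}$ (denoted $\mathcal{R}_{s,n}$ in the paper, with $n=|\Lambda|$): given $f(x_1),\ldots,f(x_m)$, set $b=\frac{1}{\sqrt m}(f(x_i))_{i=1}^m$ and $A=\frac{1}{\sqrt m}(\psi_k(x_i))_{i\in\{1,\dots,m\},k\in\Lambda}$. Let $\check c\in\mathbb{C}^\Lambda$ be the (unique) minimizer of smallest $\ell^2$-norm of $\min_{z\in\mathbb{C}^\Lambda}\lambda\|z\|_1+\|Az-b\|_2$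 with $\lambda=\frac{3}{14\sqrt s}$. Let $\hat c=H_{2s}(\check c)$, where $H_{2s}$ keeps the $2s$ largest entries in absolute value and sets all others to zero. Then $\mathcal{R}_{s,\Lambda}(f)=\sum_{k\in\Lambda}\hat c_k\psi_k$.
   Formalization: For s = 1 the error bound is claimed only when p(α) = 1, because for s = 1 and p(α) ≥ 2 the right-hand side is zero and would force f to equal its approximation for every f, which is false. *)

theory Defs
  imports "HOL-Analysis.Analysis"
begin

definition torus :: "(real ^ 'd) set" where
  "torus = {x. \<forall>j. 0 \<le> x $ j \<and> x $ j < 1}"

text \<open>The cube has volume one, so Lebesgue measure restricted to it is the uniform measure.\<close>

definition torus_measure :: "(real ^ 'd) measure" where
  "torus_measure = restrict_space lborel torus"

definition fourier_basis :: "int ^ 'd \<Rightarrow> real ^ 'd \<Rightarrow> complex" where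
  "fourier_basis k x = exp (2 * of_real pi * \<i> * of_real (\<Sum>j\<in>UNIV. of_int (k $ j) * x $ j))"

definition fourier_coeff :: "(real ^ 'd \<Rightarrow> complex) \<Rightarrow> int ^ 'd \<Rightarrow> complex" where
  "fourier_coeff f k = (LINT x|torus_measure. f x * fourier_basis (- k) x)"

text \<open>Elements of \<open>L\<^sup>2\<close> are represented by functions, not by almost-everywhere classes; only their
  values on the cube matter.\<close>

definition L2_torus :: "(real ^ 'd \<Rightarrow> complex) set" where
  "L2_torus = {f. f \<in> borel_measurable torus_measure \<and>
                  integrable torus_measure (\<lambda>x. (cmod (f x))\<^sup>2)}"

definition L2_torus_norm :: "(real ^ 'd \<Rightarrow> complex) \<Rightarrow> real" where
  "L2_torus_norm f = sqrt (LINT x|torus_measure. (cmod (f x))\<^sup>2)"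

definition mix_weighted :: "real ^ 'd \<Rightarrow> (real ^ 'd \<Rightarrow> complex) \<Rightarrow> int ^ 'd \<Rightarrow> real" where
  "mix_weighted \<alpha> f k =
     (\<Prod>j\<in>UNIV. (1 + \<bar>of_int (k $ j)\<bar>) powr (2 * \<alpha> $ j)) * (cmod (fourier_coeff f k))\<^sup>2"

definition H_mix :: "real ^ 'd \<Rightarrow> (real ^ 'd \<Rightarrow> complex) set" where
  "H_mix \<alpha> = {f \<in> L2_torus. mix_weighted \<alpha> f summable_on UNIV}"

definition H_mix_norm :: "real ^ 'd \<Rightarrow> (real ^ 'd \<Rightarrow> complex) \<Rightarrow> real" where
  "H_mix_norm \<alpha> f = sqrt (\<Sum>\<^sub>\<infinity>k. mix_weighted \<alpha> f k)"

definition min_smoothness :: "real ^ 'd \<Rightarrow> real" where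
  "min_smoothness \<alpha> = Min (range (\<lambda>i. \<alpha> $ i))"

definition min_multiplicity :: "real ^ 'd \<Rightarrow> nat" where
  "min_multiplicity \<alpha> = card {j. \<alpha> $ j = min_smoothness \<alpha>}"

text \<open>Continuous functions on the torus are continuous functions on the whole space with period one
  in every coordinate.\<close>

definition C_torus :: "(real ^ 'd \<Rightarrow> complex) set" where
  "C_torus = {g. continuous_on UNIV g \<and>
                 (\<forall>x (k :: int ^ 'd). g (x + (\<chi> j. of_int (k $ j))) = g x)}"

text \<open>Point values of an \<open>L\<^sup>2\<close> function are those of its continuous representative, which is unique
  if it exists, and exists on \<open>H_mix \<alpha>\<close> when every entry of \<open>\<alpha>\<close> exceeds one half.\<close>

definition cont_rep :: "(real ^ 'd \<Rightarrow> complex) \<Rightarrow> real ^ 'd \<Rightarrow> complex" where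
  "cont_rep f = (THE g. g \<in> C_torus \<and> (AE x in torus_measure. f x = g x))"

text \<open>Vectors indexed by \<open>\<Lambda>\<close> are functions vanishing off \<open>\<Lambda>\<close>.\<close>

definition coeff_space :: "'k set \<Rightarrow> ('k \<Rightarrow> complex) set" where
  "coeff_space \<Lambda> = {z. \<forall>k. k \<notin> \<Lambda> \<longrightarrow> z k = 0}"

definition lasso_objective ::
  "real \<Rightarrow> nat \<Rightarrow> 'k set \<Rightarrow> (nat \<Rightarrow> 'k \<Rightarrow> complex) \<Rightarrow> (nat \<Rightarrow> complex) \<Rightarrow> ('k \<Rightarrow> complex) \<Rightarrow> real" where
  "lasso_objective lam m \<Lambda> A b z =
     lam * (\<Sum>k\<in>\<Lambda>. cmod (z k)) + L2_set (\<lambda>i. cmod ((\<Sum>k\<in>\<Lambda>. A i k * z k) - b i)) {1..m}"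

definition lasso_minimizers ::
  "real \<Rightarrow> nat \<Rightarrow> 'k set \<Rightarrow> (nat \<Rightarrow> 'k \<Rightarrow> complex) \<Rightarrow> (nat \<Rightarrow> complex) \<Rightarrow> ('k \<Rightarrow> complex) set" where
  "lasso_minimizers lam m \<Lambda> A b =
     {z \<in> coeff_space \<Lambda>. \<forall>w \<in> coeff_space \<Lambda>.
        lasso_objective lam m \<Lambda> A b z \<le> lasso_objective lam m \<Lambda> A b w}"

definition lasso_solution ::
  "real \<Rightarrow> nat \<Rightarrow> 'k set \<Rightarrow> (nat \<Rightarrow> 'k \<Rightarrow> complex) \<Rightarrow> (nat \<Rightarrow> complex) \<Rightarrow> 'k \<Rightarrow> complex" where
  "lasso_solution lam m \<Lambda> A b =
     (THE z. z \<in> lasso_minimizers lam m \<Lambda> A b \<and>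
        (\<forall>w \<in> lasso_minimizers lam m \<Lambda> A b.
           L2_set (\<lambda>k. cmod (z k)) \<Lambda> \<le> L2_set (\<lambda>k. cmod (w k)) \<Lambda>))"

text \<open>Hard thresholding is a relation because entries of equal modulus may be kept in any order;
  if \<open>\<Lambda>\<close> has fewer than \<open>r\<close> elements then all entries are kept.\<close>

definition is_hard_threshold :: "nat \<Rightarrow> 'k set \<Rightarrow> ('k \<Rightarrow> complex) \<Rightarrow> ('k \<Rightarrow> complex) \<Rightarrow> bool" where
  "is_hard_threshold r \<Lambda> z w \<longleftrightarrow>
     (\<exists>S\<subseteq>\<Lambda>. card S = min r (card \<Lambda>) \<and>
        (\<forall>k\<in>S. \<forall>l\<in>\<Lambda> - S. cmod (z l) \<le> cmod (z k)) \<and>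
        w = (\<lambda>k. if k \<in> S then z k else 0))"

lemma hard_threshold_exists:
  assumes "finite \<Lambda>"
  shows "\<exists>w. is_hard_threshold r \<Lambda> z w"
proof -
  have "\<exists>S\<subseteq>\<Lambda>. card S = q \<and> (\<forall>k\<in>S. \<forall>l\<in>\<Lambda> - S. cmod (z l) \<le> cmod (z k))" if "q \<le> card \<Lambda>" for q
    using that
  proof (induction q)
    case 0
    then show ?case by (intro exI[of _ "{}"]) auto
  next
    case (Suc q)
    then obtain S where S: "S \<subseteq> \<Lambda>" "card S = q" "\<forall>k\<in>S. \<forall>l\<in>\<Lambda> - S. cmod (z l) \<le> cmod (z k)"
      by auto
    have fin: "finite S" "finite (\<Lambda> - S)" using S(1) assms by (auto intro: finite_subset)
    have ne: "\<Lambda> - S \<noteq> {}" using S(1,2) Suc.prems by auto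
    have "Max ((\<lambda>l. cmod (z l)) ` (\<Lambda> - S)) \<in> (\<lambda>l. cmod (z l)) ` (\<Lambda> - S)"
      using fin ne by (intro Max_in) auto
    then obtain a where a: "a \<in> \<Lambda> - S" "cmod (z a) = Max ((\<lambda>l. cmod (z l)) ` (\<Lambda> - S))"
      by auto
    have "cmod (z l) \<le> cmod (z a)" if "l \<in> \<Lambda> - S" for l
      unfolding a(2) using fin that by (intro Max_ge) auto
    then show ?case
      using S a(1) fin by (intro exI[of _ "insert a S"]) auto
  qed
  from this[of "min r (card \<Lambda>)"] show ?thesis
    unfolding is_hard_threshold_def by auto
qed

text \<open>The possible outputs of the recovery procedure for the data \<open>y i\<close> sampled at \<open>x i\<close>,
  \<open>i = 1, \<dots>, m\<close>; there is more than one only through ties in the thresholding step.\<close>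

definition sparse_recovery ::
  "nat \<Rightarrow> (int ^ 'd) set \<Rightarrow> nat \<Rightarrow> (nat \<Rightarrow> real ^ 'd) \<Rightarrow> (nat \<Rightarrow> complex) \<Rightarrow> (real ^ 'd \<Rightarrow> complex) set"
  where
  "sparse_recovery s \<Lambda> m x y =
     (let A = (\<lambda>i k. of_real (1 / sqrt (real m)) * fourier_basis k (x i));
          b = (\<lambda>i. of_real (1 / sqrt (real m)) * y i);
          z = lasso_solution (3 / (14 * sqrt (real s))) m \<Lambda> A b
      in {(\<lambda>t. \<Sum>k\<in>\<Lambda>. c k * fourier_basis k t) | c. is_hard_threshold (2 * s) \<Lambda> z c})"

definition sparse_combination :: "nat \<Rightarrow> (int ^ 'd) set \<Rightarrow> (real ^ 'd \<Rightarrow> complex) \<Rightarrow> bool" where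
  "sparse_combination r \<Lambda> g \<longleftrightarrow>
     (\<exists>S c. S \<subseteq> \<Lambda> \<and> finite S \<and> card S \<le> r \<and> g = (\<lambda>t. \<Sum>k\<in>S. c k * fourier_basis k t))"

end

theory Submission
  imports Defs "HOL-Probability.Probability"
begin

text \<open>
  The recovery problem contains no sparsity that has to be detected: one set of at most \<open>s\<close>
  frequencies is good for all smoothness vectors at once. Consider the crosses
  \<open>{k. (\<Prod>j. (1 + \<bar>k j\<bar>) powr \<beta> j) \<le> T}\<close> with \<open>\<beta> = 1\<close> on a nonempty set \<open>P\<close> of coordinates and
  \<open>\<beta> = 1 + 1/N\<close> on the other coordinates. Such a cross has at most
  \<open>C(P,N) * T * (1 + ln T) ^ (card P - 1)\<close> elements. The constant in the error bound may depend on
  \<open>\<alpha>\<close> in an arbitrary way, so each cross may be shrunk by its own factor, and if the factors are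
  summable over \<open>P\<close> and \<open>N\<close> then the union of all the crosses still has at most \<open>s\<close> elements
  (\<open>universal_frequency_sets\<close>). For every \<open>\<alpha>\<close> the union contains all frequencies at which the
  Sobolev weight lies below \<open>(c * s / (1 + ln s) ^ (p - 1)) powr h\<close>, where \<open>h\<close> is the smallest entry
  of \<open>\<alpha>\<close>, \<open>p\<close> the number of entries equal to it, and \<open>c\<close> depends on \<open>\<alpha>\<close> only. Hence the Fourier
  projection to this set attains the claimed rate, and thresholding to \<open>2s\<close> entries changes nothing.

  It remains to find the at most \<open>s\<close> coefficients in a stable way from the samples. For a finite set
  \<open>B\<close> of frequencies let \<open>A\<close> be the sampling matrix. Since the characters have modulus one,
  \<open>A\<^sup>* A - I\<close> has zero diagonal, and by orthogonality the expected trace of its \<open>2q\<close>-th power counts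
  pairs of a closed walk in \<open>B\<close> and a labelling of its steps by sample points such that the steps with
  the same label add up to zero. Every label must occur at least twice, because no step is zero, so
  there are at most \<open>q\<close> labels; and the balance of each label but one determines one vertex of the
  walk (\<open>card_closed_walks_le\<close>). The count gives a moment bound of matrix Chernoff quality
  (\<open>expectation_trace_gram_deviation\<close>): \<open>A\<close> is a near isometry on \<open>B\<close> with probability
  \<open>1 - card B * exp (- q)\<close> as soon as \<open>m\<close> exceeds a multiple of \<open>q * card B\<close>.

  This is used for \<open>B = \<Lambda> s\<close> and for all blocks \<open>\<Lambda> (2 ^ Suc l * s) - (\<Union>i\<le>l. \<Lambda> (2 ^ i * s))\<close>
  simultaneously. On the \<open>l\<close>-th block the norm of \<open>A\<close> is at most a constant times \<open>sqrt (2 ^ l * (l + 1))\<close>,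
  while the coefficients of \<open>f\<close> on it have size \<open>2 powr (- l * h)\<close> up to powers of \<open>l\<close>. As
  \<open>h > 1/2\<close>, the contributions of the blocks to the sampled residual are summable. On \<open>\<Lambda> s\<close> the lower
  bound \<open>1/2\<close> for \<open>A\<close> exceeds the factor \<open>3/14\<close> that the penalty of the minimization costs after the
  Cauchy-Schwarz inequality on at most \<open>s\<close> entries, so the minimizer is within seven times the sampled residual
  of the true coefficients (\<open>lasso_error_le\<close>).

  Point values are those of the continuous representative. It is the sum of the Fourier series, which
  converges absolutely by the same block estimates; that the sum agrees with \<open>f\<close> almost everywhere is
  the completeness of the trigonometric system (\<open>zero_spectrum_AE_0\<close>).
\<close>

section \<open>Closed walks with balanced labels\<close>

text \<open>The walk \<open>w\<close> has the steps \<open>w (Suc j) - w j\<close>, and step \<open>j\<close> carries the label \<open>\<iota> j\<close>. The vertices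
  \<open>w j\<close> at which a label other than \<open>\<iota> 0\<close> occurs for the first time are determined by the other
  vertices: in the balance equation of the last such label every other vertex is already known, and
  then the argument is repeated with the label before it. In terms of graphs, a vertex of the walk is an
  edge joining two consecutive labels, the balance equations say that the walk is a flow, and the
  first occurrences form a spanning tree.\<close>

lemma card_closed_walks_le:
  fixes \<iota> :: "nat \<Rightarrow> 'a" and B :: "'k::ab_group_add set"
  assumes "finite B" and "0 < p"
  shows "card {w \<in> {..p} \<rightarrow>\<^sub>E B. w 0 = w p \<and>
           (\<forall>a \<in> \<iota> ` {..<p}. (\<Sum>j | j < p \<and> \<iota> j = a. w (Suc j) - w j) = 0)}
         \<le> card B ^ (p + 1 - card (\<iota> ` {..<p}))" (is "card ?W \<le> _")
proof -
  define F where "F = {j. j < p \<and> \<iota> j \<notin> \<iota> ` {..<j} \<and> \<iota> j \<noteq> \<iota> 0}"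
  have finF: "finite F" and Fsub: "F \<subseteq> {..<p}" unfolding F_def by auto
  have F0: "0 \<notin> F" unfolding F_def by auto
  have first: "j = j'" if "j \<in> F" "j' < p" "\<iota> j = \<iota> j'" "j' \<le> j" for j j'
  proof (rule ccontr)
    assume "j \<noteq> j'"
    then have "j' \<in> {..<j}" using that by auto
    then have "\<iota> j \<in> \<iota> ` {..<j}" using that(3) by (metis imageI)
    then show False using that(1) unfolding F_def by blast
  qed
  have "bij_betw \<iota> F (\<iota> ` {..<p} - {\<iota> 0})"
  proof (rule bij_betwI')
    fix x y assume "x \<in> F" "y \<in> F"
    then show "(\<iota> x = \<iota> y) = (x = y)"
      by (metis Fsub first lessThan_iff linorder_linear subsetD)
  next
    fix x assume "x \<in> F" then show "\<iota> x \<in> \<iota> ` {..<p} - {\<iota> 0}" unfolding F_def by auto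
  next
    fix y assume y: "y \<in> \<iota> ` {..<p} - {\<iota> 0}"
    then obtain j where j: "j < p" "\<iota> j = y" by auto
    define i where "i = (LEAST i. \<iota> i = y)"
    have i1: "\<iota> i = y" unfolding i_def by (rule LeastI[of "\<lambda>i. \<iota> i = y", OF j(2)])
    have i2: "i \<le> j" unfolding i_def by (rule Least_le[of "\<lambda>i. \<iota> i = y", OF j(2)])
    have i3: "\<iota> i' \<noteq> y" if "i' < i" for i' using not_less_Least[of _ "\<lambda>i. \<iota> i = y"] that unfolding i_def by metis
    have "\<iota> i \<notin> \<iota> ` {..<i}"
    proof
      assume "\<iota> i \<in> \<iota> ` {..<i}"
      then obtain i' where "i' < i" "\<iota> i = \<iota> i'" by (elim imageE) simp
      then show False using i3[of i'] i1 by simp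
    qed
    then have "i \<in> F" using j(1) y i1 i2 unfolding F_def by simp
    then show "\<exists>x\<in>F. y = \<iota> x" using i1 by blast
  qed
  then have cardF: "card F = card (\<iota> ` {..<p}) - 1"
    using \<open>0 < p\<close> by (simp add: bij_betw_same_card card_Diff_singleton_if)
  have "inj_on (\<lambda>w. restrict w ({..<p} - F)) ?W"
  proof (rule inj_onI)
    fix w w' assume W: "w \<in> ?W" "w' \<in> ?W"
      and eq: "restrict w ({..<p} - F) = restrict w' ({..<p} - F)"
    define u where "u j = w j - w' j" for j
    have off: "u j = 0" if "j < p" "j \<notin> F" for j
      using fun_cong[OF eq, of j] that unfolding u_def by auto
    have up: "u p = 0" using off[of 0] F0 \<open>0 < p\<close> W unfolding u_def by auto
    have "{j \<in> F. u j \<noteq> 0} = {}"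
    proof (rule ccontr)
      assume ne: "{j \<in> F. u j \<noteq> 0} \<noteq> {}"
      define t where "t = Max {j \<in> F. u j \<noteq> 0}"
      have fin: "finite {j \<in> F. u j \<noteq> 0}" using finF by auto
      have t: "t \<in> F" "u t \<noteq> 0" using Max_in[OF fin ne] unfolding t_def by auto
      have later: "u j = 0" if "t < j" "j \<le> p" for j
      proof (rule ccontr)
        assume "u j \<noteq> 0"
        then have "j \<in> {j \<in> F. u j \<noteq> 0}" using that off[of j] up by (metis (mono_tags) le_neq_implies_less mem_Collect_eq)
        then show False using Max_ge[OF fin] that unfolding t_def by fastforce
      qed
      have tp: "t < p" using t Fsub by auto
      let ?J = "{j. j < p \<and> \<iota> j = \<iota> t}"
      have J: "t \<le> j" if "j \<in> ?J" for j
      proof (rule ccontr)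
        assume "\<not> t \<le> j"
        then have "t = j" using first[OF t(1), of j] that by simp
        then show False using \<open>\<not> t \<le> j\<close> by simp
      qed
      have "(\<Sum>j\<in>?J. u (Suc j) - u j) = (\<Sum>j\<in>?J. w (Suc j) - w j) - (\<Sum>j\<in>?J. w' (Suc j) - w' j)"
        unfolding u_def sum_subtractf[symmetric] by (rule sum.cong) auto
      also have "\<dots> = 0" using W tp by auto
      finally have z: "(\<Sum>j\<in>?J. u (Suc j) - u j) = 0" .
      have "(\<Sum>j\<in>?J. u (Suc j)) = 0" using J later by (intro sum.neutral) fastforce
      moreover have "(\<Sum>j\<in>?J. u j) = u t"
      proof -
        have "(\<Sum>j\<in>?J. u j) = (\<Sum>j\<in>{t}. u j)"
        proof (rule sum.mono_neutral_right)
          show "\<forall>j\<in>?J - {t}. u j = 0"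
          proof
            fix j assume "j \<in> ?J - {t}"
            then show "u j = 0" using later[of j] J[of j] by simp
          qed
        qed (use tp in auto)
        then show ?thesis by simp
      qed
      ultimately show False using z t by (simp add: sum_subtractf)
    qed
    then have all: "u j = 0" if "j \<le> p" for j
      using off[of j] up that by (cases "j = p") auto
    show "w = w'"
    proof
      fix j show "w j = w' j"
      proof (cases "j \<le> p")
        case True then show ?thesis using all[of j] unfolding u_def by simp
      next
        case False then show ?thesis using W by (auto simp: PiE_def extensional_def)
      qed
    qed
  qed
  then have "card ?W \<le> card (({..<p} - F) \<rightarrow>\<^sub>E B)"
  proof (rule card_inj_on_le)
    show "(\<lambda>w. restrict w ({..<p} - F)) ` ?W \<subseteq> ({..<p} - F) \<rightarrow>\<^sub>E B" by (auto simp: PiE_def Pi_def)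
    show "finite (({..<p} - F) \<rightarrow>\<^sub>E B)" using assms(1) by (intro finite_PiE) auto
  qed
  also have "\<dots> = card B ^ (p - card F)"
    using Fsub finF by (simp add: card_PiE card_Diff_subset)
  also have "p - card F = p + 1 - card (\<iota> ` {..<p})"
  proof -
    have "card (\<iota> ` {..<p}) > 0" using \<open>0 < p\<close> by (subst card_gt_0_iff) (auto simp: lessThan_empty_iff)
    then show ?thesis using cardF by simp
  qed
  finally show ?thesis .
qed

text \<open>A label that occurs only once forces its step to be zero.\<close>

lemma card_labels_le_half:
  fixes \<iota> :: "nat \<Rightarrow> 'a" and w :: "nat \<Rightarrow> 'k::ab_group_add"
  assumes step: "\<And>j. j < p \<Longrightarrow> w (Suc j) \<noteq> w j"
    and bal: "\<And>a. a \<in> \<iota> ` {..<p} \<Longrightarrow> (\<Sum>j | j < p \<and> \<iota> j = a. w (Suc j) - w j) = 0"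
  shows "2 * card (\<iota> ` {..<p}) \<le> p"
proof -
  have "p = card (\<Union>a\<in>\<iota> ` {..<p}. {j. j < p \<and> \<iota> j = a})"
    by (subgoal_tac "(\<Union>a\<in>\<iota> ` {..<p}. {j. j < p \<and> \<iota> j = a}) = {..<p}") auto
  also have "\<dots> = (\<Sum>a\<in>\<iota> ` {..<p}. card {j. j < p \<and> \<iota> j = a})"
    by (rule card_UN_disjoint) auto
  finally have eq: "p = (\<Sum>a\<in>\<iota> ` {..<p}. card {j. j < p \<and> \<iota> j = a})" .
  have "2 \<le> card {j. j < p \<and> \<iota> j = a}" if "a \<in> \<iota> ` {..<p}" for a
  proof (rule ccontr)
    assume "\<not> ?thesis"
    moreover have "card {j. j < p \<and> \<iota> j = a} \<noteq> 0" using that by auto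
    ultimately have "card {j. j < p \<and> \<iota> j = a} = 1" by linarith
    then obtain j where "{j. j < p \<and> \<iota> j = a} = {j}" by (auto simp: card_1_singleton_iff)
    then show False using bal[OF that] step[of j] by auto
  qed
  then have "(\<Sum>a\<in>\<iota> ` {..<p}. 2) \<le> (\<Sum>a\<in>\<iota> ` {..<p}. card {j. j < p \<and> \<iota> j = a})"
    by (rule sum_mono)
  then show ?thesis using eq by simp
qed

lemma power_self_le_exp_fact: "real b ^ b \<le> exp (real b) * fact b"
proof -
  have "real b ^ b /\<^sub>R fact b \<le> (\<Sum>n. real b ^ n /\<^sub>R fact n)"
    using sum_le_suminf[OF summable_exp_generic[of "real b"], of "{b}"] by simp
  then show ?thesis by (simp add: exp_def divide_simps mult.commute)
qed

text \<open>There are at most \<open>(card I choose b) * b ^ p\<close> labellings with exactly \<open>b\<close> labels, and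
  \<open>(card I choose b) * b ^ b \<le> card I ^ b * exp b\<close>.\<close>

lemma sum_over_labellings_le:
  fixes g :: "nat \<Rightarrow> real"
  assumes "finite I" "0 < p" and g: "\<And>b. 0 \<le> g b" and big: "\<And>b. r < b \<Longrightarrow> g b = 0" and rp: "r \<le> p"
  shows "(\<Sum>\<iota>\<in>{..<p} \<rightarrow>\<^sub>E I. g (card (\<iota> ` {..<p})))
         \<le> (\<Sum>b=1..r. real (card I) ^ b * exp (real b) * real b ^ (p - b) * g b)"
proof -
  let ?P = "{..<p} \<rightarrow>\<^sub>E I"
  have finP: "finite ?P" using assms by (intro finite_PiE) auto
  have im: "card (\<iota> ` {..<p}) \<noteq> 0" for \<iota> :: "nat \<Rightarrow> 'a" using \<open>0 < p\<close> by auto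
  have "(\<Sum>\<iota>\<in>?P. g (card (\<iota> ` {..<p})))
      = (\<Sum>\<iota>\<in>{\<iota>\<in>?P. card (\<iota> ` {..<p}) \<le> r}. g (card (\<iota> ` {..<p})))"
    by (rule sum.mono_neutral_right) (use finP big in \<open>simp_all add: subset_iff not_le\<close>)
  also have "\<dots> = (\<Sum>b\<in>{1..r}. \<Sum>\<iota>\<in>{\<iota>\<in>{\<iota>\<in>?P. card (\<iota> ` {..<p}) \<le> r}. card (\<iota> ` {..<p}) = b}.
        g (card (\<iota> ` {..<p})))"
  proof (rule sum.group[symmetric])
    show "(\<lambda>\<iota>. card (\<iota> ` {..<p})) ` {\<iota>\<in>?P. card (\<iota> ` {..<p}) \<le> r} \<subseteq> {1..r}"
    proof (rule image_subsetI)
      fix \<iota> assume "\<iota> \<in> {\<iota>\<in>?P. card (\<iota> ` {..<p}) \<le> r}"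
      then show "card (\<iota> ` {..<p}) \<in> {1..r}" using im[of \<iota>] by (metis (no_types, lifting) atLeastAtMost_iff less_one linorder_not_le mem_Collect_eq)
    qed
  qed (use finP in simp_all)
  also have "\<dots> \<le> (\<Sum>b=1..r. real (card I) ^ b * exp (real b) * real b ^ (p - b) * g b)"
  proof (rule sum_mono)
    fix b assume b: "b \<in> {1..r}"
    let ?S = "{\<iota>\<in>{\<iota>\<in>?P. card (\<iota> ` {..<p}) \<le> r}. card (\<iota> ` {..<p}) = b}"
    let ?U = "{U. U \<subseteq> I \<and> card U = b}"
    have "?S \<subseteq> (\<Union>U\<in>?U. {..<p} \<rightarrow>\<^sub>E U)"
    proof
      fix \<iota> assume "\<iota> \<in> ?S"
      then have "\<iota> \<in> ?P" "card (\<iota> ` {..<p}) = b" by simp_all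
      moreover from this have "\<iota> ` {..<p} \<subseteq> I" by (simp add: PiE_iff image_subset_iff)
      moreover have "\<iota> \<in> {..<p} \<rightarrow>\<^sub>E \<iota> ` {..<p}" using \<open>\<iota> \<in> ?P\<close> by (simp add: PiE_iff)
      ultimately show "\<iota> \<in> (\<Union>U\<in>?U. {..<p} \<rightarrow>\<^sub>E U)" by (intro UN_I[of "\<iota> ` {..<p}"]) simp_all
    qed
    moreover have "finite (\<Union>U\<in>?U. {..<p} \<rightarrow>\<^sub>E U)"
    proof (rule finite_UN_I)
      show "finite ?U" using assms(1) by simp
    qed (use assms(1) in \<open>auto intro!: finite_PiE intro: finite_subset\<close>)
    ultimately have "card ?S \<le> card (\<Union>U\<in>?U. {..<p} \<rightarrow>\<^sub>E U)" by (rule card_mono[rotated])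
    also have "\<dots> \<le> (\<Sum>U\<in>?U. card ({..<p} \<rightarrow>\<^sub>E U))"
      by (rule card_UN_le) (use assms(1) in simp)
    also have "\<dots> = (\<Sum>U\<in>?U. b ^ p)"
      by (rule sum.cong) (simp_all add: card_PiE)
    also have "\<dots> = (card I choose b) * b ^ p" using assms(1) by (simp add: n_subsets)
    finally have "real (card ?S) \<le> real ((card I choose b) * b ^ p)" by (rule of_nat_mono)
    then have S: "real (card ?S) \<le> real (card I choose b) * real b ^ p" by simp
    have "real b ^ p = real b ^ b * real b ^ (p - b)"
      using b rp by (simp flip: power_add)
    also have "\<dots> \<le> exp (real b) * fact b * real b ^ (p - b)"
      by (intro mult_right_mono power_self_le_exp_fact) auto
    finally have bp: "real b ^ p \<le> exp (real b) * fact b * real b ^ (p - b)" .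
    have "real ((card I choose b) * fact b) \<le> real (card I ^ b)"
      by (rule of_nat_mono[OF binomial_fact_pow])
    then have ch: "real (card I choose b) * fact b \<le> real (card I) ^ b" by simp
    have "real (card ?S) \<le> real (card I choose b) * (exp (real b) * fact b * real b ^ (p - b))"
      by (rule order_trans[OF S]) (rule mult_left_mono[OF bp], simp)
    also have "\<dots> = (real (card I choose b) * fact b) * (exp (real b) * real b ^ (p - b))" by simp
    also have "\<dots> \<le> real (card I) ^ b * (exp (real b) * real b ^ (p - b))"
      using ch by (rule mult_right_mono) auto
    finally have "real (card ?S) * g b \<le> real (card I) ^ b * exp (real b) * real b ^ (p - b) * g b"
      using g[of b] by (intro mult_right_mono) (auto simp: mult.assoc)
    moreover have "(\<Sum>\<iota>\<in>?S. g (card (\<iota> ` {..<p}))) = real (card ?S) * g b" by simp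
    ultimately show "(\<Sum>\<iota>\<in>?S. g (card (\<iota> ` {..<p})))
        \<le> real (card I) ^ b * exp (real b) * real b ^ (p - b) * g b" by simp
  qed
  finally show ?thesis .
qed

section \<open>Traces of powers of Hermitian matrices\<close>

text \<open>Powers of a matrix whose rows and columns are indexed by a finite set \<open>B\<close> of arbitrary elements.\<close>

primrec kernel_power :: "'k set \<Rightarrow> ('k \<Rightarrow> 'k \<Rightarrow> complex) \<Rightarrow> nat \<Rightarrow> 'k \<Rightarrow> 'k \<Rightarrow> complex" where
  "kernel_power B X 0 = (\<lambda>k l. if k = l then 1 else 0)"
| "kernel_power B X (Suc p) = (\<lambda>k l. \<Sum>r\<in>B. kernel_power B X p k r * X r l)"

definition kernel_apply :: "'k set \<Rightarrow> ('k \<Rightarrow> 'k \<Rightarrow> complex) \<Rightarrow> ('k \<Rightarrow> complex) \<Rightarrow> 'k \<Rightarrow> complex" where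
  "kernel_apply B X v k = (\<Sum>l\<in>B. X k l * v l)"

lemma kernel_power_add:
  assumes "finite B" "k \<in> B" "l \<in> B"
  shows "kernel_power B X (a + b) k l = (\<Sum>r\<in>B. kernel_power B X a k r * kernel_power B X b r l)"
  using assms(3)
proof (induction b arbitrary: l)
  case 0
  have "(\<Sum>r\<in>B. kernel_power B X a k r * kernel_power B X 0 r l) =
        (\<Sum>r\<in>B. if r = l then kernel_power B X a k r else 0)"
    by (rule sum.cong) simp_all
  then show ?case using assms(1) 0 by simp
next
  case (Suc b)
  have "kernel_power B X (a + Suc b) k l = (\<Sum>t\<in>B. kernel_power B X (a + b) k t * X t l)" by simp
  also have "\<dots> = (\<Sum>t\<in>B. \<Sum>r\<in>B. kernel_power B X a k r * kernel_power B X b r t * X t l)"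
    using Suc.IH by (intro sum.cong) (simp_all add: sum_distrib_right)
  also have "\<dots> = (\<Sum>r\<in>B. \<Sum>t\<in>B. kernel_power B X a k r * kernel_power B X b r t * X t l)"
    by (rule sum.swap)
  also have "\<dots> = (\<Sum>r\<in>B. kernel_power B X a k r * kernel_power B X (Suc b) r l)"
    by (simp add: sum_distrib_left mult.assoc)
  finally show ?case .
qed

text \<open>An entry of the \<open>p\<close>-th power is a sum over walks of length \<open>p\<close>; summation over the last inner vertex
  turns a walk of length \<open>Suc p\<close> into one of length \<open>p\<close>.\<close>

lemma kernel_power_walks:
  assumes "finite B" "k \<in> B" "l \<in> B"
  shows "kernel_power B X p k l =
    (\<Sum>w | w \<in> {..p} \<rightarrow>\<^sub>E B \<and> w 0 = k \<and> w p = l. \<Prod>j<p. X (w j) (w (Suc j)))"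
  using assms(3)
proof (induction p arbitrary: l)
  case 0
  have "{w. w \<in> {..0::nat} \<rightarrow>\<^sub>E B \<and> w 0 = k \<and> w 0 = l} = (if k = l then {\<lambda>j\<in>{..0}. k} else {})"
    using assms(2) by (auto simp: PiE_iff extensional_def fun_eq_iff)
  then show ?case by simp
next
  case (Suc p)
  have fin: "finite {w. w \<in> {..p} \<rightarrow>\<^sub>E B \<and> w 0 = k}"
    using assms(1) by (intro finite_subset[OF _ finite_PiE[of "{..p}" "\<lambda>_. B"]]) auto
  have "kernel_power B X (Suc p) k l =
      (\<Sum>r\<in>B. \<Sum>w | w \<in> {..p} \<rightarrow>\<^sub>E B \<and> w 0 = k \<and> w p = r. (\<Prod>j<p. X (w j) (w (Suc j))) * X (w p) l)"
    using Suc.IH by (simp add: sum_distrib_right)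
  also have "\<dots> = (\<Sum>r\<in>B. \<Sum>w\<in>{w \<in> {w. w \<in> {..p} \<rightarrow>\<^sub>E B \<and> w 0 = k}. w p = r}.
                    (\<Prod>j<p. X (w j) (w (Suc j))) * X (w p) l)"
    by (intro sum.cong) auto
  also have "\<dots> = (\<Sum>w | w \<in> {..p} \<rightarrow>\<^sub>E B \<and> w 0 = k. (\<Prod>j<p. X (w j) (w (Suc j))) * X (w p) l)"
    using fin assms(1) by (intro sum.group) auto
  also have "\<dots> = (\<Sum>w | w \<in> {..Suc p} \<rightarrow>\<^sub>E B \<and> w 0 = k \<and> w (Suc p) = l.
                    \<Prod>j<Suc p. X (w j) (w (Suc j)))"
  proof (rule sum.reindex_bij_witness[of _ "\<lambda>w. restrict w {..p}" "\<lambda>w. w(Suc p := l)"])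
    fix w assume w: "w \<in> {w. w \<in> {..p} \<rightarrow>\<^sub>E B \<and> w 0 = k}"
    show "restrict (w(Suc p := l)) {..p} = w"
      using w by (auto simp: fun_eq_iff PiE_iff extensional_def)
    show "w(Suc p := l) \<in> {w. w \<in> {..Suc p} \<rightarrow>\<^sub>E B \<and> w 0 = k \<and> w (Suc p) = l}"
      using w Suc.prems by (auto simp: PiE_iff extensional_def)
    have "(\<Prod>j<p. X ((w(Suc p := l)) j) ((w(Suc p := l)) (Suc j))) = (\<Prod>j<p. X (w j) (w (Suc j)))"
      by (rule prod.cong) auto
    then show "(\<Prod>j<Suc p. X ((w(Suc p := l)) j) ((w(Suc p := l)) (Suc j))) =
      (\<Prod>j<p. X (w j) (w (Suc j))) * X (w p) l" by simp
  next
    fix w assume w: "w \<in> {w. w \<in> {..Suc p} \<rightarrow>\<^sub>E B \<and> w 0 = k \<and> w (Suc p) = l}"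
    then show "(restrict w {..p})(Suc p := l) = w"
      by (auto simp: fun_eq_iff PiE_iff extensional_def)
    show "restrict w {..p} \<in> {w. w \<in> {..p} \<rightarrow>\<^sub>E B \<and> w 0 = k}"
      using w by (auto simp: PiE_iff)
  qed
  finally show ?case .
qed

lemma trace_kernel_power_walks:
  assumes "finite B"
  shows "(\<Sum>k\<in>B. kernel_power B X p k k) =
    (\<Sum>w | w \<in> {..p} \<rightarrow>\<^sub>E B \<and> w 0 = w p. \<Prod>j<p. X (w j) (w (Suc j)))"
proof -
  have fin: "finite {w. w \<in> {..p} \<rightarrow>\<^sub>E B \<and> w 0 = w p}"
    using assms by (intro finite_subset[OF _ finite_PiE[of "{..p}" "\<lambda>_. B"]]) auto
  have "(\<Sum>k\<in>B. kernel_power B X p k k) =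
      (\<Sum>k\<in>B. \<Sum>w\<in>{w \<in> {w. w \<in> {..p} \<rightarrow>\<^sub>E B \<and> w 0 = w p}. w 0 = k}. \<Prod>j<p. X (w j) (w (Suc j)))"
    using assms by (intro sum.cong) (auto simp: kernel_power_walks intro!: sum.cong)
  also have "\<dots> = (\<Sum>w | w \<in> {..p} \<rightarrow>\<^sub>E B \<and> w 0 = w p. \<Prod>j<p. X (w j) (w (Suc j)))"
    using fin assms by (intro sum.group) auto
  finally show ?thesis .
qed

lemma kernel_power_1:
  assumes "finite B" "k \<in> B" shows "kernel_power B X 1 k l = X k l"
proof -
  have "kernel_power B X 1 k l = (\<Sum>r\<in>B. if r = k then X r l else 0)"
    unfolding One_nat_def kernel_power.simps by (rule sum.cong) auto
  then show ?thesis using assms by simp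
qed

lemma hermitian_kernel_power:
  assumes "finite B" and herm: "\<And>k l. k \<in> B \<Longrightarrow> l \<in> B \<Longrightarrow> X l k = cnj (X k l)"
    and "k \<in> B" "l \<in> B"
  shows "kernel_power B X p l k = cnj (kernel_power B X p k l)"
  using assms(3,4)
proof (induction p arbitrary: k l)
  case 0 then show ?case by simp
next
  case (Suc p)
  have "cnj (kernel_power B X (Suc p) k l) = (\<Sum>r\<in>B. cnj (kernel_power B X p k r) * cnj (X r l))"
    by simp
  also have "\<dots> = (\<Sum>r\<in>B. kernel_power B X 1 l r * kernel_power B X p r k)"
  proof (rule sum.cong[OF refl])
    fix r assume r: "r \<in> B"
    show "cnj (kernel_power B X p k r) * cnj (X r l) = kernel_power B X 1 l r * kernel_power B X p r k"
      using Suc.IH[OF Suc.prems(1) r] herm[OF r Suc.prems(2)]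
        kernel_power_1[OF assms(1) Suc.prems(2), of X r] by (simp only: mult.commute)
  qed
  also have "\<dots> = kernel_power B X (1 + p) l k"
    using assms(1) Suc.prems by (intro kernel_power_add[symmetric])
  finally show ?case by (simp only: plus_1_eq_Suc)
qed

lemma cmod_sum_mult_le:
  "cmod (\<Sum>k\<in>B. x k * y k) \<le> L2_set (\<lambda>k. cmod (x k)) B * L2_set (\<lambda>k. cmod (y k)) B"
proof -
  have "cmod (\<Sum>k\<in>B. x k * y k) \<le> (\<Sum>k\<in>B. \<bar>cmod (x k)\<bar> * \<bar>cmod (y k)\<bar>)"
    by (rule order_trans[OF norm_sum]) (simp add: norm_mult)
  also have "\<dots> \<le> L2_set (\<lambda>k. cmod (x k)) B * L2_set (\<lambda>k. cmod (y k)) B"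
    by (rule L2_set_mult_ineq)
  finally show ?thesis .
qed

lemma L2_set_squared: "(L2_set f A)\<^sup>2 = (\<Sum>k\<in>A. (f k)\<^sup>2)"
  by (simp add: L2_set_def sum_nonneg)

text \<open>For Hermitian \<open>Y\<close> with square \<open>Z\<close>, the squared norm of \<open>Y v\<close> is the inner product of \<open>v\<close> and \<open>Z v\<close>.\<close>

lemma norm_kernel_apply_square_le:
  assumes "finite B" and herm: "\<And>k l. k \<in> B \<Longrightarrow> l \<in> B \<Longrightarrow> Y l k = cnj (Y k l)"
    and Z: "\<And>k l. k \<in> B \<Longrightarrow> l \<in> B \<Longrightarrow> Z k l = (\<Sum>r\<in>B. Y k r * Y r l)"
  shows "(L2_set (\<lambda>k. cmod (kernel_apply B Y v k)) B)\<^sup>2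
    \<le> L2_set (\<lambda>k. cmod (v k)) B * L2_set (\<lambda>k. cmod (kernel_apply B Z v k)) B"
proof -
  have "complex_of_real ((L2_set (\<lambda>k. cmod (kernel_apply B Y v k)) B)\<^sup>2)
      = (\<Sum>k\<in>B. cnj (kernel_apply B Y v k) * kernel_apply B Y v k)"
    by (simp add: L2_set_squared complex_norm_square[symmetric] mult.commute del: of_real_power)
  also have "\<dots> = (\<Sum>k\<in>B. \<Sum>l\<in>B. cnj (v l) * (Y l k * kernel_apply B Y v k))"
  proof (rule sum.cong[OF refl])
    fix k assume k: "k \<in> B"
    have "cnj (kernel_apply B Y v k) = (\<Sum>l\<in>B. cnj (v l) * Y l k)"
      unfolding kernel_apply_def cnj_sum complex_cnj_mult
      by (rule sum.cong[OF refl]) (simp only: herm[OF k] mult.commute)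
    then show "cnj (kernel_apply B Y v k) * kernel_apply B Y v k
        = (\<Sum>l\<in>B. cnj (v l) * (Y l k * kernel_apply B Y v k))"
      by (simp only: sum_distrib_right mult.assoc)
  qed
  also have "\<dots> = (\<Sum>l\<in>B. cnj (v l) * (\<Sum>k\<in>B. Y l k * kernel_apply B Y v k))"
    by (subst sum.swap) (simp add: sum_distrib_left)
  also have "\<dots> = (\<Sum>l\<in>B. cnj (v l) * kernel_apply B Z v l)"
  proof (rule sum.cong[OF refl])
    fix l assume l: "l \<in> B"
    have "(\<Sum>k\<in>B. Y l k * kernel_apply B Y v k) = (\<Sum>k\<in>B. \<Sum>t\<in>B. Y l k * Y k t * v t)"
      by (simp add: kernel_apply_def sum_distrib_left mult.assoc)
    also have "\<dots> = (\<Sum>t\<in>B. \<Sum>k\<in>B. Y l k * Y k t * v t)" by (rule sum.swap)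
    also have "\<dots> = kernel_apply B Z v l"
      using l by (simp add: kernel_apply_def Z sum_distrib_right)
    finally show "cnj (v l) * (\<Sum>k\<in>B. Y l k * kernel_apply B Y v k) = cnj (v l) * kernel_apply B Z v l"
      by simp
  qed
  finally have "(L2_set (\<lambda>k. cmod (kernel_apply B Y v k)) B)\<^sup>2 = cmod (\<Sum>l\<in>B. cnj (v l) * kernel_apply B Z v l)"
    by (metis abs_of_nonneg norm_of_real zero_le_power2)
  also have "\<dots> \<le> L2_set (\<lambda>k. cmod (cnj (v k))) B * L2_set (\<lambda>k. cmod (kernel_apply B Z v k)) B"
    by (rule cmod_sum_mult_le)
  finally show ?thesis by simp
qed

text \<open>Iterated squaring replaces the spectral theorem: it controls the norm of a Hermitian matrix by the norms
  of its powers, as long as the exponent is a power of two.\<close>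

lemma norm_kernel_apply_power_le:
  assumes "finite B" and herm: "\<And>k l. k \<in> B \<Longrightarrow> l \<in> B \<Longrightarrow> X l k = cnj (X k l)"
  shows "L2_set (\<lambda>k. cmod (kernel_apply B X v k)) B ^ (2 ^ n)
    \<le> L2_set (\<lambda>k. cmod (kernel_apply B (kernel_power B X (2 ^ n)) v k)) B
        * L2_set (\<lambda>k. cmod (v k)) B ^ (2 ^ n - 1)"
proof (induction n)
  case 0
  have "kernel_apply B (kernel_power B X 1) v k = kernel_apply B X v k" if "k \<in> B" for k
    using assms(1) that unfolding kernel_apply_def by (simp only: kernel_power_1)
  then have "L2_set (\<lambda>k. cmod (kernel_apply B (kernel_power B X 1) v k)) B = L2_set (\<lambda>k. cmod (kernel_apply B X v k)) B"
    by (intro L2_set_cong) auto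
  then show ?case by (simp del: One_nat_def)
next
  case (Suc n)
  define V where "V = L2_set (\<lambda>k. cmod (v k)) B"
  define N where "N p = L2_set (\<lambda>k. cmod (kernel_apply B (kernel_power B X p) v k)) B" for p
  have V0: "0 \<le> V" unfolding V_def by simp
  have "L2_set (\<lambda>k. cmod (kernel_apply B X v k)) B ^ (2 ^ Suc n)
      = (L2_set (\<lambda>k. cmod (kernel_apply B X v k)) B ^ (2 ^ n))\<^sup>2"
    by (simp only: power_Suc power_even_eq)
  also have "\<dots> \<le> (N (2 ^ n) * V ^ (2 ^ n - 1))\<^sup>2"
    using Suc.IH unfolding N_def V_def by (intro power_mono) simp_all
  also have "\<dots> = (N (2 ^ n))\<^sup>2 * V ^ (2 * (2 ^ n - 1))"
    by (simp only: power_mult_distrib power_even_eq)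
  also have "(N (2 ^ n))\<^sup>2 \<le> V * N (2 ^ Suc n)"
    unfolding N_def V_def
  proof (rule norm_kernel_apply_square_le[OF assms(1)])
    fix k l assume kl: "k \<in> B" "l \<in> B"
    show "kernel_power B X (2 ^ n) l k = cnj (kernel_power B X (2 ^ n) k l)"
      by (rule hermitian_kernel_power[OF assms(1) _ kl]) (rule herm)
    have "kernel_power B X (2 ^ n + 2 ^ n) k l = (\<Sum>r\<in>B. kernel_power B X (2 ^ n) k r * kernel_power B X (2 ^ n) r l)"
      by (rule kernel_power_add[OF assms(1) kl])
    then show "kernel_power B X (2 ^ Suc n) k l = (\<Sum>r\<in>B. kernel_power B X (2 ^ n) k r * kernel_power B X (2 ^ n) r l)"
      by (simp add: mult_2)
  qed
  also have "V * N (2 ^ Suc n) * V ^ (2 * (2 ^ n - 1)) = N (2 ^ Suc n) * V ^ Suc (2 * (2 ^ n - 1))"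
    by simp
  also have "Suc (2 * (2 ^ n - 1)) = 2 ^ Suc n - (1::nat)"
  proof -
    have "1 \<le> (2::nat) ^ n" by simp
    then show ?thesis unfolding power_Suc by linarith
  qed
  finally show ?case using V0 unfolding N_def V_def by (simp add: mult_right_mono)
qed

text \<open>The trace of an even power is a squared Frobenius norm, hence nonnegative.\<close>

lemma trace_kernel_power_even:
  assumes "finite B" and herm: "\<And>k l. k \<in> B \<Longrightarrow> l \<in> B \<Longrightarrow> X l k = cnj (X k l)"
  shows "Re (\<Sum>k\<in>B. kernel_power B X (2 * q) k k) = (\<Sum>k\<in>B. \<Sum>l\<in>B. (cmod (kernel_power B X q k l))\<^sup>2)"
proof -
  let ?Y = "kernel_power B X q"
  have "(\<Sum>k\<in>B. kernel_power B X (2 * q) k k) = (\<Sum>k\<in>B. \<Sum>l\<in>B. ?Y k l * ?Y l k)"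
    using assms(1) unfolding mult_2 by (intro sum.cong) (simp_all add: kernel_power_add)
  also have "\<dots> = (\<Sum>k\<in>B. \<Sum>l\<in>B. of_real ((cmod (?Y k l))\<^sup>2))"
  proof (intro sum.cong[OF refl])
    fix k l assume kl: "k \<in> B" "l \<in> B"
    have "?Y l k = cnj (?Y k l)" by (rule hermitian_kernel_power[OF assms(1) _ kl]) (rule herm)
    then show "?Y k l * ?Y l k = of_real ((cmod (?Y k l))\<^sup>2)"
      by (simp only: complex_norm_square)
  qed
  finally show ?thesis by simp
qed

lemma norm_kernel_apply_le_trace:
  assumes "finite B" and herm: "\<And>k l. k \<in> B \<Longrightarrow> l \<in> B \<Longrightarrow> X l k = cnj (X k l)"
    and q: "q = 2 ^ n" and \<delta>: "0 \<le> \<delta>"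
    and tr: "Re (\<Sum>k\<in>B. kernel_power B X (2 * q) k k) \<le> \<delta> ^ (2 * q)"
  shows "L2_set (\<lambda>k. cmod (kernel_apply B X v k)) B \<le> \<delta> * L2_set (\<lambda>k. cmod (v k)) B"
proof -
  define V where "V = L2_set (\<lambda>k. cmod (v k)) B"
  define Y where "Y = kernel_power B X q"
  have V0: "0 \<le> V" unfolding V_def by simp
  have q1: "1 \<le> q" using q by simp
  have tr_eq: "Re (\<Sum>k\<in>B. kernel_power B X (2 * q) k k) = (\<Sum>k\<in>B. \<Sum>l\<in>B. (cmod (Y k l))\<^sup>2)"
    unfolding Y_def by (rule trace_kernel_power_even[OF assms(1)]) (rule herm)
  have "(L2_set (\<lambda>k. cmod (kernel_apply B Y v k)) B)\<^sup>2 = (\<Sum>k\<in>B. (cmod (kernel_apply B Y v k))\<^sup>2)"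
    by (rule L2_set_squared)
  also have "\<dots> \<le> (\<Sum>k\<in>B. (\<Sum>l\<in>B. (cmod (Y k l))\<^sup>2) * V\<^sup>2)"
  proof (rule sum_mono)
    fix k
    have "cmod (kernel_apply B Y v k) \<le> L2_set (\<lambda>l. cmod (Y k l)) B * V"
      unfolding kernel_apply_def V_def by (rule cmod_sum_mult_le)
    then have "(cmod (kernel_apply B Y v k))\<^sup>2 \<le> (L2_set (\<lambda>l. cmod (Y k l)) B * V)\<^sup>2"
      by (rule power_mono) simp
    then show "(cmod (kernel_apply B Y v k))\<^sup>2 \<le> (\<Sum>l\<in>B. (cmod (Y k l))\<^sup>2) * V\<^sup>2"
      by (simp add: power_mult_distrib L2_set_squared)
  qed
  also have "\<dots> = Re (\<Sum>k\<in>B. kernel_power B X (2 * q) k k) * V\<^sup>2"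
    unfolding tr_eq by (simp add: sum_distrib_right)
  also have "\<dots> \<le> \<delta> ^ (2 * q) * V\<^sup>2" using tr by (rule mult_right_mono) simp
  finally have Y2: "(L2_set (\<lambda>k. cmod (kernel_apply B Y v k)) B)\<^sup>2 \<le> \<delta> ^ (2 * q) * V\<^sup>2" .
  have "L2_set (\<lambda>k. cmod (kernel_apply B X v k)) B ^ (2 * q)
      = (L2_set (\<lambda>k. cmod (kernel_apply B X v k)) B ^ q)\<^sup>2"
    by (simp only: power_even_eq)
  also have "\<dots> \<le> (L2_set (\<lambda>k. cmod (kernel_apply B Y v k)) B * V ^ (q - 1))\<^sup>2"
    unfolding Y_def V_def q
    by (rule power_mono[OF norm_kernel_apply_power_le[OF assms(1)]]) (rule herm, assumption+, simp)
  also have "\<dots> = (L2_set (\<lambda>k. cmod (kernel_apply B Y v k)) B)\<^sup>2 * V ^ (2 * (q - 1))"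
    by (simp only: power_mult_distrib power_even_eq)
  also have "\<dots> \<le> \<delta> ^ (2 * q) * V\<^sup>2 * V ^ (2 * (q - 1))"
    using Y2 V0 by (intro mult_right_mono) simp_all
  also have "\<dots> = (\<delta> * V) ^ (2 * q)"
  proof -
    have "2 * q = 2 + 2 * (q - 1)" using q1 by simp
    then have "V ^ (2 * q) = V\<^sup>2 * V ^ (2 * (q - 1))" by (metis power_add)
    then show ?thesis by (simp add: power_mult_distrib)
  qed
  finally have "L2_set (\<lambda>k. cmod (kernel_apply B X v k)) B ^ Suc (2 * q - 1) \<le> (\<delta> * V) ^ Suc (2 * q - 1)"
    using q1 by simp
  moreover have "0 \<le> \<delta> * V" using \<delta> V0 by simp
  ultimately show ?thesis unfolding V_def[symmetric] by (rule power_le_imp_le_base)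
qed

section \<open>Characters of the torus\<close>

lemma torus_sandwich: "box 0 1 \<subseteq> (torus :: (real ^ 'd) set)" "(torus :: (real ^ 'd) set) \<subseteq> cbox 0 1"
  by (auto simp: torus_def mem_box_cart less_imp_le)

lemma torus_borel [measurable]: "(torus :: (real ^ 'd) set) \<in> sets borel"
proof -
  have "(torus :: (real ^ 'd) set) = (\<Inter>j\<in>UNIV. {x. 0 \<le> x $ j \<and> x $ j < 1})"
    by (auto simp: torus_def)
  also have "\<dots> \<in> sets borel" by measurable
  finally show ?thesis .
qed

lemma space_torus_measure [simp]: "space torus_measure = torus"
  by (simp add: torus_measure_def space_restrict_space)

lemma sets_torus_measure: "sets torus_measure = sets (restrict_space borel torus)"
  by (simp add: torus_measure_def sets_restrict_space)

text \<open>The half-open cube lies between the open and the closed cube, which have the same volume.\<close>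

lemma emeasure_torus: "emeasure lborel (torus :: (real ^ 'd) set) = 1"
proof (rule antisym)
  have le: "\<And>b. b \<in> Basis \<Longrightarrow> (0 :: real ^ 'd) \<bullet> b \<le> 1 \<bullet> b"
    by (auto simp: Basis_vec_def inner_axis)
  have one: "(\<Prod>b\<in>Basis. (1 - (0 :: real ^ 'd)) \<bullet> b) = 1"
    by (intro prod.neutral) (auto simp: Basis_vec_def inner_axis)
  have c: "emeasure lborel (cbox 0 1 :: (real ^ 'd) set) = 1" "emeasure lborel (box 0 1 :: (real ^ 'd) set) = 1"
    by (simp_all only: emeasure_lborel_cbox[OF le] emeasure_lborel_box[OF le] one) simp_all
  have "emeasure lborel (torus :: (real ^ 'd) set) \<le> emeasure lborel (cbox 0 1 :: (real ^ 'd) set)"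
    by (rule emeasure_mono[OF torus_sandwich(2)]) simp
  then show "emeasure lborel (torus :: (real ^ 'd) set) \<le> 1" unfolding c .
  have "emeasure lborel (box 0 1 :: (real ^ 'd) set) \<le> emeasure lborel (torus :: (real ^ 'd) set)"
    by (rule emeasure_mono[OF torus_sandwich(1)]) (simp add: torus_borel)
  then show "1 \<le> emeasure lborel (torus :: (real ^ 'd) set)" unfolding c .
qed

lemma prob_space_torus: "prob_space (torus_measure :: (real ^ 'd) measure)"
proof
  show "emeasure (torus_measure :: (real ^ 'd) measure) (space torus_measure) = 1"
    using emeasure_torus by (simp add: torus_measure_def emeasure_restrict_space)
qed

lemma borel_measurable_torus_measure:
  "f \<in> borel_measurable borel \<Longrightarrow> f \<in> borel_measurable torus_measure"
  by (simp add: torus_measure_def measurable_restrict_space1)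


lemma fourier_basis_add: "fourier_basis (k + l) x = fourier_basis k x * fourier_basis l x"
  by (simp add: fourier_basis_def exp_add[symmetric] sum.distrib algebra_simps)

lemma fourier_basis_0 [simp]: "fourier_basis 0 x = 1"
  by (simp add: fourier_basis_def)

lemma fourier_basis_cnj: "cnj (fourier_basis k x) = fourier_basis (- k) x"
  by (simp add: fourier_basis_def exp_cnj sum_negf)

lemma norm_fourier_basis [simp]: "cmod (fourier_basis k x) = 1"
  by (simp add: fourier_basis_def)

lemma fourier_basis_diff: "fourier_basis (k - l) x = fourier_basis k x * cnj (fourier_basis l x)"
  using fourier_basis_add[of k "- l" x] by (simp add: fourier_basis_cnj)

lemma fourier_basis_sum: "finite A \<Longrightarrow> fourier_basis (\<Sum>j\<in>A. e j) x = (\<Prod>j\<in>A. fourier_basis (e j) x)"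
  by (induction A rule: finite_induct) (simp_all add: fourier_basis_add)

lemma continuous_fourier_basis: "continuous_on S (fourier_basis k)"
  unfolding fourier_basis_def by (intro continuous_intros)

lemma fourier_basis_periodic:
  "fourier_basis k (x + (\<chi> j. of_int (z $ j))) = fourier_basis k x"
proof -
  have "exp (2 * of_real pi * \<i> * of_real (\<Sum>j\<in>UNIV. of_int (k $ j) * of_int (z $ j)) :: complex)
      = exp ((2 * of_int (\<Sum>j\<in>UNIV. k $ j * z $ j) * pi) * \<i>)"
    by (simp add: mult_ac)
  also have "\<dots> = 1" by (rule exp_integer_2pi) (auto intro!: Ints_sum Ints_mult)
  finally show ?thesis
    by (simp add: fourier_basis_def exp_add sum.distrib distrib_left)
qed

lemma borel_measurable_fourier_basis [measurable]: "fourier_basis k \<in> borel_measurable borel"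
  using borel_measurable_continuous_onI[OF continuous_fourier_basis] .

lemma integral_character_unit_interval:
  "integrable lborel (\<lambda>t::real. indicator {0..<1} t *\<^sub>R exp (2 * of_real pi * \<i> * of_real (of_int n * t)))"
  "(\<integral>t. indicator {0..<1} t *\<^sub>R exp (2 * of_real pi * \<i> * of_real (of_int n * t)) \<partial>lborel)
     = (if n = 0 then 1 else 0 :: complex)"
proof -
  let ?f = "\<lambda>t::real. exp (2 * of_real pi * \<i> * of_real (of_int n * t)) :: complex"
  have cont: "continuous_on {0..1} ?f" by (intro continuous_intros)
  have "has_bochner_integral lborel (\<lambda>t. indicator {0..1} t *\<^sub>R ?f t) (if n = 0 then 1 else 0 :: complex)"
  proof (cases "n = 0")
    case True
    have "has_bochner_integral lborel (\<lambda>t::real. indicator {0..1} t *\<^sub>R (1::complex)) (of_real (1::real) - of_real 0)"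
    proof (rule has_bochner_integral_FTC_Icc)
      fix t :: real
      show "(complex_of_real has_vector_derivative 1) (at t within {0..1})"
        using has_vector_derivative_of_real[of "\<lambda>t. t" 1 "at t within {0..1}"] by (simp add: has_real_derivative_iff_has_vector_derivative)
    qed (auto intro!: continuous_intros)
    then show ?thesis using True by simp
  next
    case False
    let ?F = "\<lambda>t::real. ?f t / (2 * of_real pi * \<i> * of_int n)"
    have d: "(?F has_vector_derivative ?f t) (at t within {0..1})" for t
    proof -
      have "((\<lambda>z. exp (2 * of_real pi * \<i> * (of_int n * z)) / (2 * of_real pi * \<i> * of_int n))
          has_field_derivative exp (2 * of_real pi * \<i> * (of_int n * of_real t))) (at (of_real t))"
        using False by (auto intro!: derivative_eq_intros simp: field_simps)
      from has_vector_derivative_real_field[OF this] show ?thesis by simp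
    qed
    have "has_bochner_integral lborel (\<lambda>t. indicator {0..1} t *\<^sub>R ?f t) (?F 1 - ?F 0)"
      by (rule has_bochner_integral_FTC_Icc) (use d cont in auto)
    moreover have "?f 1 = 1"
      using exp_integer_2pi[of "of_int n"] by (simp add: mult_ac)
    ultimately show ?thesis using False by simp
  qed
  then have I: "integrable lborel (\<lambda>t. indicator {0..1} t *\<^sub>R ?f t)"
    "(\<integral>t. indicator {0..1} t *\<^sub>R ?f t \<partial>lborel) = (if n = 0 then 1 else 0 :: complex)"
    by (auto simp: has_bochner_integral_iff)
  have m: "?f \<in> borel_measurable borel"
    by (intro borel_measurable_continuous_onI continuous_intros)
  have ae: "AE t in lborel. indicator {0..1} t *\<^sub>R ?f t = indicator {0..<1} t *\<^sub>R ?f t"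
    using AE_lborel_singleton[of "1::real"] by eventually_elim (auto simp: indicator_def)
  have m1: "(\<lambda>t. indicator {0..1} t *\<^sub>R ?f t) \<in> borel_measurable lborel"
    and m2: "(\<lambda>t. indicator {0..<1} t *\<^sub>R ?f t) \<in> borel_measurable lborel"
    using m by auto
  show "integrable lborel (\<lambda>t. indicator {0..<1} t *\<^sub>R ?f t)"
    using I(1) integrable_cong_AE[OF m1 m2 ae] by simp
  show "(\<integral>t. indicator {0..<1} t *\<^sub>R ?f t \<partial>lborel) = (if n = 0 then 1 else 0 :: complex)"
    using I(2) integral_cong_AE[OF m1 m2 ae] by simp
qed

text \<open>The character is a product of functions of one coordinate, and Lebesgue measure is a product measure.\<close>

lemma integral_fourier_basis:
  "(LINT x|torus_measure. fourier_basis k x) = (if k = (0 :: int ^ 'd) then 1 else 0)"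
proof -
  define g :: "real ^ 'd \<Rightarrow> real \<Rightarrow> complex" where
    "g b t = indicator {0..<1} t *\<^sub>R exp (2 * of_real pi * \<i> * of_real (of_int (k $ (SOME j. b = axis j 1)) * t))" for b t
  have some: "(SOME i. axis j (1::real) = axis i 1) = (j::'d)" for j
    by (auto simp: axis_eq_axis)
  have basis: "(\<Prod>b\<in>Basis. h b) = (\<Prod>j\<in>UNIV. h (axis j 1))" for h :: "real ^ 'd \<Rightarrow> complex"
  proof -
    have B: "(Basis :: (real ^ 'd) set) = range (\<lambda>j. axis j 1)" by (auto simp: Basis_vec_def)
    show ?thesis unfolding B
      by (subst prod.reindex) (auto simp: inj_on_def axis_eq_axis)
  qed
  have ind: "indicator torus x *\<^sub>R fourier_basis k x = (\<Prod>b\<in>Basis. g b (x \<bullet> b))" for x :: "real ^ 'd"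
  proof -
    have "(\<Prod>b\<in>Basis. g b (x \<bullet> b)) = (\<Prod>j\<in>UNIV. indicator {0..<1} (x $ j) *\<^sub>R
        exp (2 * of_real pi * \<i> * of_real (of_int (k $ j) * x $ j)))"
      unfolding basis g_def some by (simp add: inner_axis)
    also have "\<dots> = (\<Prod>j\<in>UNIV. of_real (indicator {0..<1} (x $ j))) *
        (\<Prod>j\<in>UNIV. exp (2 * of_real pi * \<i> * of_real (of_int (k $ j) * x $ j)))"
      by (simp add: scaleR_conv_of_real prod.distrib)
    also have "(\<Prod>j\<in>UNIV. exp (2 * of_real pi * \<i> * of_real (of_int (k $ j) * x $ j))) = fourier_basis k x"
      unfolding fourier_basis_def by (simp add: exp_sum[symmetric] sum_distrib_left)
    also have "(\<Prod>j\<in>UNIV. of_real (indicator {0..<1} (x $ j))) = (of_real (indicator torus x) :: complex)"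
    proof (cases "x \<in> torus")
      case True then show ?thesis by (auto simp: torus_def indicator_def)
    next
      case False
      then obtain j where "\<not> (0 \<le> x $ j \<and> x $ j < 1)" by (auto simp: torus_def)
      then have "\<exists>j\<in>UNIV. of_real (indicator {0..<1} (x $ j)) = (0::complex)" by (auto intro!: exI[of _ j])
      then show ?thesis using False by (subst prod_zero) auto
    qed
    finally show ?thesis by (simp add: scaleR_conv_of_real)
  qed
  interpret product_sigma_finite "\<lambda>_::real ^ 'd. lborel :: real measure" ..
  have gm: "g b \<in> borel_measurable borel" for b
    using borel_measurable_integrable[OF integral_character_unit_interval(1)] unfolding g_def by simp
  have comp: "(\<Sum>b\<in>Basis. f b *\<^sub>R b) \<bullet> b' = f b'" if "b' \<in> Basis" for f and b' :: "real ^ 'd"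
    using that by (simp add: inner_sum_left inner_Basis if_distrib cong: if_cong)
  have "(LINT x|torus_measure. fourier_basis k x) = (\<integral>x. (\<Prod>b\<in>Basis. g b (x \<bullet> b)) \<partial>lborel)"
    by (simp add: torus_measure_def integral_restrict_space ind)
  also have "\<dots> = (\<integral>x. (\<Prod>b\<in>Basis. g b (x \<bullet> b)) \<partial>distr (\<Pi>\<^sub>M b\<in>Basis. lborel) borel (\<lambda>f. \<Sum>b\<in>Basis. f b *\<^sub>R b))"
    by (subst lborel_eq) (rule refl)
  also have "\<dots> = (\<integral>f. (\<Prod>b\<in>Basis. g b (f b)) \<partial>(\<Pi>\<^sub>M b\<in>(Basis :: (real ^ 'd) set). lborel))"
  proof (subst integral_distr)
    show "(\<lambda>x. \<Prod>b\<in>Basis. g b (x \<bullet> b)) \<in> borel_measurable borel"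
      using gm by measurable
    show "(\<integral>f. (\<Prod>b\<in>Basis. g b ((\<Sum>b\<in>Basis. f b *\<^sub>R b) \<bullet> b)) \<partial>(\<Pi>\<^sub>M b\<in>(Basis :: (real ^ 'd) set). lborel)) =
        (\<integral>f. (\<Prod>b\<in>Basis. g b (f b)) \<partial>(\<Pi>\<^sub>M b\<in>(Basis :: (real ^ 'd) set). lborel))"
      by (intro Bochner_Integration.integral_cong refl prod.cong) (simp add: comp)
  qed measurable
  also have "\<dots> = (\<Prod>b\<in>Basis. \<integral>t. g b t \<partial>lborel)"
    by (rule product_integral_prod) (simp_all only: g_def integral_character_unit_interval(1) finite_Basis)
  also have "\<dots> = (\<Prod>j\<in>UNIV. if k $ j = 0 then 1 else 0)"
    unfolding basis g_def some integral_character_unit_interval(2) ..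
  also have "\<dots> = (if k = 0 then 1 else 0)"
  proof (cases "k = 0")
    case False
    then obtain j where "k $ j \<noteq> 0" by (auto simp: vec_eq_iff)
    then show ?thesis using False by (subst prod_zero) auto
  qed simp
  finally show ?thesis .
qed

section \<open>Moments of the random Gram matrix\<close>

abbreviation sample_measure :: "nat \<Rightarrow> (nat \<Rightarrow> real ^ 'd) measure" where
  "sample_measure m \<equiv> PiM {1..m} (\<lambda>_. torus_measure)"

lemma prob_space_sample: "prob_space (sample_measure m :: (nat \<Rightarrow> real ^ 'd) measure)"
  by (intro prob_space_PiM prob_space_torus)

lemma fourier_basis_product_regroup:
  fixes p :: nat
  assumes "finite I" "\<iota> ` {..<p} \<subseteq> I"
  shows "(\<Prod>j<p. fourier_basis (e j) (x (\<iota> j)))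
    = (\<Prod>a\<in>I. fourier_basis (\<Sum>j | j < p \<and> \<iota> j = a. e j) (x a))"
proof -
  have "(\<Prod>j<p. fourier_basis (e j) (x (\<iota> j)))
      = (\<Prod>a\<in>I. \<Prod>j\<in>{j \<in> {..<p}. \<iota> j = a}. fourier_basis (e j) (x (\<iota> j)))"
    using assms by (intro prod.group[symmetric]) auto
  also have "\<dots> = (\<Prod>a\<in>I. fourier_basis (\<Sum>j | j < p \<and> \<iota> j = a. e j) (x a))"
    by (rule prod.cong) (auto simp: fourier_basis_sum intro!: prod.cong)
  finally show ?thesis .
qed

lemma integrable_fourier_basis: "integrable torus_measure (fourier_basis k)"
proof -
  interpret prob_space "torus_measure :: (real ^ 'd) measure" by (rule prob_space_torus)
  show ?thesis
    by (rule integrable_const_bound[where B = 1])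
      (simp_all add: borel_measurable_torus_measure)
qed

text \<open>Sample points with different labels are independent, so the expectation factors over the labels, and
  each factor is the integral of a single character.\<close>

lemma expectation_fourier_product:
  fixes e :: "nat \<Rightarrow> int ^ 'd"
  assumes "finite I" "\<iota> ` {..<p} \<subseteq> I"
  shows "integrable (PiM I (\<lambda>_. torus_measure)) (\<lambda>x. \<Prod>j<p. fourier_basis (e j) (x (\<iota> j)))"
    and "(\<integral>x. (\<Prod>j<p. fourier_basis (e j) (x (\<iota> j))) \<partial>PiM I (\<lambda>_. torus_measure))
      = (if \<forall>a\<in>\<iota> ` {..<p}. (\<Sum>j | j < p \<and> \<iota> j = a. e j) = 0 then 1 else 0)"
proof -
  interpret T: prob_space "torus_measure :: (real ^ 'd) measure" by (rule prob_space_torus)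
  interpret product_sigma_finite "\<lambda>_. torus_measure :: (real ^ 'd) measure" ..
  show "integrable (PiM I (\<lambda>_. torus_measure)) (\<lambda>x. \<Prod>j<p. fourier_basis (e j) (x (\<iota> j)))"
    unfolding fourier_basis_product_regroup[OF assms]
    using assms(1) integrable_fourier_basis by (rule product_integrable_prod)
  have "(\<integral>x. (\<Prod>j<p. fourier_basis (e j) (x (\<iota> j))) \<partial>PiM I (\<lambda>_. torus_measure))
      = (\<Prod>a\<in>I. LINT x|torus_measure. fourier_basis (\<Sum>j | j < p \<and> \<iota> j = a. e j) x)"
    unfolding fourier_basis_product_regroup[OF assms]
    using assms(1) integrable_fourier_basis by (rule product_integral_prod)
  also have "\<dots> = (\<Prod>a\<in>I. if (\<Sum>j | j < p \<and> \<iota> j = a. e j) = 0 then 1 else 0)"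
    unfolding integral_fourier_basis ..
  also have "\<dots> = (if \<forall>a\<in>\<iota> ` {..<p}. (\<Sum>j | j < p \<and> \<iota> j = a. e j) = 0 then 1 else 0)"
  proof (cases "\<forall>a\<in>\<iota> ` {..<p}. (\<Sum>j | j < p \<and> \<iota> j = a. e j) = 0")
    case True
    have "(\<Sum>j | j < p \<and> \<iota> j = a. e j) = 0" for a
    proof (cases "a \<in> \<iota> ` {..<p}")
      case False
      then have none: "{j. j < p \<and> \<iota> j = a} = {}" by auto
      show ?thesis unfolding none by simp
    qed (use True in blast)
    then show ?thesis by simp
  next
    case False
    then obtain a where a: "a \<in> \<iota> ` {..<p}" "(\<Sum>j | j < p \<and> \<iota> j = a. e j) \<noteq> 0" by blast
    have "(\<Prod>a\<in>I. if (\<Sum>j | j < p \<and> \<iota> j = a. e j) = 0 then 1 else 0) = (0::complex)"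
      by (rule prod_zero[OF assms(1)]) (use a assms(2) in \<open>auto intro!: bexI[of _ a]\<close>)
    then show ?thesis using False by (simp only: if_False)
  qed
  finally show "(\<integral>x. (\<Prod>j<p. fourier_basis (e j) (x (\<iota> j))) \<partial>PiM I (\<lambda>_. torus_measure))
      = (if \<forall>a\<in>\<iota> ` {..<p}. (\<Sum>j | j < p \<and> \<iota> j = a. e j) = 0 then 1 else 0)" .
qed

text \<open>The matrix \<open>A\<^sup>* A - I\<close> for the sampling matrix \<open>A\<close>. Its diagonal is exactly zero because characters have
  modulus one.\<close>

definition gram_deviation :: "nat \<Rightarrow> (nat \<Rightarrow> real ^ 'd) \<Rightarrow> int ^ 'd \<Rightarrow> int ^ 'd \<Rightarrow> complex" where
  "gram_deviation m x k l = (if k = l then 0 else (\<Sum>i=1..m. fourier_basis (l - k) (x i)) / of_nat m)"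

lemma gram_deviation_hermitian: "gram_deviation m x l k = cnj (gram_deviation m x k l)"
  by (simp add: gram_deviation_def fourier_basis_cnj)

text \<open>The trace is a sum over closed walks in \<open>B\<close> without zero steps and over labellings of the steps by
  sample points. Taking expectations leaves the pairs in which each label is balanced; those use at most \<open>q\<close>
  labels, and for \<open>b\<close> labels there are at most \<open>N ^ (2 * q + 1 - b)\<close> walks.\<close>

lemma expectation_trace_gram_deviation:
  fixes B :: "(int ^ 'd) set"
  assumes B: "finite B" "card B \<le> N" and m: "1 \<le> m" and q: "1 \<le> q"
  defines "T \<equiv> \<lambda>x. Re (\<Sum>k\<in>B. kernel_power B (gram_deviation m x) (2 * q) k k)"
  shows "integrable (sample_measure m) T"
    and "integral\<^sup>L (sample_measure m) T
      \<le> real N * (\<Sum>b=1..q. exp (real b) * (real b * real N / real m) ^ (2 * q - b))"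
proof -
  define p where "p = 2 * q"
  define W where "W = {w \<in> {..p} \<rightarrow>\<^sub>E B. w 0 = w p \<and> (\<forall>j<p. w (Suc j) \<noteq> w j)}"
  define L where "L = {..<p} \<rightarrow>\<^sub>E {1..m}"
  define F where "F w \<iota> x = (\<Prod>j<p. fourier_basis (w (Suc j) - w j) (x (\<iota> j)))"
    for w :: "nat \<Rightarrow> int ^ 'd" and \<iota> and x :: "nat \<Rightarrow> real ^ 'd"
  define bal where "bal w \<iota> \<longleftrightarrow> (\<forall>a\<in>\<iota> ` {..<p}. (\<Sum>j | j < p \<and> \<iota> j = a. w (Suc j) - w j) = 0)"
    for w :: "nat \<Rightarrow> int ^ 'd" and \<iota> :: "nat \<Rightarrow> nat"
  define g where "g b = (if b \<le> q then real N ^ (p + 1 - b) else 0)" for b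
  have p0: "0 < p" using q unfolding p_def by simp
  have finW0: "finite ({..p} \<rightarrow>\<^sub>E B)" using B(1) by (intro finite_PiE) auto
  then have finW: "finite W" unfolding W_def by (rule rev_finite_subset) auto
  have im: "\<iota> ` {..<p} \<subseteq> {1..m}" if "\<iota> \<in> L" for \<iota>
    using that unfolding L_def by (simp add: PiE_iff image_subset_iff)
  have trace: "(\<Sum>k\<in>B. kernel_power B (gram_deviation m x) p k k) = (\<Sum>w\<in>W. \<Sum>\<iota>\<in>L. F w \<iota> x / of_nat m ^ p)" for x
  proof -
    have "(\<Sum>k\<in>B. kernel_power B (gram_deviation m x) p k k)
        = (\<Sum>w | w \<in> {..p} \<rightarrow>\<^sub>E B \<and> w 0 = w p. \<Prod>j<p. gram_deviation m x (w j) (w (Suc j)))"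
      by (rule trace_kernel_power_walks[OF B(1)])
    also have "\<dots> = (\<Sum>w\<in>W. \<Prod>j<p. gram_deviation m x (w j) (w (Suc j)))"
    proof (rule sum.mono_neutral_right)
      show "finite {w. w \<in> {..p} \<rightarrow>\<^sub>E B \<and> w 0 = w p}" by (rule rev_finite_subset[OF finW0]) auto
      show "\<forall>w\<in>{w. w \<in> {..p} \<rightarrow>\<^sub>E B \<and> w 0 = w p} - W. (\<Prod>j<p. gram_deviation m x (w j) (w (Suc j))) = 0"
      proof
        fix w assume "w \<in> {w. w \<in> {..p} \<rightarrow>\<^sub>E B \<and> w 0 = w p} - W"
        then obtain j where "j < p" "w (Suc j) = w j" unfolding W_def by blast
        then show "(\<Prod>j<p. gram_deviation m x (w j) (w (Suc j))) = 0"
          by (intro prod_zero) (auto simp: gram_deviation_def intro!: bexI[of _ j])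
      qed
    qed (auto simp: W_def)
    also have "\<dots> = (\<Sum>w\<in>W. \<Sum>\<iota>\<in>L. F w \<iota> x / of_nat m ^ p)"
    proof (rule sum.cong[OF refl])
      fix w assume w: "w \<in> W"
      have "(\<Prod>j<p. gram_deviation m x (w j) (w (Suc j)))
          = (\<Prod>j<p. \<Sum>i\<in>{1..m}. fourier_basis (w (Suc j) - w j) (x i) / of_nat m)"
      proof (rule prod.cong[OF refl])
        fix j assume "j \<in> {..<p}"
        then have "w j \<noteq> w (Suc j)" using w unfolding W_def by (metis (mono_tags, lifting) lessThan_iff mem_Collect_eq)
        then show "gram_deviation m x (w j) (w (Suc j)) = (\<Sum>i\<in>{1..m}. fourier_basis (w (Suc j) - w j) (x i) / of_nat m)"
          by (simp add: gram_deviation_def sum_divide_distrib)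
      qed
      also have "\<dots> = (\<Sum>\<iota>\<in>L. \<Prod>j<p. fourier_basis (w (Suc j) - w j) (x (\<iota> j)) / of_nat m)"
        unfolding L_def by (rule prod_sum_PiE) auto
      also have "\<dots> = (\<Sum>\<iota>\<in>L. F w \<iota> x / of_nat m ^ p)"
        unfolding F_def by (simp add: prod_dividef)
      finally show "(\<Prod>j<p. gram_deviation m x (w j) (w (Suc j))) = (\<Sum>\<iota>\<in>L. F w \<iota> x / of_nat m ^ p)" .
    qed
    finally show ?thesis .
  qed
  have int: "integrable (sample_measure m) (F w \<iota>)" if "\<iota> \<in> L" for w \<iota>
    unfolding F_def by (rule expectation_fourier_product(1)[OF _ im[OF that]]) simp
  have val: "integral\<^sup>L (sample_measure m) (F w \<iota>) = (if bal w \<iota> then 1 else 0)" if "\<iota> \<in> L" for w \<iota>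
    unfolding F_def bal_def by (rule expectation_fourier_product(2)[OF _ im[OF that]]) simp
  have T: "T = (\<lambda>x. Re (\<Sum>w\<in>W. \<Sum>\<iota>\<in>L. F w \<iota> x / of_nat m ^ p))"
    unfolding T_def p_def[symmetric] trace ..
  have int2: "integrable (sample_measure m) (\<lambda>x. \<Sum>w\<in>W. \<Sum>\<iota>\<in>L. F w \<iota> x / of_nat m ^ p)"
    by (intro Bochner_Integration.integrable_sum integrable_divide_zero impI int)
  then show "integrable (sample_measure m) T"
    unfolding T by (rule integrable_Re)
  have "integral\<^sup>L (sample_measure m) T
      = Re (\<Sum>w\<in>W. \<Sum>\<iota>\<in>L. (if bal w \<iota> then 1 else 0) / of_nat m ^ p)"
  proof -
    have "integral\<^sup>L (sample_measure m) T
        = Re (integral\<^sup>L (sample_measure m) (\<lambda>x. \<Sum>w\<in>W. \<Sum>\<iota>\<in>L. F w \<iota> x / of_nat m ^ p))"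
      unfolding T by (rule integral_Re[OF int2])
    also have "integral\<^sup>L (sample_measure m) (\<lambda>x. \<Sum>w\<in>W. \<Sum>\<iota>\<in>L. F w \<iota> x / of_nat m ^ p)
        = (\<Sum>w\<in>W. \<Sum>\<iota>\<in>L. integral\<^sup>L (sample_measure m) (F w \<iota>) / of_nat m ^ p)"
    proof -
      have int1: "integrable (sample_measure m) (\<lambda>x. F w \<iota> x / of_nat m ^ p)" if "\<iota> \<in> L" for w \<iota>
        using int[OF that] by (intro integrable_divide_zero) blast
      have "integral\<^sup>L (sample_measure m) (\<lambda>x. \<Sum>w\<in>W. \<Sum>\<iota>\<in>L. F w \<iota> x / of_nat m ^ p)
          = (\<Sum>w\<in>W. integral\<^sup>L (sample_measure m) (\<lambda>x. \<Sum>\<iota>\<in>L. F w \<iota> x / of_nat m ^ p))"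
        by (intro Bochner_Integration.integral_sum Bochner_Integration.integrable_sum int1)
      also have "\<dots> = (\<Sum>w\<in>W. \<Sum>\<iota>\<in>L. integral\<^sup>L (sample_measure m) (\<lambda>x. F w \<iota> x / of_nat m ^ p))"
        by (intro sum.cong refl Bochner_Integration.integral_sum int1)
      finally show ?thesis by simp
    qed
    also have "\<dots> = (\<Sum>w\<in>W. \<Sum>\<iota>\<in>L. (if bal w \<iota> then 1 else 0) / of_nat m ^ p)"
      by (intro sum.cong refl) (simp only: val)
    finally show ?thesis .
  qed
  also have "\<dots> = (\<Sum>w\<in>W. \<Sum>\<iota>\<in>L. (if bal w \<iota> then 1 else 0) / real m ^ p)"
  proof -
    have "(if bal w \<iota> then 1 else 0) / of_nat m ^ p = complex_of_real ((if bal w \<iota> then 1 else 0) / real m ^ p)" for w \<iota>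
      by simp
    then show ?thesis by (simp only: of_real_sum[symmetric] Re_complex_of_real)
  qed
  also have "\<dots> = (\<Sum>\<iota>\<in>L. \<Sum>w\<in>W. (if bal w \<iota> then 1 else 0)) / real m ^ p"
    by (subst sum.swap) (simp add: sum_divide_distrib)
  also have "\<dots> \<le> (\<Sum>\<iota>\<in>L. g (card (\<iota> ` {..<p}))) / real m ^ p"
  proof (intro divide_right_mono sum_mono)
    fix \<iota> assume "\<iota> \<in> L"
    have "(\<Sum>w\<in>W. (if bal w \<iota> then 1 else 0)) = real (card {w\<in>W. bal w \<iota>})"
      using finW by (simp add: sum.If_cases Int_def)
    also have "\<dots> \<le> g (card (\<iota> ` {..<p}))"
    proof (cases "{w\<in>W. bal w \<iota>} = {}")
      case False
      then obtain w where w: "w \<in> W" "bal w \<iota>" by blast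
      have "2 * card (\<iota> ` {..<p}) \<le> p"
        by (rule card_labels_le_half[of p w]) (use w in \<open>auto simp: W_def bal_def\<close>)
      then have le: "card (\<iota> ` {..<p}) \<le> q" unfolding p_def by simp
      have "card {w\<in>W. bal w \<iota>} \<le> card {w \<in> {..p} \<rightarrow>\<^sub>E B. w 0 = w p \<and>
           (\<forall>a \<in> \<iota> ` {..<p}. (\<Sum>j | j < p \<and> \<iota> j = a. w (Suc j) - w j) = 0)}"
        by (rule card_mono) (use finW0 in \<open>auto simp: W_def bal_def intro: rev_finite_subset\<close>)
      also have "\<dots> \<le> card B ^ (p + 1 - card (\<iota> ` {..<p}))"
        by (rule card_closed_walks_le[OF B(1) p0])
      also have "\<dots> \<le> N ^ (p + 1 - card (\<iota> ` {..<p}))" using B(2) by (rule power_mono) simp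
      finally have "real (card {w\<in>W. bal w \<iota>}) \<le> real (N ^ (p + 1 - card (\<iota> ` {..<p})))" by (rule of_nat_mono)
      then show ?thesis using le unfolding g_def by simp
    next
      case True
      show ?thesis unfolding True g_def by simp
    qed
    finally show "(\<Sum>w\<in>W. (if bal w \<iota> then 1 else 0)) \<le> g (card (\<iota> ` {..<p}))" .
  qed simp
  also have "\<dots> \<le> (\<Sum>b=1..q. real (card {1..m}) ^ b * exp (real b) * real b ^ (p - b) * g b) / real m ^ p"
    unfolding L_def
    by (intro divide_right_mono sum_over_labellings_le p0) (auto simp: g_def p_def)
  also have "\<dots> = (\<Sum>b=1..q. real N * (exp (real b) * (real b * real N / real m) ^ (p - b)))"
    unfolding sum_divide_distrib
  proof (rule sum.cong[OF refl])
    fix b assume b: "b \<in> {1..q}"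
    then have e: "p + 1 - b = Suc (p - b)" "p = b + (p - b)" unfolding p_def by auto
    have mp: "real m ^ p = real m ^ b * real m ^ (p - b)" using e(2) by (metis power_add)
    show "real (card {1..m}) ^ b * exp (real b) * real b ^ (p - b) * g b / real m ^ p
        = real N * (exp (real b) * (real b * real N / real m) ^ (p - b))"
      using b m unfolding g_def e(1) mp
      by (simp add: power_mult_distrib power_divide field_simps)
  qed
  finally show "integral\<^sup>L (sample_measure m) T
      \<le> real N * (\<Sum>b=1..q. exp (real b) * (real b * real N / real m) ^ (2 * q - b))"
    unfolding p_def sum_distrib_left .
qed

section \<open>Random sampling is a near isometry\<close>

text \<open>The left-hand side is the absolute value of the quadratic form of \<open>A\<^sup>* A - I\<close> at \<open>v\<close>.\<close>

lemma gram_quadratic_form_deviation: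
  fixes v :: "int ^ 'd \<Rightarrow> complex"
  assumes B: "finite B" and m: "1 \<le> m"
  shows "\<bar>(\<Sum>i=1..m. (cmod (\<Sum>k\<in>B. fourier_basis k (x i) * v k))\<^sup>2) / real m - (\<Sum>k\<in>B. (cmod (v k))\<^sup>2)\<bar>
    \<le> L2_set (\<lambda>k. cmod (v k)) B * L2_set (\<lambda>k. cmod (kernel_apply B (gram_deviation m x) v k)) B"
proof -
  let ?S = "\<Sum>i=1..m. (cmod (\<Sum>k\<in>B. fourier_basis k (x i) * v k))\<^sup>2"
  have "complex_of_real ?S = (\<Sum>i=1..m. \<Sum>k\<in>B. \<Sum>l\<in>B. cnj (v k) * v l * fourier_basis (l - k) (x i))"
  proof -
    have "complex_of_real ((cmod (\<Sum>k\<in>B. fourier_basis k (x i) * v k))\<^sup>2)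
        = (\<Sum>k\<in>B. \<Sum>l\<in>B. cnj (v k) * v l * fourier_basis (l - k) (x i))" for i
    proof -
      have "complex_of_real ((cmod (\<Sum>k\<in>B. fourier_basis k (x i) * v k))\<^sup>2)
          = (\<Sum>k\<in>B. cnj (fourier_basis k (x i) * v k)) * (\<Sum>l\<in>B. fourier_basis l (x i) * v l)"
        by (simp only: complex_norm_square cnj_sum mult.commute)
      also have "\<dots> = (\<Sum>k\<in>B. \<Sum>l\<in>B. cnj (fourier_basis k (x i) * v k) * (fourier_basis l (x i) * v l))"
        by (rule sum_product)
      also have "\<dots> = (\<Sum>k\<in>B. \<Sum>l\<in>B. cnj (v k) * v l * fourier_basis (l - k) (x i))"
        by (intro sum.cong refl) (simp add: fourier_basis_diff)
      finally show ?thesis .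
    qed
    then show ?thesis by (simp only: of_real_sum)
  qed
  also have "\<dots> = (\<Sum>k\<in>B. \<Sum>l\<in>B. \<Sum>i=1..m. cnj (v k) * v l * fourier_basis (l - k) (x i))"
    by (subst sum.swap) (intro sum.cong refl, rule sum.swap)
  also have "\<dots> = (\<Sum>k\<in>B. \<Sum>l\<in>B. of_nat m * (cnj (v k) * v l * (gram_deviation m x k l + (if k = l then 1 else 0))))"
  proof (intro sum.cong refl)
    fix k l
    show "(\<Sum>i=1..m. cnj (v k) * v l * fourier_basis (l - k) (x i))
        = of_nat m * (cnj (v k) * v l * (gram_deviation m x k l + (if k = l then 1 else 0)))"
      using m by (cases "k = l") (simp_all add: gram_deviation_def sum_distrib_left[symmetric])
  qed
  also have "\<dots> = of_nat m * ((\<Sum>k\<in>B. \<Sum>l\<in>B. cnj (v k) * v l * gram_deviation m x k l)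
      + (\<Sum>k\<in>B. \<Sum>l\<in>B. if k = l then cnj (v k) * v l else 0))"
  proof -
    have "of_nat m * (cnj (v k) * v l * (gram_deviation m x k l + (if k = l then 1 else 0)))
        = of_nat m * (cnj (v k) * v l * gram_deviation m x k l)
          + of_nat m * (if k = l then cnj (v k) * v l else 0)" for k l
      by (simp add: distrib_left)
    then show ?thesis by (simp only: sum.distrib sum_distrib_left distrib_left)
  qed
  also have "(\<Sum>k\<in>B. \<Sum>l\<in>B. if k = l then cnj (v k) * v l else 0) = complex_of_real (\<Sum>k\<in>B. (cmod (v k))\<^sup>2)"
  proof -
    have "(\<Sum>l\<in>B. if k = l then cnj (v k) * v l else 0) = complex_of_real ((cmod (v k))\<^sup>2)" if "k \<in> B" for k
      using B that by (simp add: mult.commute complex_norm_square del: of_real_power)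
    then show ?thesis by simp
  qed
  also have "(\<Sum>k\<in>B. \<Sum>l\<in>B. cnj (v k) * v l * gram_deviation m x k l)
      = (\<Sum>k\<in>B. cnj (v k) * kernel_apply B (gram_deviation m x) v k)"
    unfolding kernel_apply_def sum_distrib_left by (intro sum.cong refl) (simp only: mult_ac)
  finally have eq: "complex_of_real ?S = of_nat m * ((\<Sum>k\<in>B. cnj (v k) * kernel_apply B (gram_deviation m x) v k)
      + complex_of_real (\<Sum>k\<in>B. (cmod (v k))\<^sup>2))" .
  have "complex_of_real (?S / real m - (\<Sum>k\<in>B. (cmod (v k))\<^sup>2))
      = (\<Sum>k\<in>B. cnj (v k) * kernel_apply B (gram_deviation m x) v k)"
  proof -
    have cancel: "of_nat m * (X + Y) / complex_of_real (real m) - Y = X" for X Y :: complex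
      using m by simp
    show ?thesis unfolding of_real_diff of_real_divide eq by (rule cancel)
  qed
  from arg_cong[OF this, of cmod]
  have "\<bar>?S / real m - (\<Sum>k\<in>B. (cmod (v k))\<^sup>2)\<bar>
      = cmod (\<Sum>k\<in>B. cnj (v k) * kernel_apply B (gram_deviation m x) v k)"
    unfolding norm_of_real .
  also have "\<dots> \<le> L2_set (\<lambda>k. cmod (cnj (v k))) B * L2_set (\<lambda>k. cmod (kernel_apply B (gram_deviation m x) v k)) B"
    by (rule cmod_sum_mult_le)
  finally show ?thesis by (simp only: complex_mod_cnj)
qed

definition near_isometry :: "real \<Rightarrow> (int ^ 'd) set \<Rightarrow> nat \<Rightarrow> (nat \<Rightarrow> real ^ 'd) \<Rightarrow> bool" where
  "near_isometry \<delta> B m x \<longleftrightarrow> (\<forall>v. \<bar>(\<Sum>i=1..m. (cmod (\<Sum>k\<in>B. fourier_basis k (x i) * v k))\<^sup>2) / real m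
      - (\<Sum>k\<in>B. (cmod (v k))\<^sup>2)\<bar> \<le> \<delta> * (\<Sum>k\<in>B. (cmod (v k))\<^sup>2))"

text \<open>Markov's inequality for the trace, which bounds the operator norm of the deviation from the identity.\<close>

lemma sampling_near_isometry:
  fixes B :: "(int ^ 'd) set"
  assumes B: "finite B" "card B \<le> N" and m: "1 \<le> m" and q: "q = 2 ^ n" and \<delta>: "0 < \<delta>"
    and small: "(\<Sum>b=1..q. exp (real b) * (real b * real N / real m) ^ (2 * q - b)) \<le> \<delta> ^ (2 * q) * exp (- real q)"
  shows "\<exists>E \<in> sets (sample_measure m). measure (sample_measure m) E \<ge> 1 - real N * exp (- real q) \<and>
    (\<forall>x\<in>E. near_isometry \<delta> B m x)"
proof -
  let ?M = "sample_measure m :: (nat \<Rightarrow> real ^ 'd) measure"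
  interpret prob_space ?M by (rule prob_space_sample)
  define T where "T x = Re (\<Sum>k\<in>B. kernel_power B (gram_deviation m x) (2 * q) k k)" for x
  have q1: "1 \<le> q" using q by simp
  have int: "integrable ?M T"
    unfolding T_def by (rule expectation_trace_gram_deviation(1)[OF B m q1])
  have ET: "integral\<^sup>L ?M T \<le> real N * (\<delta> ^ (2 * q) * exp (- real q))"
    using expectation_trace_gram_deviation(2)[OF B m q1] mult_left_mono[OF small, of "real N"]
    unfolding T_def by simp
  have T0: "0 \<le> T x" for x
    unfolding T_def
    by (subst trace_kernel_power_even[OF B(1)]) (rule gram_deviation_hermitian, simp add: sum_nonneg)
  let ?E = "{x \<in> space ?M. T x \<le> \<delta> ^ (2 * q)}"
  have Es: "?E \<in> sets ?M" using borel_measurable_integrable[OF int] by measurable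
  have "measure ?M {x \<in> space ?M. \<delta> ^ (2 * q) \<le> T x} \<le> integral\<^sup>L ?M T / \<delta> ^ (2 * q)"
    by (rule integral_Markov_inequality_measure[OF int sets.empty_sets]) (use T0 \<delta> in simp_all)
  also have "\<dots> \<le> real N * (\<delta> ^ (2 * q) * exp (- real q)) / \<delta> ^ (2 * q)"
    using ET \<delta> by (intro divide_right_mono) simp_all
  also have "\<dots> = real N * exp (- real q)" using \<delta> by simp
  finally have bad: "measure ?M {x \<in> space ?M. \<delta> ^ (2 * q) \<le> T x} \<le> real N * exp (- real q)" .
  have "measure ?M (space ?M - ?E) \<le> measure ?M {x \<in> space ?M. \<delta> ^ (2 * q) \<le> T x}"
    by (rule finite_measure_mono) (use borel_measurable_integrable[OF int] in \<open>auto simp: measurable\<close>)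
  then have "1 - real N * exp (- real q) \<le> measure ?M ?E"
    using bad prob_compl[OF Es] by simp
  moreover have "near_isometry \<delta> B m x" if "x \<in> ?E" for x
    unfolding near_isometry_def
  proof
    fix v
    have "L2_set (\<lambda>k. cmod (kernel_apply B (gram_deviation m x) v k)) B \<le> \<delta> * L2_set (\<lambda>k. cmod (v k)) B"
      by (rule norm_kernel_apply_le_trace[OF B(1) _ q])
        (use that \<delta> in \<open>simp_all add: T_def gram_deviation_hermitian[symmetric]\<close>)
    then have "L2_set (\<lambda>k. cmod (v k)) B * L2_set (\<lambda>k. cmod (kernel_apply B (gram_deviation m x) v k)) B
        \<le> L2_set (\<lambda>k. cmod (v k)) B * (\<delta> * L2_set (\<lambda>k. cmod (v k)) B)"
      by (rule mult_left_mono) simp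
    also have "\<dots> = \<delta> * (L2_set (\<lambda>k. cmod (v k)) B)\<^sup>2" by (simp add: power2_eq_square)
    also have "\<dots> = \<delta> * (\<Sum>k\<in>B. (cmod (v k))\<^sup>2)" by (simp only: L2_set_squared)
    finally show "\<bar>(\<Sum>i=1..m. (cmod (\<Sum>k\<in>B. fourier_basis k (x i) * v k))\<^sup>2) / real m
      - (\<Sum>k\<in>B. (cmod (v k))\<^sup>2)\<bar> \<le> \<delta> * (\<Sum>k\<in>B. (cmod (v k))\<^sup>2)"
      using gram_quadratic_form_deviation[OF B(1) m, of x v] by linarith
  qed
  ultimately show ?thesis using Es by (intro bexI[of _ ?E]) auto
qed

lemma moment_sum_le:
  assumes q: "1 \<le> q" and r: "real q * real N / real m \<le> \<rho>" and \<rho>: "\<And>b. b \<in> {1..q} \<Longrightarrow> \<rho> ^ (2 * q - b) \<le> t ^ q"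
    and t: "0 \<le> t"
  shows "(\<Sum>b=1..q. exp (real b) * (real b * real N / real m) ^ (2 * q - b)) \<le> (2 * exp 1 * t) ^ q"
proof -
  have "(\<Sum>b=1..q. exp (real b) * (real b * real N / real m) ^ (2 * q - b)) \<le> (\<Sum>b=1..q. exp (real q) * t ^ q)"
  proof (rule sum_mono)
    fix b assume b: "b \<in> {1..q}"
    have "real b * real N / real m \<le> real q * real N / real m"
      using b by (intro divide_right_mono mult_right_mono) auto
    then have "(real b * real N / real m) ^ (2 * q - b) \<le> \<rho> ^ (2 * q - b)"
      using r by (intro power_mono) auto
    also have "\<dots> \<le> t ^ q" by (rule \<rho>[OF b])
    finally show "exp (real b) * (real b * real N / real m) ^ (2 * q - b) \<le> exp (real q) * t ^ q"
      using b by (intro mult_mono) auto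
  qed
  also have "\<dots> = real q * (exp 1 * t) ^ q"
    using exp_of_nat_mult[of q "1 :: real"] by (simp add: power_mult_distrib)
  also have "\<dots> \<le> 2 ^ q * (exp 1 * t) ^ q"
  proof (rule mult_right_mono)
    show "real q \<le> 2 ^ q" by (rule less_imp_le[OF of_nat_less_two_power])
  qed (use t in simp)
  also have "\<dots> = (2 * exp 1 * t) ^ q" by (simp only: power_mult_distrib mult.assoc)
  finally show ?thesis .
qed

text \<open>With \<open>t = 1/64\<close> the moment sum is at most \<open>(exp 1 / 32) ^ q\<close>, and \<open>exp 1 / 32 \<le> exp (-1) / 4\<close>.\<close>

lemma sampling_half_isometry:
  fixes B :: "(int ^ 'd) set"
  assumes B: "finite B" "card B \<le> N" and m: "1 \<le> m" and q: "q = 2 ^ n"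
    and large: "64 * real q * real N \<le> real m"
  shows "\<exists>E \<in> sets (sample_measure m). measure (sample_measure m) E \<ge> 1 - real N * exp (- real q) \<and>
    (\<forall>x\<in>E. near_isometry (1/2) B m x)"
proof (rule sampling_near_isometry[OF B m q])
  have e2: "exp 1 * exp 1 \<le> (8::real)"
    using mult_mono[of "exp 1" "272/100" "exp 1" "272/100 :: real"] e_less_272 by simp
  have q1: "1 \<le> q" using q by simp
  have exp_q: "exp (- real q) = exp (- 1) ^ q" using exp_of_nat_mult[of q "- 1 :: real"] by simp
  have "(\<Sum>b=1..q. exp (real b) * (real b * real N / real m) ^ (2 * q - b)) \<le> (2 * exp 1 * (1 / 64)) ^ q"
  proof (rule moment_sum_le[OF q1])
    show "real q * real N / real m \<le> 1 / 64" using large m by (simp add: divide_simps)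
    fix b assume "b \<in> {1..q}"
    then show "(1 / 64 :: real) ^ (2 * q - b) \<le> (1 / 64) ^ q" by (intro power_decreasing) auto
  qed simp
  also have "\<dots> \<le> (1 / 4 * exp (- 1)) ^ q"
    using e2 by (intro power_mono) (simp_all add: exp_minus divide_simps)
  also have "\<dots> = (1/2) ^ (2 * q) * exp (- real q)"
  proof -
    have "(1/2 :: real) ^ (2 * q) = (1/4) ^ q" by (simp add: power_mult power2_eq_square)
    then show ?thesis by (simp only: exp_q power_mult_distrib)
  qed
  finally show "(\<Sum>b=1..q. exp (real b) * (real b * real N / real m) ^ (2 * q - b)) \<le> (1/2) ^ (2 * q) * exp (- real q)" .
qed simp

text \<open>A crude version for sets that are large in comparison with the number of samples: only the growth of the
  bound with \<open>card B\<close> matters.\<close>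

lemma sampling_bounded:
  fixes B :: "(int ^ 'd) set"
  assumes B: "finite B" "card B \<le> N" and m: "1 \<le> m" and q: "q = 2 ^ n"
    and \<tau>: "1 \<le> \<tau>" "real q * real N \<le> \<tau> * real m"
  shows "\<exists>E \<in> sets (sample_measure m). measure (sample_measure m) E \<ge> 1 - real N * exp (- real q) \<and>
    (\<forall>x\<in>E. near_isometry (4 * \<tau>) B m x)"
proof (rule sampling_near_isometry[OF B m q])
  have e2: "exp 1 * exp 1 \<le> (8::real)"
    using mult_mono[of "exp 1" "272/100" "exp 1" "272/100 :: real"] e_less_272 by simp
  have q1: "1 \<le> q" using q by simp
  have exp_q: "exp (- real q) = exp (- 1) ^ q" using exp_of_nat_mult[of q "- 1 :: real"] by simp
  have "(\<Sum>b=1..q. exp (real b) * (real b * real N / real m) ^ (2 * q - b)) \<le> (2 * exp 1 * \<tau>\<^sup>2) ^ q"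
  proof (rule moment_sum_le[OF q1])
    show "real q * real N / real m \<le> \<tau>" using \<tau> m by (simp add: divide_simps)
    fix b assume "b \<in> {1..q}"
    then show "\<tau> ^ (2 * q - b) \<le> \<tau>\<^sup>2 ^ q" unfolding power_mult[symmetric] using \<tau> by (intro power_increasing) auto
  qed simp
  also have "\<dots> \<le> ((4 * \<tau>)\<^sup>2 * exp (- 1)) ^ q"
  proof (rule power_mono)
    have "2 * (exp 1 * exp 1) * \<tau>\<^sup>2 \<le> 16 * \<tau>\<^sup>2" using e2 by (intro mult_right_mono) auto
    then show "2 * exp 1 * \<tau>\<^sup>2 \<le> (4 * \<tau>)\<^sup>2 * exp (- 1)"
      by (simp add: exp_minus divide_simps power_mult_distrib mult_ac)
  qed simp
  also have "\<dots> = (4 * \<tau>) ^ (2 * q) * exp (- real q)"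
    by (simp only: exp_q power_mult_distrib[symmetric] power_mult)
  finally show "(\<Sum>b=1..q. exp (real b) * (real b * real N / real m) ^ (2 * q - b)) \<le> (4 * \<tau>) ^ (2 * q) * exp (- real q)" .
qed (use \<tau> in simp)

lemma power_of_two_between:
  assumes "1/2 \<le> (y::real)"
  shows "\<exists>n. y \<le> 2 ^ n \<and> 2 ^ n \<le> 2 * y"
proof -
  define n where "n = (LEAST n. y \<le> 2 ^ n)"
  obtain j where "y < 2 ^ j" using real_arch_pow[of 2 y] by auto
  then have n: "y \<le> 2 ^ n" unfolding n_def by (intro LeastI[of "\<lambda>n. y \<le> 2 ^ n" j]) simp
  moreover have "2 ^ n \<le> 2 * y"
  proof (cases n)
    case 0 then show ?thesis using assms by simp
  next
    case (Suc i)
    then have "\<not> y \<le> 2 ^ i" using not_less_Least[of i "\<lambda>n. y \<le> 2 ^ n"] unfolding n_def by simp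
    then show ?thesis using Suc by simp
  qed
  ultimately show ?thesis by blast
qed

lemma (in prob_space) prob_Inter_ge:
  assumes E: "\<And>n::nat. E n \<in> events" "\<And>n. prob (E n) \<ge> 1 - f n" and f: "f sums t"
  shows "prob (\<Inter>n. E n) \<ge> 1 - t"
proof -
  have le: "prob (space M - E n) \<le> f n" for n using E[of n] by (simp add: prob_compl)
  have sum: "summable (\<lambda>n. prob (space M - E n))"
    by (rule summable_comparison_test'[OF sums_summable[OF f], of 0]) (simp add: le)
  have "prob (\<Union>n. space M - E n) \<le> (\<Sum>n. prob (space M - E n))"
    using E sum by (intro finite_measure_subadditive_countably) auto
  also have "\<dots> \<le> (\<Sum>n. f n)" using sum sums_summable[OF f] by (rule suminf_le[OF le])
  also have "\<dots> = t" using f by (rule sums_unique[symmetric])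
  also have "(\<Union>n. space M - E n) = space M - (\<Inter>n. E n)" by auto
  finally show ?thesis using E by (simp add: prob_compl)
qed

text \<open>The logarithm of \<open>2 * s / \<epsilon>\<close>, which is what the union bound costs, is within a constant factor of the
  oversampling that is available.\<close>

lemma log_budget:
  assumes s: "1 \<le> (s::real)" and \<epsilon>: "0 < \<epsilon>" "\<epsilon> < 1"
  shows "ln (2 * s / \<epsilon>) \<le> 3 * (ln (2 * s) ^ 3 + ln (2 / \<epsilon>))" and "2/3 \<le> ln (2 * s / \<epsilon>)"
    and "ln 2 \<le> ln (2 * s / \<epsilon>)"
proof -
  define a where "a = ln (2 * s)"
  have a: "2/3 \<le> a" using s ln2_ge_two_thirds ln_le_cancel_iff[of 2 "2 * s"] unfolding a_def by linarith
  have e: "ln \<epsilon> \<le> 0" using \<epsilon> by simp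
  have "1 * a \<le> (3 * a\<^sup>2) * a"
  proof (rule mult_right_mono)
    have "(2/3)\<^sup>2 \<le> a\<^sup>2" using a by (intro power_mono) auto
    then show "1 \<le> 3 * a\<^sup>2" by (simp add: power2_eq_square)
  qed (use a in simp)
  then have a3: "a \<le> 3 * a ^ 3" by (simp add: power2_eq_square power3_eq_cube)
  have eq: "ln (2 * s / \<epsilon>) = a - ln \<epsilon>" "ln (2 / \<epsilon>) = ln 2 - ln \<epsilon>"
    using s \<epsilon> unfolding a_def by (simp_all add: ln_div)
  show "ln (2 * s / \<epsilon>) \<le> 3 * (ln (2 * s) ^ 3 + ln (2 / \<epsilon>))"
    unfolding eq a_def[symmetric] using a3 e ln2_ge_two_thirds by (simp add: algebra_simps)
  show "2/3 \<le> ln (2 * s / \<epsilon>)" unfolding eq using a e by simp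
  show "ln 2 \<le> ln (2 * s / \<epsilon>)"
    unfolding eq using s e ln_le_cancel_iff[of 2 "2 * s"] unfolding a_def by linarith
qed

text \<open>The failure probability \<open>\<epsilon>\<close> is split geometrically over the set \<open>A\<close> and the sets \<open>B l\<close>. For \<open>B l\<close>
  the moment is taken of an order \<open>q\<close> proportional to \<open>(l + 1) * ln (2 * s / \<epsilon>)\<close>, so that the deviation
  grows only by the factor \<open>l + 1\<close> beyond the growth \<open>2 ^ l\<close> of the sets.\<close>

lemma simultaneous_near_isometry:
  fixes A :: "(int ^ 'd) set" and B :: "nat \<Rightarrow> (int ^ 'd) set"
  assumes s: "1 \<le> s" and A: "finite A" "card A \<le> s" and B: "\<And>l. finite (B l)" "\<And>l. card (B l) \<le> 2 ^ Suc l * s"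
    and \<epsilon>: "0 < \<epsilon>" "\<epsilon> < 1" and m: "400 * real s * (ln (2 * real s) ^ 3 + ln (2 / \<epsilon>)) \<le> real m"
  shows "\<exists>E \<in> sets (sample_measure m). measure (sample_measure m) E \<ge> 1 - \<epsilon> \<and>
    (\<forall>x\<in>E. near_isometry (1/2) A m x \<and> (\<forall>l. near_isometry (4 * (2 ^ l * real (Suc l))) (B l) m x))"
proof -
  interpret prob_space "sample_measure m :: (nat \<Rightarrow> real ^ 'd) measure" by (rule prob_space_sample)
  \<comment> \<open>The constant 400 covers \<open>64 * (2 * (3 * L))\<close>: the order \<open>q\<close> may be as large as \<open>2 * y\<close>, since only powers of two are
    available, and \<open>y \<le> 3 * L\<close>.\<close>
  define L where "L = ln (2 * real s) ^ 3 + ln (2 / \<epsilon>)"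
  define y where "y = ln (2 * real s / \<epsilon>)"
  have y: "y \<le> 3 * L" "2/3 \<le> y" "ln 2 \<le> y"
    unfolding y_def L_def using log_budget[of "real s" \<epsilon>] s \<epsilon> by auto
  have s0: "0 < real s" using s by simp
  have mL: "400 * real s * L \<le> real m" using m unfolding L_def .
  have sL: "real s * y \<le> 3 * (real s * L)" using mult_left_mono[OF y(1), of "real s"] by simp
  have "0 < real s * y" using s0 y by simp
  then have "0 < real m" using mL sL by linarith
  then have m1: "1 \<le> m" by simp
  have expy: "real s * exp (- y) = \<epsilon> / 2"
    unfolding y_def using s0 \<epsilon> by (simp add: exp_minus)
  have "\<exists>E \<in> events. prob E \<ge> 1 - \<epsilon> * (1/2) ^ Suc n \<and>
    (\<forall>x\<in>E. case n of 0 \<Rightarrow> near_isometry (1/2) A m x | Suc l \<Rightarrow> near_isometry (4 * (2 ^ l * real (Suc l))) (B l) m x)" for n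
  proof (cases n)
    case 0
    obtain i where i: "y \<le> 2 ^ i" "2 ^ i \<le> 2 * y" using power_of_two_between[of y] y by auto
    define q :: nat where "q = 2 ^ i"
    have q: "y \<le> real q" "real q \<le> 2 * y" using i unfolding q_def by auto
    have "64 * real q * real s \<le> 64 * (2 * y) * real s" using q s0 by (intro mult_right_mono mult_left_mono) auto
    also have "\<dots> = 128 * (real s * y)" by simp
    also have "\<dots> \<le> real m" using mL sL \<open>0 < real s * y\<close> by linarith
    finally have "\<exists>E \<in> events. prob E \<ge> 1 - real s * exp (- real q) \<and> (\<forall>x\<in>E. near_isometry (1/2) A m x)"
      by (intro sampling_half_isometry[OF A m1 q_def])
    then obtain E where E: "E \<in> events" "prob E \<ge> 1 - real s * exp (- real q)" "\<forall>x\<in>E. near_isometry (1/2) A m x"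
      by blast
    have "real s * exp (- real q) \<le> real s * exp (- y)" using q s0 by (intro mult_left_mono) auto
    then show ?thesis using E 0 expy by (intro bexI[of _ E]) auto
  next
    case (Suc l)
    \<comment> \<open>Of the factor \<open>2 ^ (2 * l + 2)\<close> one half pays for the size of \<open>B l\<close>, the other for the sum over \<open>l\<close>.\<close>
    define z where "z = real (2 * l + 2) * ln 2 + y"
    have z0: "1/2 \<le> z" unfolding z_def using y by (simp add: add_nonneg_nonneg order_trans[of "1/2" "2/3"] add_increasing)
    obtain i where i: "z \<le> 2 ^ i" "2 ^ i \<le> 2 * z" using power_of_two_between[OF z0] by auto
    define q :: nat where "q = 2 ^ i"
    have q: "z \<le> real q" "real q \<le> 2 * z" using i unfolding q_def by auto
    have "real (2 * l + 2) * ln 2 \<le> real (2 * l + 2) * y" using y by (intro mult_left_mono) auto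
    then have "z \<le> real (2 * l + 3) * y" unfolding z_def by (simp add: algebra_simps)
    also have "\<dots> \<le> (3 * real (Suc l)) * y" using y by (intro mult_right_mono) auto
    finally have zy: "z \<le> 3 * real (Suc l) * y" .
    have "real q * real (2 ^ Suc l * s) \<le> (2 * (3 * real (Suc l) * y)) * real (2 ^ Suc l * s)"
      using q zy by (intro mult_right_mono) auto
    also have "\<dots> = 2 ^ l * real (Suc l) * (12 * (real s * y))" by simp
    also have "\<dots> \<le> 2 ^ l * real (Suc l) * real m"
    proof (rule mult_left_mono)
      have "0 \<le> real s * L" using sL \<open>0 < real s * y\<close> by linarith
      then show "12 * (real s * y) \<le> real m" using mL sL by linarith
    qed simp
    finally have "\<exists>E \<in> events. prob E \<ge> 1 - real (2 ^ Suc l * s) * exp (- real q) \<and>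
        (\<forall>x\<in>E. near_isometry (4 * (2 ^ l * real (Suc l))) (B l) m x)"
    proof (intro sampling_bounded[OF B m1 q_def])
      show "1 \<le> 2 ^ l * real (Suc l)"
        using mult_mono[of 1 "2 ^ l" 1 "real (Suc l)"] by simp
    qed
    then obtain E where E: "E \<in> events" "prob E \<ge> 1 - real (2 ^ Suc l * s) * exp (- real q)"
      "\<forall>x\<in>E. near_isometry (4 * (2 ^ l * real (Suc l))) (B l) m x" by blast
    have "real (2 ^ Suc l * s) * exp (- real q) \<le> real (2 ^ Suc l * s) * exp (- z)"
      using q by (intro mult_left_mono) auto
    also have "exp (- z) = exp (- y) * (1/2) ^ (2 * l + 2)"
    proof -
      have "exp (real (2 * l + 2) * ln 2) = (2::real) ^ (2 * l + 2)" by (subst exp_of_nat_mult) simp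
      then have "exp (- (real (2 * l + 2) * ln 2)) = (1/2::real) ^ (2 * l + 2)"
        by (simp only: exp_minus) (simp add: power_divide inverse_eq_divide)
      moreover have "- z = - y + - (real (2 * l + 2) * ln 2)" unfolding z_def by simp
      ultimately show ?thesis by (simp only: exp_add)
    qed
    also have "real (2 ^ Suc l * s) * (exp (- y) * (1/2) ^ (2 * l + 2))
        = (real s * exp (- y)) * (2 ^ Suc l * (1/2) ^ (2 * l + 2))" by simp
    also have "\<dots> = \<epsilon> * (1/2) ^ Suc n"
    proof -
      have "(1/2::real) ^ (2 * l + 2) = (1/2) ^ Suc l * (1/2) ^ Suc l"
        by (simp add: power_add[symmetric] mult_2)
      then have "(2::real) ^ Suc l * (1/2) ^ (2 * l + 2) = (1/2) ^ Suc l"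
        by (simp add: power_mult_distrib[symmetric] mult.assoc[symmetric] del: power_Suc)
      then show ?thesis unfolding expy Suc by simp
    qed
    finally have fin: "real (2 ^ Suc l * s) * exp (- real q) \<le> \<epsilon> * (1/2) ^ Suc n" .
    show ?thesis
    proof (rule bexI[OF _ E(1)], intro conjI)
      show "1 - \<epsilon> * (1/2) ^ Suc n \<le> prob E" using E(2) fin by linarith
      show "\<forall>x\<in>E. case n of 0 \<Rightarrow> near_isometry (1/2) A m x | Suc l \<Rightarrow> near_isometry (4 * (2 ^ l * real (Suc l))) (B l) m x"
        using E(3) unfolding Suc nat.case .
    qed
  qed
  then obtain E where "\<forall>n. E n \<in> events \<and> prob (E n) \<ge> 1 - \<epsilon> * (1/2) ^ Suc n \<and>
    (\<forall>x\<in>E n. case n of 0 \<Rightarrow> near_isometry (1/2) A m x | Suc l \<Rightarrow> near_isometry (4 * (2 ^ l * real (Suc l))) (B l) m x)"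
    using choice[of "\<lambda>n E. E \<in> events \<and> prob E \<ge> 1 - \<epsilon> * (1/2) ^ Suc n \<and>
    (\<forall>x\<in>E. case n of 0 \<Rightarrow> near_isometry (1/2) A m x | Suc l \<Rightarrow> near_isometry (4 * (2 ^ l * real (Suc l))) (B l) m x)"]
    unfolding Bex_def by blast
  then have E: "\<And>n. E n \<in> events" "\<And>n. prob (E n) \<ge> 1 - \<epsilon> * (1/2) ^ Suc n"
    "\<And>n x. x \<in> E n \<Longrightarrow> (case n of 0 \<Rightarrow> near_isometry (1/2) A m x | Suc l \<Rightarrow> near_isometry (4 * (2 ^ l * real (Suc l))) (B l) m x)"
    by simp_all
  have "prob (\<Inter>n. E n) \<ge> 1 - \<epsilon> * 1"
    by (rule prob_Inter_ge[OF E(1,2) sums_mult[OF power_half_series]])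
  moreover have "near_isometry (1/2) A m x" if "x \<in> (\<Inter>n. E n)" for x
    using E(3)[of x 0] that by auto
  moreover have "near_isometry (4 * (2 ^ l * real (Suc l))) (B l) m x" if "x \<in> (\<Inter>n. E n)" for x l
    using E(3)[of x "Suc l"] that by auto
  moreover have "(\<Inter>n. E n) \<in> events" using E(1) by auto
  ultimately show ?thesis by (intro bexI[of _ "\<Inter>n. E n"]) auto
qed

section \<open>Frequency sets that serve all smoothness vectors\<close>

definition mixed_weight :: "('d::finite \<Rightarrow> real) \<Rightarrow> int ^ 'd \<Rightarrow> real" where
  "mixed_weight \<beta> k = (\<Prod>j\<in>UNIV. (1 + \<bar>of_int (k $ j)\<bar>) powr \<beta> j)"

lemma sum_over_symmetric_interval_le:
  fixes g :: "nat \<Rightarrow> real"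
  assumes g: "\<And>n. 0 \<le> g n"
  shows "(\<Sum>a\<in>{- int M..int M}. g (nat \<bar>a\<bar>)) \<le> 2 * (\<Sum>n\<le>M. g n)"
proof -
  have "(\<Sum>a\<in>{- int M..int M}. g (nat \<bar>a\<bar>)) \<le> (\<Sum>a\<in>int ` {..M} \<union> (\<lambda>n. - int n) ` {..M}. g (nat \<bar>a\<bar>))"
  proof (rule sum_mono2)
    show "{- int M..int M} \<subseteq> int ` {..M} \<union> (\<lambda>n. - int n) ` {..M}"
    proof
      fix a assume a: "a \<in> {- int M..int M}"
      then have "nat \<bar>a\<bar> \<in> {..M}" by auto
      moreover have "a = int (nat \<bar>a\<bar>) \<or> a = - int (nat \<bar>a\<bar>)" by auto
      ultimately show "a \<in> int ` {..M} \<union> (\<lambda>n. - int n) ` {..M}" by blast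
    qed
  qed (use g in auto)
  also have "\<dots> \<le> (\<Sum>a\<in>int ` {..M}. g (nat \<bar>a\<bar>)) + (\<Sum>a\<in>(\<lambda>n. - int n) ` {..M}. g (nat \<bar>a\<bar>))"
    using sum.union_inter[of "int ` {..M}" "(\<lambda>n. - int n) ` {..M}" "\<lambda>a. g (nat \<bar>a\<bar>)"]
      sum_nonneg[of "int ` {..M} \<inter> (\<lambda>n. - int n) ` {..M}" "\<lambda>a. g (nat \<bar>a\<bar>)"] g by simp
  also have "\<dots> = 2 * (\<Sum>n\<le>M. g n)"
    by (simp add: sum.reindex inj_on_def)
  finally show ?thesis .
qed

lemma harmonic_sum_le: "(\<Sum>n\<le>M. 1 / (1 + real n)) \<le> 1 + ln (1 + real M)"
proof (induction M)
  case 0 then show ?case by simp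
next
  case (Suc M)
  have "ln ((1 + real M) / (2 + real M)) \<le> (1 + real M) / (2 + real M) - 1"
    by (rule ln_le_minus_one) simp
  also have "\<dots> = - (1 / (2 + real M))" by (simp add: field_simps)
  finally have "1 / (2 + real M) \<le> ln (2 + real M) - ln (1 + real M)"
    by (simp add: ln_div)
  then show ?case using Suc.IH by (simp add: add.commute)
qed

lemma card_int_ball_le:
  assumes "0 \<le> X"
  shows "finite {a::int. 1 + \<bar>real_of_int a\<bar> \<le> X}" and "real (card {a::int. 1 + \<bar>real_of_int a\<bar> \<le> X}) \<le> 2 * X"
proof -
  have eq: "{a::int. 1 + \<bar>real_of_int a\<bar> \<le> X} = {- \<lfloor>X - 1\<rfloor>..\<lfloor>X - 1\<rfloor>}"
  proof (rule set_eqI)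
    fix a :: int
    have "1 + \<bar>real_of_int a\<bar> \<le> X \<longleftrightarrow> \<bar>a\<bar> \<le> \<lfloor>X - 1\<rfloor>" by (simp add: le_floor_iff) linarith
    then show "a \<in> {a. 1 + \<bar>real_of_int a\<bar> \<le> X} \<longleftrightarrow> a \<in> {- \<lfloor>X - 1\<rfloor>..\<lfloor>X - 1\<rfloor>}" by auto
  qed
  show "finite {a::int. 1 + \<bar>real_of_int a\<bar> \<le> X}" unfolding eq by simp
  show "real (card {a::int. 1 + \<bar>real_of_int a\<bar> \<le> X}) \<le> 2 * X"
  proof (cases "0 \<le> \<lfloor>X - 1\<rfloor>")
    case True
    have "real (card {- \<lfloor>X - 1\<rfloor>..\<lfloor>X - 1\<rfloor>}) = 2 * real_of_int \<lfloor>X - 1\<rfloor> + 1" using True by simp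
    also have "\<dots> \<le> 2 * (X - 1) + 1" using of_int_floor_le[of "X - 1"] by simp
    finally show ?thesis unfolding eq by simp
  qed (use assms eq in simp)
qed

text \<open>For fixed values of the other coordinates there are at most \<open>2 * T\<close>, divided by their weight, choices for the
  coordinate \<open>j0\<close>. The sum of the reciprocal weights is a product of one-dimensional sums: a
  harmonic sum for each of the other coordinates in \<open>P\<close>, a convergent series for each coordinate outside \<open>P\<close>.\<close>

lemma card_mixed_weight_le:
  fixes \<beta> :: "'d::finite \<Rightarrow> real"
  assumes P: "j0 \<in> P" and \<beta>: "\<And>j. j \<in> P \<Longrightarrow> \<beta> j = 1" "\<And>j. j \<notin> P \<Longrightarrow> 1 < \<beta> j"
  shows "\<exists>C\<ge>1. \<forall>T\<ge>1. finite {k. mixed_weight \<beta> k \<le> T} \<and>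
    real (card {k. mixed_weight \<beta> k \<le> T}) \<le> C * T * (1 + ln T) ^ (card P - 1)"
proof -
  define R where "R = UNIV - {j0}"
  have finR: "finite R" "j0 \<notin> R" "UNIV = insert j0 R" unfolding R_def by auto
  have \<beta>1: "1 \<le> \<beta> j" for j using \<beta>[of j] by (cases "j \<in> P") auto
  define Z where "Z j = (\<Sum>n. (1 + real n) powr - \<beta> j)" for j
  have summ: "summable (\<lambda>n. (1 + real n) powr - \<beta> j)" if "j \<notin> P" for j
  proof -
    have "summable (\<lambda>n. real n powr - \<beta> j)" using \<beta>(2)[OF that] by (simp add: summable_real_powr_iff)
    then have "summable (\<lambda>n. real (Suc n) powr - \<beta> j)" by (subst summable_Suc_iff)
    then show ?thesis by (simp add: add.commute)
  qed
  \<comment> \<open>The maximum with 1 makes the constant a valid divisor for any choice of the parameters.\<close>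
  define C where "C = max 1 (2 * (4 ^ (card P - 1) * (\<Prod>j\<in>R - P. 2 * Z j)))"
  have "finite {k. mixed_weight \<beta> k \<le> T} \<and>
    real (card {k. mixed_weight \<beta> k \<le> T}) \<le> C * T * (1 + ln T) ^ (card P - 1)" if T: "1 \<le> T" for T
  proof -
    define M where "M = nat \<lfloor>T\<rfloor>"
    define A where "A = {- int M..int M}"
    define rest where "rest u = (\<Prod>j\<in>R. (1 + \<bar>real_of_int (u j)\<bar>) powr \<beta> j)" for u :: "'d \<Rightarrow> int"
    have rest1: "1 \<le> rest u" for u
      unfolding rest_def using \<beta>1 by (intro prod_ge_1 ge_one_powr_ge_zero) (auto intro: order_trans[of 0 1])
    have q0: "0 \<le> T / rest u" for u using T rest1[of u] by simp
    let ?S = "{k. mixed_weight \<beta> k \<le> T}"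
    let ?D = "Sigma (R \<rightarrow>\<^sub>E A) (\<lambda>u. {a. 1 + \<bar>real_of_int a\<bar> \<le> T / rest u})"
    let ?\<phi> = "\<lambda>k::int ^ 'd. (restrict (($) k) R, k $ j0)"
    have finD: "finite ?D"
      by (intro finite_SigmaI finite_PiE card_int_ball_le(1) q0 finR(1)) (simp add: A_def)
    have split: "mixed_weight \<beta> k = (1 + \<bar>real_of_int (k $ j0)\<bar>) * rest (restrict (($) k) R)" for k
    proof -
      have "mixed_weight \<beta> k = (\<Prod>j\<in>insert j0 R. (1 + \<bar>real_of_int (k $ j)\<bar>) powr \<beta> j)"
        unfolding mixed_weight_def finR(3)[symmetric] ..
      also have "\<dots> = (1 + \<bar>real_of_int (k $ j0)\<bar>) powr \<beta> j0 * rest (($) k)"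
        unfolding rest_def using finR by (subst prod.insert) auto
      also have "rest (($) k) = rest (restrict (($) k) R)" unfolding rest_def by simp
      finally show ?thesis using \<beta>(1)[OF P] by simp
    qed
    have sub: "?\<phi> ` ?S \<subseteq> ?D"
    proof (rule image_subsetI)
      fix k assume "k \<in> ?S"
      then have k: "mixed_weight \<beta> k \<le> T" by simp
      have "k $ j \<in> A" for j
      proof -
        have "1 + \<bar>real_of_int (k $ j)\<bar> \<le> (1 + \<bar>real_of_int (k $ j)\<bar>) powr \<beta> j"
          using powr_mono[of 1 "\<beta> j" "1 + \<bar>real_of_int (k $ j)\<bar>"] \<beta>1[of j] by simp
        also have "\<dots> \<le> mixed_weight \<beta> k"
        proof -
          have "1 * (1 + \<bar>real_of_int (k $ j)\<bar>) powr \<beta> j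
            \<le> (\<Prod>i\<in>UNIV - {j}. (1 + \<bar>real_of_int (k $ i)\<bar>) powr \<beta> i) * (1 + \<bar>real_of_int (k $ j)\<bar>) powr \<beta> j"
            using \<beta>1 by (intro mult_right_mono prod_ge_1 ge_one_powr_ge_zero) (auto intro: order_trans[of 0 1])
          then show ?thesis unfolding mixed_weight_def by (subst prod.remove[of UNIV j]) (simp_all add: mult.commute)
        qed
        finally have "\<bar>real_of_int (k $ j)\<bar> \<le> T" using k by simp
        then have "\<bar>k $ j\<bar> \<le> \<lfloor>T\<rfloor>" by (simp add: le_floor_iff)
        then show ?thesis using T unfolding A_def M_def by auto
      qed
      moreover have "0 < rest (restrict (($) k) R)" using rest1 by (rule less_le_trans[OF zero_less_one])
      then have "1 + \<bar>real_of_int (k $ j0)\<bar> \<le> T / rest (restrict (($) k) R)"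
        using k unfolding split by (simp add: pos_le_divide_eq)
      ultimately show "?\<phi> k \<in> ?D" by auto
    qed
    have inj: "inj_on ?\<phi> ?S"
    proof (rule inj_onI)
      fix k l assume eq: "?\<phi> k = ?\<phi> l"
      have "k $ j = l $ j" for j
      proof (cases "j = j0")
        case True then show ?thesis using eq by simp
      next
        case False
        then have "j \<in> R" unfolding R_def by simp
        then show ?thesis using eq by (metis prod.inject restrict_apply')
      qed
      then show "k = l" by (simp add: vec_eq_iff)
    qed
    have finS: "finite ?S" using finite_imageD[OF finite_subset[OF sub finD] inj] .
    have "real (card ?S) \<le> real (card ?D)"
      using card_inj_on_le[OF inj sub finD] by simp
    also have "\<dots> = (\<Sum>u\<in>R \<rightarrow>\<^sub>E A. real (card {a. 1 + \<bar>real_of_int a\<bar> \<le> T / rest u}))"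
    proof (subst card_SigmaI)
      show "finite (R \<rightarrow>\<^sub>E A)" by (intro finite_PiE finR(1)) (simp add: A_def)
      show "\<forall>u\<in>R \<rightarrow>\<^sub>E A. finite {a::int. 1 + \<bar>real_of_int a\<bar> \<le> T / rest u}"
        by (intro ballI card_int_ball_le(1) q0)
    qed simp
    also have "\<dots> \<le> (\<Sum>u\<in>R \<rightarrow>\<^sub>E A. 2 * (T / rest u))"
      by (intro sum_mono card_int_ball_le(2) q0)
    also have "\<dots> = 2 * T * (\<Sum>u\<in>R \<rightarrow>\<^sub>E A. \<Prod>j\<in>R. (1 + \<bar>real_of_int (u j)\<bar>) powr - \<beta> j)"
      unfolding rest_def sum_distrib_left
      by (intro sum.cong refl) (simp add: powr_minus prod_inversef[symmetric] divide_inverse comp_def)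
    also have "(\<Sum>u\<in>R \<rightarrow>\<^sub>E A. \<Prod>j\<in>R. (1 + \<bar>real_of_int (u j)\<bar>) powr - \<beta> j)
        = (\<Prod>j\<in>R. \<Sum>a\<in>A. (1 + \<bar>real_of_int a\<bar>) powr - \<beta> j)"
      using finR by (subst prod_sum_PiE) (auto simp: A_def)
    also have "\<dots> \<le> (\<Prod>j\<in>R. if j \<in> P then 4 * (1 + ln T) else 2 * Z j)"
    proof (rule prod_mono, intro conjI)
      fix j assume "j \<in> R"
      show "0 \<le> (\<Sum>a\<in>A. (1 + \<bar>real_of_int a\<bar>) powr - \<beta> j)" by (intro sum_nonneg) simp
      have "(\<Sum>a\<in>A. (1 + \<bar>real_of_int a\<bar>) powr - \<beta> j) = (\<Sum>a\<in>A. (1 + real (nat \<bar>a\<bar>)) powr - \<beta> j)"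
        by (intro sum.cong refl) simp
      also have "\<dots> \<le> 2 * (\<Sum>n\<le>M. (1 + real n) powr - \<beta> j)"
        unfolding A_def by (rule sum_over_symmetric_interval_le) simp
      finally have *: "(\<Sum>a\<in>A. (1 + \<bar>real_of_int a\<bar>) powr - \<beta> j) \<le> 2 * (\<Sum>n\<le>M. (1 + real n) powr - \<beta> j)" .
      show "(\<Sum>a\<in>A. (1 + \<bar>real_of_int a\<bar>) powr - \<beta> j) \<le> (if j \<in> P then 4 * (1 + ln T) else 2 * Z j)"
      proof (cases "j \<in> P")
        case True
        have "(\<Sum>n\<le>M. (1 + real n) powr - \<beta> j) = (\<Sum>n\<le>M. 1 / (1 + real n))"
          using \<beta>(1)[OF True] by (simp add: powr_minus divide_inverse)
        also have "\<dots> \<le> 1 + ln (1 + real M)" by (rule harmonic_sum_le)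
        also have "\<dots> \<le> 1 + ln (2 * T)"
        proof -
          have "real M \<le> T" using T unfolding M_def by simp
          then show ?thesis using T by simp
        qed
        also have "\<dots> = 1 + (ln 2 + ln T)" using T by (simp add: ln_mult)
        finally have y: "(\<Sum>n\<le>M. (1 + real n) powr - \<beta> j) \<le> 1 + (ln 2 + ln T)" .
        have arith: "x \<le> 4 * (1 + b)" if "x \<le> 2 * y" "y \<le> 1 + (a + b)" "a < 1" "0 \<le> b" for x y a b :: real
          using that by (simp add: algebra_simps)
        show ?thesis unfolding if_P[OF True] by (rule arith[OF * y ln_2_less_1 ln_ge_zero[OF T]])
      next
        case False
        have "(\<Sum>n\<le>M. (1 + real n) powr - \<beta> j) \<le> Z j"
          unfolding Z_def by (rule sum_le_suminf[OF summ[OF False]]) auto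
        then show ?thesis using * False by simp
      qed
    qed
    also have "\<dots> = (4 * (1 + ln T)) ^ (card P - 1) * (\<Prod>j\<in>R - P. 2 * Z j)"
    proof -
      have "card (R \<inter> P) = card P - 1"
      proof -
        have "R \<inter> P = P - {j0}" unfolding R_def by auto
        then show ?thesis using P by simp
      qed
      then show ?thesis using finR(1) by (subst prod.If_cases) (simp_all add: Diff_eq)
    qed
    finally have "real (card ?S) \<le> 2 * T * ((4 * (1 + ln T)) ^ (card P - 1) * (\<Prod>j\<in>R - P. 2 * Z j))"
      using T by simp
    also have "\<dots> = (2 * (4 ^ (card P - 1) * (\<Prod>j\<in>R - P. 2 * Z j))) * (T * (1 + ln T) ^ (card P - 1))"
      by (simp only: power_mult_distrib mult_ac)
    also have "\<dots> \<le> C * (T * (1 + ln T) ^ (card P - 1))"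
      unfolding C_def using T by (intro mult_right_mono) simp_all
    finally show ?thesis using finS by (simp add: mult.assoc)
  qed
  moreover have "1 \<le> C" unfolding C_def by simp
  ultimately show ?thesis by blast
qed


lemma mixed_weight_ge_1: "(\<And>j. 0 \<le> \<beta> j) \<Longrightarrow> 1 \<le> mixed_weight \<beta> k"
  unfolding mixed_weight_def by (intro prod_ge_1 ge_one_powr_ge_zero) auto

lemma mixed_weight_powr:
  "mixed_weight (\<lambda>j. h * \<beta> j) k = mixed_weight \<beta> k powr h"
proof -
  have "mixed_weight \<beta> k powr h = (\<Prod>j\<in>UNIV. ((1 + \<bar>of_int (k $ j)\<bar>) powr \<beta> j) powr h)"
    unfolding mixed_weight_def by (rule prod_powr_distrib)
  then show ?thesis unfolding mixed_weight_def by (simp add: powr_powr mult.commute)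
qed

lemma mixed_weight_mono:
  "(\<And>j. \<beta> j \<le> \<gamma> j) \<Longrightarrow> mixed_weight \<beta> k \<le> mixed_weight \<gamma> k"
  unfolding mixed_weight_def by (intro prod_mono conjI powr_mono) auto

text \<open>The cross with parameters \<open>P\<close> and \<open>N\<close> is taken up to the height \<open>T P N n\<close>, in which the factor
  \<open>c P N\<close> is \<open>(1/2) ^ Suc N\<close> divided by the constant of the cardinality bound and by the number of sets \<open>P\<close>;
  so the cardinalities add up to at most \<open>n\<close>. Given \<open>\<alpha>\<close> with minimum \<open>h\<close>, let \<open>P\<close> be the set where
  the minimum is attained and \<open>N\<close> so large that \<open>1 + 1 / Suc N\<close> is below \<open>\<alpha> $ j / h\<close> outside \<open>P\<close>; then
  the Sobolev weight dominates the \<open>h\<close>-th power of the weight of that cross.\<close>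

lemma universal_frequency_sets:
  "\<exists>\<Lambda> :: nat \<Rightarrow> (int ^ 'd) set.
     (\<forall>n. finite (\<Lambda> n) \<and> card (\<Lambda> n) \<le> n) \<and>
     (\<forall>k. \<exists>N. \<forall>n\<ge>N. k \<in> \<Lambda> n) \<and>
     (\<forall>\<alpha> :: real ^ 'd. (\<forall>j. 0 < \<alpha> $ j) \<longrightarrow> (\<exists>c>0. \<forall>n\<ge>1. \<forall>k. k \<notin> \<Lambda> n \<longrightarrow>
        (c * real n / (1 + ln (real n)) ^ (min_multiplicity \<alpha> - 1)) powr min_smoothness \<alpha>
          \<le> mixed_weight (($) \<alpha>) k))"
proof -
  define \<beta> :: "'d set \<Rightarrow> nat \<Rightarrow> 'd \<Rightarrow> real" where "\<beta> P N j = (if j \<in> P then 1 else 1 + 1 / real (Suc N))" for P N j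
  have \<beta>0: "0 \<le> \<beta> P N j" for P N j unfolding \<beta>_def by simp
  have mw1: "1 \<le> mixed_weight (\<beta> P N) k" for P N k by (rule mixed_weight_ge_1) (rule \<beta>0)
  have "\<exists>C\<ge>1. P \<noteq> {} \<longrightarrow> (\<forall>T\<ge>1. finite {k. mixed_weight (\<beta> P N) k \<le> T} \<and>
      real (card {k. mixed_weight (\<beta> P N) k \<le> T}) \<le> C * T * (1 + ln T) ^ (card P - 1))" for P N
  proof (cases "P = {}")
    case False
    then obtain j0 where "j0 \<in> P" by blast
    then have "\<exists>C\<ge>1. \<forall>T\<ge>1. finite {k. mixed_weight (\<beta> P N) k \<le> T} \<and>
      real (card {k. mixed_weight (\<beta> P N) k \<le> T}) \<le> C * T * (1 + ln T) ^ (card P - 1)"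
      by (rule card_mixed_weight_le) (simp_all add: \<beta>_def)
    then show ?thesis by blast
  qed auto
  then obtain C where C1: "\<And>P N. 1 \<le> C P N"
    and C: "\<And>P N T. P \<noteq> {} \<Longrightarrow> 1 \<le> T \<Longrightarrow> finite {k. mixed_weight (\<beta> P N) k \<le> T}"
      "\<And>P N T. P \<noteq> {} \<Longrightarrow> 1 \<le> T \<Longrightarrow>
        real (card {k. mixed_weight (\<beta> P N) k \<le> T}) \<le> C P N * T * (1 + ln T) ^ (card P - 1)"
    by metis
  define D where "D = real (card (UNIV :: 'd set set))"
  have D1: "1 \<le> D" unfolding D_def by (simp add: Suc_le_eq finite_UNIV_card_ge_0)
  define c where "c P N = (1/2) ^ Suc N / (D * C P N)" for P N
  have c0: "0 < c P N" for P N unfolding c_def using D1 C1[of P N] by simp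
  have c2: "c P N \<le> (1/2) ^ Suc N" for P N
    unfolding c_def using D1 C1[of P N] mult_mono[of 1 D 1 "C P N"] by (simp add: divide_simps)
  define T where "T P N n = c P N * real n / (1 + ln (real n)) ^ (card P - 1)" for P :: "'d set" and N n
  define Q where "Q P N n = {k. mixed_weight (\<beta> P N) k \<le> T P N n}" for P N n
  have lg: "1 \<le> (1 + ln (real n)) ^ i" if "1 \<le> n" for n i using that by (intro one_le_power) simp
  have Tle: "T P N n \<le> (1/2) ^ Suc N * real n" if "1 \<le> n" for P N n
  proof -
    have "T P N n \<le> c P N * real n / 1"
      unfolding T_def using lg[OF that, of "card P - 1"] c0[of P N] by (intro divide_left_mono) auto
    also have "\<dots> \<le> (1/2) ^ Suc N * real n / 1" using c2[of P N] by (intro divide_right_mono mult_right_mono) auto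
    finally show ?thesis by simp
  qed
  have Qempty: "Q P N n = {}" if "T P N n < 1" for P N n
  proof -
    have "\<not> mixed_weight (\<beta> P N) k \<le> T P N n" for k using mw1[of P N k] that by linarith
    then show ?thesis unfolding Q_def by simp
  qed
  have Qcard: "finite (Q P N n) \<and> real (card (Q P N n)) \<le> (1/2) ^ Suc N / D * real n" if P: "P \<noteq> {}" and n: "1 \<le> n" for P N n
  proof (cases "T P N n < 1")
    case True then show ?thesis using Qempty D1 by simp
  next
    case False
    then have T1: "1 \<le> T P N n" by simp
    have "T P N n \<le> (1/2) ^ Suc N * real n" by (rule Tle[OF n])
    also have "\<dots> \<le> 1 * real n" by (intro mult_right_mono power_le_one) auto
    finally have Tn: "T P N n \<le> real n" by simp
    have "real (card (Q P N n)) \<le> C P N * T P N n * (1 + ln (T P N n)) ^ (card P - 1)"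
      unfolding Q_def by (rule C(2)[OF P T1])
    also have "\<dots> \<le> C P N * T P N n * (1 + ln (real n)) ^ (card P - 1)"
      using T1 Tn C1[of P N] by (intro mult_left_mono power_mono) auto
    also have "\<dots> = C P N * c P N * real n"
    proof -
      have cancel: "u * (v * w / g) * g = u * v * w" if "1 \<le> g" for u v w g :: real using that by simp
      show ?thesis unfolding T_def by (rule cancel[OF lg[OF n]])
    qed
    also have "C P N * c P N = (1/2) ^ Suc N / D" unfolding c_def using C1[of P N] by simp
    finally show ?thesis using C(1)[OF P T1] unfolding Q_def by simp
  qed
  define \<Lambda> where "\<Lambda> n = (if n = 0 then {} else \<Union>P\<in>- {{}}. \<Union>N<n. Q P N n)" for n
  \<comment> \<open>For \<open>N \<ge> n\<close> the height \<open>T P N n\<close> is below 1, so the crosses left out of the union are empty.\<close>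
  have notin: "T P N n < mixed_weight (\<beta> P N) k" if "P \<noteq> {}" "1 \<le> n" "k \<notin> \<Lambda> n" for P N n k
  proof (cases "N < n")
    case True
    then have "k \<notin> Q P N n" using that unfolding \<Lambda>_def by auto
    then show ?thesis unfolding Q_def by simp
  next
    case False
    have "real n < 2 ^ n" by (rule of_nat_less_two_power)
    also have "(2::real) ^ n \<le> 2 ^ Suc N" using False by (intro power_increasing) auto
    finally have "(1/2) ^ Suc N * real n < 1" by (simp add: power_divide divide_simps)
    then have "T P N n < 1" using Tle[OF that(2), of P N] by simp
    then show ?thesis using mw1[of P N k] by linarith
  qed
  have "finite (\<Lambda> n) \<and> card (\<Lambda> n) \<le> n" for n
  proof (cases "n = 0")
    case False
    then have n: "1 \<le> n" by simp
    have half: "(\<Sum>N<n. (1/2::real) ^ Suc N) \<le> 1"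
      using sum_le_suminf[OF sums_summable[OF power_half_series], of "{..<n}"] sums_unique[OF power_half_series] by simp
    have "card (\<Lambda> n) \<le> (\<Sum>P\<in>- {{}}. card (\<Union>N<n. Q P N n))"
      unfolding \<Lambda>_def if_not_P[OF False] by (rule card_UN_le) simp
    also have "\<dots> \<le> (\<Sum>P\<in>- {{}}. \<Sum>N<n. card (Q P N n))"
      by (intro sum_mono card_UN_le) simp
    finally have "real (card (\<Lambda> n)) \<le> (\<Sum>P\<in>- {{}}. \<Sum>N<n. real (card (Q P N n)))"
      by (simp only: of_nat_sum[symmetric] of_nat_le_iff)
    also have "\<dots> \<le> (\<Sum>P\<in>- {{}::'d set}. \<Sum>N<n. (1/2) ^ Suc N / D * real n)"
      using Qcard n by (intro sum_mono) auto
    also have "\<dots> = real (card (- {{}::'d set})) * ((\<Sum>N<n. (1/2) ^ Suc N) * (real n / D))"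
      by (simp only: sum_distrib_right sum_constant) (simp only: times_divide_eq_left times_divide_eq_right)
    also have "\<dots> \<le> D * (1 * (real n / D))"
    proof (rule mult_mono)
      show "real (card (- {{}::'d set})) \<le> D" unfolding D_def by (intro of_nat_mono card_mono) simp_all
      show "(\<Sum>N<n. (1/2) ^ Suc N) * (real n / D) \<le> 1 * (real n / D)"
        using D1 by (intro mult_right_mono half) simp
      show "0 \<le> (\<Sum>N<n. (1/2) ^ Suc N) * (real n / D)"
        using D1 by (intro mult_nonneg_nonneg sum_nonneg) simp_all
    qed (use D1 in simp)
    also have "\<dots> = real n" using D1 by simp
    finally have "card (\<Lambda> n) \<le> n" by simp
    moreover have "finite (\<Lambda> n)" unfolding \<Lambda>_def using Qcard n by auto
    ultimately show ?thesis by simp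
  qed (simp add: \<Lambda>_def)
  moreover have "\<exists>N. \<forall>n\<ge>N. k \<in> \<Lambda> n" for k
  proof -
    fix j0 :: 'd
    obtain N where N: "mixed_weight (\<beta> {j0} 0) k / c {j0} 0 \<le> real N" using real_arch_simple by blast
    have "k \<in> \<Lambda> n" if n: "max 1 N \<le> n" for n
    proof -
      have "mixed_weight (\<beta> {j0} 0) k / c {j0} 0 \<le> real n" using N n by linarith
      then have "k \<in> Q {j0} 0 n" unfolding Q_def T_def using c0[of "{j0}" 0] by (simp add: pos_divide_le_eq mult.commute)
      then show ?thesis unfolding \<Lambda>_def using n by (auto intro!: exI[of _ "{j0}"] bexI[of _ 0])
    qed
    then show ?thesis by blast
  qed
  moreover have "\<exists>c>0. \<forall>n\<ge>1. \<forall>k. k \<notin> \<Lambda> n \<longrightarrow>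
        (c * real n / (1 + ln (real n)) ^ (min_multiplicity \<alpha> - 1)) powr min_smoothness \<alpha>
          \<le> mixed_weight (($) \<alpha>) k" if \<alpha>: "\<forall>j. 0 < \<alpha> $ j" for \<alpha> :: "real ^ 'd"
  proof -
    define h where "h = min_smoothness \<alpha>"
    define P where "P = {j. \<alpha> $ j = h}"
    have hin: "h \<in> range (($) \<alpha>)" unfolding h_def min_smoothness_def by (rule Min_in) auto
    then have P0: "P \<noteq> {}" unfolding P_def by auto
    have h0: "0 < h" using hin \<alpha> by auto
    have hle: "h \<le> \<alpha> $ j" for j unfolding h_def min_smoothness_def by (rule Min_le) auto
    \<comment> \<open>The element 2 keeps the set nonempty when all entries of \<open>\<alpha>\<close> are equal.\<close>
    define r where "r = Min (insert 2 ((\<lambda>j. \<alpha> $ j / h) ` (- P)))"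
    have "1 < r"
    proof -
      have "1 < \<alpha> $ j / h" if "j \<in> - P" for j
        using that hle[of j] h0 unfolding P_def by (simp add: less_le)
      then show ?thesis unfolding r_def by (subst Min_gr_iff) auto
    qed
    have rle: "r \<le> \<alpha> $ j / h" if "j \<notin> P" for j unfolding r_def using that by (intro Min_le) auto
    obtain N where N: "1 / real (Suc N) < r - 1" using \<open>1 < r\<close> nat_approx_posE[of "r - 1"] by auto
    have \<beta>le: "h * \<beta> P N j \<le> \<alpha> $ j" for j
    proof (cases "j \<in> P")
      case True then show ?thesis unfolding \<beta>_def by (simp add: P_def)
    next
      case False
      then have "\<beta> P N j \<le> \<alpha> $ j / h" using N rle[OF False] unfolding \<beta>_def by simp
      then show ?thesis using h0 by (simp add: pos_le_divide_eq mult.commute)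
    qed
    have "(c P N * real n / (1 + ln (real n)) ^ (min_multiplicity \<alpha> - 1)) powr min_smoothness \<alpha>
          \<le> mixed_weight (($) \<alpha>) k" if n: "1 \<le> n" and k: "k \<notin> \<Lambda> n" for n k
    proof -
      have "(c P N * real n / (1 + ln (real n)) ^ (min_multiplicity \<alpha> - 1)) powr min_smoothness \<alpha> = T P N n powr h"
        unfolding T_def min_multiplicity_def P_def h_def ..
      also have "\<dots> \<le> mixed_weight (\<beta> P N) k powr h"
      proof (rule powr_mono2)
        show "0 \<le> T P N n" unfolding T_def using c0[of P N] lg[OF n, of "card P - 1"] by simp
      qed (use notin[OF P0 n k, of N] h0 in auto)
      also have "\<dots> = mixed_weight (\<lambda>j. h * \<beta> P N j) k" by (rule mixed_weight_powr[symmetric])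
      also have "\<dots> \<le> mixed_weight (($) \<alpha>) k" by (rule mixed_weight_mono) (rule \<beta>le)
      finally show ?thesis .
    qed
    then show ?thesis using c0[of P N] by blast
  qed
  ultimately show ?thesis by (intro exI[of _ \<Lambda>]) simp
qed

section \<open>Completeness of the trigonometric system\<close>

text \<open>Since the characters are closed under products, this space of functions is invariant under multiplication by
  characters, and therefore under multiplication by polynomials in the coordinates of \<open>torus_embedding\<close>.\<close>

definition zero_spectrum :: "(real ^ 'd \<Rightarrow> complex) set" where
  "zero_spectrum = {h. integrable torus_measure h \<and> (\<forall>k. (LINT x|torus_measure. h x * fourier_basis k x) = 0)}"

lemma integrable_mult_bounded_torus:
  fixes h b :: "real ^ 'd \<Rightarrow> complex"
  assumes h: "integrable torus_measure h" and b: "b \<in> borel_measurable borel" and M: "\<And>x. x \<in> torus \<Longrightarrow> cmod (b x) \<le> M"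
  shows "integrable torus_measure (\<lambda>x. h x * b x)"
proof (rule Bochner_Integration.integrable_bound)
  show "integrable torus_measure (\<lambda>x. M * cmod (h x))" using h by (intro integrable_mult_right integrable_norm)
  show "(\<lambda>x. h x * b x) \<in> borel_measurable torus_measure"
    using h borel_measurable_torus_measure[OF b] by (intro borel_measurable_times) auto
  show "AE x in torus_measure. norm (h x * b x) \<le> norm (M * cmod (h x))"
  proof (rule AE_I2)
    fix x :: "real ^ 'd" assume "x \<in> space torus_measure"
    then have "cmod (b x) \<le> M" using M by simp
    then have "cmod (h x) * cmod (b x) \<le> cmod (h x) * \<bar>M\<bar>" by (intro mult_left_mono) auto
    then show "norm (h x * b x) \<le> norm (M * cmod (h x))" by (simp add: norm_mult mult.commute)
  qed
qed

lemma integrable_mult_fourier_basis: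
  "integrable torus_measure h \<Longrightarrow> integrable torus_measure (\<lambda>x. h x * fourier_basis k x)"
  by (rule integrable_mult_bounded_torus[where M = 1]) auto

lemma zero_spectrum_add:
  "g \<in> zero_spectrum \<Longrightarrow> h \<in> zero_spectrum \<Longrightarrow> (\<lambda>x. g x + h x) \<in> zero_spectrum"
  unfolding zero_spectrum_def by (simp add: distrib_right integrable_mult_fourier_basis)

lemma zero_spectrum_scale:
  "h \<in> zero_spectrum \<Longrightarrow> (\<lambda>x. c * h x) \<in> zero_spectrum"
  unfolding zero_spectrum_def by (simp add: mult.assoc integrable_mult_fourier_basis)

lemma zero_spectrum_sum:
  "finite A \<Longrightarrow> (\<And>a. a \<in> A \<Longrightarrow> h a \<in> zero_spectrum) \<Longrightarrow> (\<lambda>x. \<Sum>a\<in>A. h a x) \<in> zero_spectrum"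
  by (induction A rule: finite_induct) (simp_all add: zero_spectrum_add, simp add: zero_spectrum_def)

lemma zero_spectrum_modulate:
  fixes h :: "real ^ 'd \<Rightarrow> complex"
  assumes "h \<in> zero_spectrum" shows "(\<lambda>x. fourier_basis l x * h x) \<in> zero_spectrum"
proof -
  have eq: "fourier_basis l x * h x * fourier_basis k x = h x * fourier_basis (l + k) x" for k x
    by (simp add: fourier_basis_add)
  have "integrable torus_measure (\<lambda>x. fourier_basis l x * h x)"
    using integrable_mult_fourier_basis[of h l] assms unfolding zero_spectrum_def by (simp add: mult.commute)
  then show ?thesis using assms unfolding zero_spectrum_def mem_Collect_eq eq by simp
qed

text \<open>The cube is wrapped onto a product of unit circles, so that continuous functions on the image are the continuous
  periodic functions.\<close>

definition torus_embedding :: "real ^ 'd \<Rightarrow> complex ^ 'd" where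
  "torus_embedding x = (\<chi> j. fourier_basis (axis j 1) x)"

lemma fourier_basis_axis: "fourier_basis (axis j 1) x = exp (2 * of_real pi * \<i> * of_real (x $ j))"
proof -
  have "(\<Sum>i\<in>UNIV. real_of_int (axis j 1 $ i) * x $ i) = (\<Sum>i\<in>UNIV. if i = j then x $ i else 0)"
    by (rule sum.cong) (auto simp: axis_def)
  then show ?thesis unfolding fourier_basis_def by simp
qed

lemma continuous_torus_embedding: "continuous_on S torus_embedding"
  unfolding torus_embedding_def by (intro continuous_intros continuous_fourier_basis)

lemma inj_on_torus_embedding: "inj_on torus_embedding torus"
proof (rule inj_onI)
  fix x y :: "real ^ 'd" assume xy: "x \<in> torus" "y \<in> torus" "torus_embedding x = torus_embedding y"
  have "x $ j = y $ j" for j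
  proof -
    have "exp (2 * of_real pi * \<i> * of_real (x $ j)) = exp (2 * of_real pi * \<i> * of_real (y $ j))"
      using xy(3) by (simp add: torus_embedding_def vec_eq_iff fourier_basis_axis)
    then obtain n :: int where "2 * of_real pi * \<i> * of_real (x $ j) = 2 * of_real pi * \<i> * of_real (y $ j) + (of_int (2 * n) * pi) * \<i>"
      by (auto simp: exp_eq)
    then have "complex_of_real (2 * pi * x $ j) * \<i> = complex_of_real (2 * pi * (y $ j + of_int n)) * \<i>"
      by (simp add: algebra_simps)
    then have "2 * pi * x $ j = 2 * pi * (y $ j + of_int n)"
      by (metis complex_i_not_zero mult_right_cancel of_real_eq_iff)
    then have eq: "x $ j = y $ j + of_int n" by simp
    have "0 \<le> x $ j" "x $ j < 1" "0 \<le> y $ j" "y $ j < 1" using xy by (auto simp: torus_def)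
    then have "-1 < real_of_int n" "real_of_int n < 1" using eq by linarith+
    then show ?thesis using eq by simp
  qed
  then show "x = y" by (simp add: vec_eq_iff)
qed

text \<open>A coordinate of the embedding is a linear combination of a character and its conjugate; sums and products follow
  from the invariance of \<open>zero_spectrum\<close>.\<close>

lemma zero_spectrum_polynomial:
  fixes h :: "real ^ 'd \<Rightarrow> complex"
  assumes "real_polynomial_function p" "h \<in> zero_spectrum"
  shows "(\<lambda>x. of_real (p (torus_embedding x)) * h x) \<in> zero_spectrum"
  using assms
proof (induction arbitrary: h rule: real_polynomial_function.induct)
  case (linear p)
  have comp: "complex_of_real (torus_embedding x \<bullet> axis j u)
      = (cnj u / 2) * fourier_basis (axis j 1) x + (u / 2) * fourier_basis (- axis j 1) x" for x :: "real ^ 'd" and j u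
  proof -
    define w where "w = fourier_basis (axis j 1) x"
    have "complex_of_real (w \<bullet> u) = (cnj u / 2) * w + (u / 2) * cnj w"
      by (simp add: complex_eq_iff inner_complex_def field_simps)
    then show ?thesis unfolding w_def by (simp add: inner_axis torus_embedding_def fourier_basis_cnj)
  qed
  have b: "(\<lambda>x. of_real (torus_embedding x \<bullet> b) * h x) \<in> zero_spectrum" if "b \<in> Basis" for b :: "complex ^ 'd"
  proof -
    obtain j u where bj: "b = axis j u" using \<open>b \<in> Basis\<close> by (auto simp: Basis_vec_def)
    have "(\<lambda>x. of_real (torus_embedding x \<bullet> b) * h x)
      = (\<lambda>x. (cnj u / 2) * (fourier_basis (axis j 1) x * h x) + (u / 2) * (fourier_basis (- axis j 1) x * h x))"
      unfolding bj comp by (simp add: algebra_simps)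
    also have "\<dots> \<in> zero_spectrum"
      by (intro zero_spectrum_add zero_spectrum_scale zero_spectrum_modulate linear.prems)
    finally show ?thesis .
  qed
  have pz: "p z = (\<Sum>b\<in>Basis. p b * (z \<bullet> b))" for z
  proof -
    interpret bounded_linear p by fact
    have "p z = p (\<Sum>b\<in>Basis. (z \<bullet> b) *\<^sub>R b)" by (simp add: euclidean_representation)
    then show ?thesis by (simp add: sum scaleR mult.commute)
  qed
  have "(\<lambda>x. of_real (p (torus_embedding x)) * h x)
      = (\<lambda>x. \<Sum>b\<in>Basis. of_real (p b) * (of_real (torus_embedding x \<bullet> b) * h x))"
    by (rule ext, subst pz) (simp add: sum_distrib_right mult.assoc)
  also have "\<dots> \<in> zero_spectrum"
    by (intro zero_spectrum_sum zero_spectrum_scale b) auto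
  finally show ?case .
next
  case (const c) then show ?case by (rule zero_spectrum_scale)
next
  case (add f g)
  have "(\<lambda>x. of_real (f (torus_embedding x)) * h x + of_real (g (torus_embedding x)) * h x) \<in> zero_spectrum"
    by (intro zero_spectrum_add add.IH add.prems)
  then show ?case by (simp add: distrib_right)
next
  case (mult f g)
  have "(\<lambda>x. of_real (f (torus_embedding x)) * (of_real (g (torus_embedding x)) * h x)) \<in> zero_spectrum"
    by (intro mult.IH mult.prems)
  then show ?case by (simp add: mult.assoc)
qed

text \<open>Stone-Weierstrass on the compact image of the closed cube.\<close>

lemma zero_spectrum_continuous:
  fixes h :: "real ^ 'd \<Rightarrow> complex" and F :: "complex ^ 'd \<Rightarrow> real"
  assumes h: "h \<in> zero_spectrum" and F: "continuous_on UNIV F"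
  shows "(LINT x|torus_measure. h x * of_real (F (torus_embedding x))) = 0"
proof -
  let ?S = "torus_embedding ` (cbox 0 1 :: (real ^ 'd) set)"
  have S: "compact ?S" by (intro compact_continuous_image continuous_torus_embedding compact_cbox)
  have inS: "torus_embedding x \<in> ?S" if "x \<in> torus" for x :: "real ^ 'd"
    using that torus_sandwich(2) by blast
  have int: "integrable torus_measure h" using h unfolding zero_spectrum_def by simp
  have meas: "(\<lambda>x. complex_of_real (G (torus_embedding x))) \<in> borel_measurable borel" if "continuous_on UNIV G" for G :: "complex ^ 'd \<Rightarrow> real"
    by (intro borel_measurable_continuous_onI continuous_on_of_real continuous_on_compose2[OF that continuous_torus_embedding]) simp
  have "cmod (LINT x|torus_measure. h x * of_real (F (torus_embedding x))) \<le> e * (LINT x|torus_measure. cmod (h x))"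
    if e: "0 < e" for e
  proof -
    obtain p where p: "real_polynomial_function p" "\<And>z. z \<in> ?S \<Longrightarrow> \<bar>F z - p z\<bar> < e"
      using Stone_Weierstrass_real_polynomial_function[OF S continuous_on_subset[OF F subset_UNIV] e] by blast
    have pc: "continuous_on UNIV p"
      using p(1) by (simp add: continuous_on_polymonial_function real_polynomial_function_eq)
    have dc: "continuous_on UNIV (\<lambda>z. F z - p z)" by (intro continuous_intros F pc)
    have "(\<lambda>x. of_real (p (torus_embedding x)) * h x) \<in> zero_spectrum" by (rule zero_spectrum_polynomial[OF p(1) h])
    then have pz: "integrable torus_measure (\<lambda>x. of_real (p (torus_embedding x)) * h x)"
      "(LINT x|torus_measure. of_real (p (torus_embedding x)) * h x * fourier_basis 0 x) = 0"
      unfolding zero_spectrum_def by blast+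
    have intd: "integrable torus_measure (\<lambda>x. h x * of_real (F (torus_embedding x) - p (torus_embedding x)))"
      by (rule integrable_mult_bounded_torus[OF int meas[OF dc], of e])
        (use p(2) inS in \<open>auto simp: less_imp_le simp del: of_real_diff\<close>)
    have "(LINT x|torus_measure. h x * of_real (F (torus_embedding x)))
        = (LINT x|torus_measure. h x * of_real (F (torus_embedding x) - p (torus_embedding x)) + of_real (p (torus_embedding x)) * h x)"
      by (intro Bochner_Integration.integral_cong refl) (simp add: algebra_simps)
    also have "\<dots> = (LINT x|torus_measure. h x * of_real (F (torus_embedding x) - p (torus_embedding x)))
        + (LINT x|torus_measure. of_real (p (torus_embedding x)) * h x)"
      by (rule Bochner_Integration.integral_add[OF intd pz(1)])
    also have "(LINT x|torus_measure. of_real (p (torus_embedding x)) * h x) = 0" using pz(2) by simp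
    finally have eq: "(LINT x|torus_measure. h x * of_real (F (torus_embedding x)))
        = (LINT x|torus_measure. h x * of_real (F (torus_embedding x) - p (torus_embedding x)))" by simp
    have "cmod (LINT x|torus_measure. h x * of_real (F (torus_embedding x)))
        \<le> (LINT x|torus_measure. cmod (h x * of_real (F (torus_embedding x) - p (torus_embedding x))))"
      unfolding eq by (rule integral_norm_bound)
    also have "\<dots> \<le> (LINT x|torus_measure. e * cmod (h x))"
    proof (rule integral_mono)
      show "integrable torus_measure (\<lambda>x. cmod (h x * of_real (F (torus_embedding x) - p (torus_embedding x))))"
        by (rule integrable_norm[OF intd])
      show "integrable torus_measure (\<lambda>x. e * cmod (h x))" by (intro integrable_mult_right integrable_norm int)
      fix x :: "real ^ 'd" assume "x \<in> space torus_measure"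
      then have "\<bar>F (torus_embedding x) - p (torus_embedding x)\<bar> \<le> e" using p(2)[OF inS] by (simp add: less_imp_le)
      then have "cmod (h x) * \<bar>F (torus_embedding x) - p (torus_embedding x)\<bar> \<le> cmod (h x) * e"
        by (rule mult_left_mono) simp
      then show "cmod (h x * of_real (F (torus_embedding x) - p (torus_embedding x))) \<le> e * cmod (h x)"
        unfolding norm_mult norm_of_real by (simp only: mult.commute)
    qed
    also have "\<dots> = e * (LINT x|torus_measure. cmod (h x))" by simp
    finally show ?thesis .
  qed
  note bound = this
  define I where "I = (LINT x|torus_measure. cmod (h x))"
  have I0: "0 \<le> I" unfolding I_def by simp
  have "cmod (LINT x|torus_measure. h x * of_real (F (torus_embedding x))) \<le> 0 + e" if "0 < e" for e
  proof -
    have "cmod (LINT x|torus_measure. h x * of_real (F (torus_embedding x))) \<le> e / (I + 1) * I"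
      using bound[of "e / (I + 1)"] that I0 unfolding I_def by simp
    also have "\<dots> \<le> e" using that I0 by (simp add: divide_simps)
    finally show ?thesis by simp
  qed
  then have "cmod (LINT x|torus_measure. h x * of_real (F (torus_embedding x))) \<le> 0" by (rule field_le_epsilon)
  then show ?thesis by simp
qed

text \<open>The indicator of a compact subset is a bounded limit of continuous functions of the distance to its image; the
  embedding is injective on the half-open cube, so the distance vanishes only on \<open>K\<close>.\<close>

lemma zero_spectrum_compact:
  fixes h :: "real ^ 'd \<Rightarrow> complex"
  assumes h: "h \<in> zero_spectrum" and K: "compact K" "K \<subseteq> torus"
  shows "(LINT x|torus_measure. h x * indicator K x) = 0"
proof (cases "K = {}")
  case False
  let ?E = "torus_embedding ` K"
  have E: "closed ?E" "?E \<noteq> {}"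
    using K False compact_continuous_image[OF continuous_torus_embedding] by (auto intro: compact_imp_closed)
  define F where "F n z = max 0 (1 - real n * infdist z ?E)" for n z
  have Fc: "continuous_on UNIV (F n)" for n
    unfolding F_def by (intro continuous_intros)
  have int: "integrable torus_measure h" using h unfolding zero_spectrum_def by simp
  have hm: "h \<in> borel_measurable torus_measure" using int by simp
  have lim: "(\<lambda>n. LINT x|torus_measure. h x * of_real (F n (torus_embedding x))) \<longlonglongrightarrow> (LINT x|torus_measure. h x * indicator K x)"
  proof (rule integral_dominated_convergence[where w = "\<lambda>x. cmod (h x)"])
    have "K \<in> sets borel" using K(1) by (simp add: compact_imp_closed borel_closed)
    then have "(indicator K :: _ \<Rightarrow> complex) \<in> borel_measurable borel" by simp
    then show "(\<lambda>x. h x * indicator K x) \<in> borel_measurable torus_measure"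
      by (intro borel_measurable_times hm borel_measurable_torus_measure)
    show "(\<lambda>x. h x * of_real (F n (torus_embedding x))) \<in> borel_measurable torus_measure" for n
      by (intro borel_measurable_times hm borel_measurable_torus_measure borel_measurable_continuous_onI
          continuous_on_of_real continuous_on_compose2[OF Fc continuous_torus_embedding]) simp
    show "integrable torus_measure (\<lambda>x. cmod (h x))" by (rule integrable_norm[OF int])
    show "AE x in torus_measure. norm (h x * of_real (F n (torus_embedding x))) \<le> cmod (h x)" for n
    proof (rule AE_I2)
      fix x :: "real ^ 'd"
      have "0 \<le> F n (torus_embedding x)" "F n (torus_embedding x) \<le> 1" unfolding F_def by (auto simp: infdist_nonneg)
      then have "cmod (h x) * \<bar>F n (torus_embedding x)\<bar> \<le> cmod (h x) * 1" by (intro mult_left_mono) auto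
      then show "norm (h x * of_real (F n (torus_embedding x))) \<le> cmod (h x)" by (simp add: norm_mult)
    qed
    show "AE x in torus_measure. (\<lambda>n. h x * of_real (F n (torus_embedding x))) \<longlonglongrightarrow> h x * indicator K x"
    proof (rule AE_I2)
      fix x :: "real ^ 'd" assume "x \<in> space torus_measure"
      then have x: "x \<in> torus" by simp
      have "(\<lambda>n. F n (torus_embedding x)) \<longlonglongrightarrow> indicator K x"
      proof (cases "x \<in> K")
        case True
        then have "infdist (torus_embedding x) ?E = 0" by simp
        then show ?thesis using True unfolding F_def by simp
      next
        case False
        then have "torus_embedding x \<notin> ?E" using inj_on_torus_embedding K(2) x by (auto dest: inj_onD)
        then have pos: "0 < infdist (torus_embedding x) ?E"
          using E by (simp add: infdist_pos_not_in_closed)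
        obtain N where N: "1 < real N * infdist (torus_embedding x) ?E"
          using reals_Archimedean3[OF pos] by blast
        have "F n (torus_embedding x) = 0" if "N \<le> n" for n
        proof -
          have "real N * infdist (torus_embedding x) ?E \<le> real n * infdist (torus_embedding x) ?E"
            using that pos by (intro mult_right_mono) auto
          then show ?thesis using N unfolding F_def by simp
        qed
        then have "eventually (\<lambda>n. F n (torus_embedding x) = 0) sequentially"
          by (auto simp: eventually_sequentially)
        then show ?thesis using False by (simp add: tendsto_eventually)
      qed
      then have "(\<lambda>n. h x * of_real (F n (torus_embedding x))) \<longlonglongrightarrow> h x * of_real (indicator K x)"
        by (intro tendsto_intros)
      moreover have "complex_of_real (indicator K x) = indicator K x" by (simp add: indicator_def)
      ultimately show "(\<lambda>n. h x * of_real (F n (torus_embedding x))) \<longlonglongrightarrow> h x * indicator K x" by simp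
    qed
  qed
  then show ?thesis unfolding zero_spectrum_continuous[OF h Fc] by (simp add: LIMSEQ_const_iff)
qed simp

text \<open>By inner regularity a set of positive measure on which \<open>u\<close> is positive would contain a compact set of
  positive measure.\<close>

lemma AE_le_0_if_compact_integrals_0:
  fixes u :: "real ^ 'd \<Rightarrow> real"
  assumes u: "integrable torus_measure u"
    and z: "\<And>K. compact K \<Longrightarrow> K \<subseteq> torus \<Longrightarrow> (LINT x|torus_measure. u x * indicator K x) = 0"
  shows "AE x in torus_measure. u x \<le> 0"
proof -
  let ?A = "{x \<in> torus. 0 < u x}"
  have As: "?A \<in> sets torus_measure"
    using borel_measurable_integrable[OF u] by (simp flip: space_torus_measure)
  have Ab: "?A \<in> sets borel"
    using As torus_borel by (auto simp: sets_torus_measure sets_restrict_space)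
  define N where "N = distr (torus_measure :: (real ^ 'd) measure) borel (\<lambda>x. x)"
  have mid: "(\<lambda>x. x) \<in> torus_measure \<rightarrow>\<^sub>M (borel :: (real ^ 'd) measure)"
    by (rule borel_measurable_torus_measure) simp
  have N: "emeasure N B = emeasure torus_measure (B \<inter> torus)" if "B \<in> sets borel" for B
    unfolding N_def using emeasure_distr[OF mid that] by simp
  interpret prob_space "torus_measure :: (real ^ 'd) measure" by (rule prob_space_torus)
  have fin: "emeasure N (space N) \<noteq> \<infinity>" using N[of UNIV] by (simp add: N_def)
  have sN: "sets N = sets borel" unfolding N_def by simp
  have "emeasure N ?A = 0"
  proof (rule ccontr)
    assume "emeasure N ?A \<noteq> 0"
    then have "0 < (SUP K \<in> {K. K \<subseteq> ?A \<and> compact K}. emeasure N K)"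
      unfolding inner_regular[OF sN fin Ab] by (simp add: zero_less_iff_neq_zero)
    then obtain K where K: "K \<subseteq> ?A" "compact K" "0 < emeasure N K"
      by (auto simp: less_SUP_iff)
    have Kt: "K \<subseteq> torus" using K(1) by auto
    have Kb: "K \<in> sets borel" using K(2) by (simp add: compact_imp_closed borel_closed)
    have Ks: "K \<in> sets torus_measure" using Kb Kt by (auto simp: sets_torus_measure sets_restrict_space)
    have int: "integrable torus_measure (\<lambda>x. u x * indicator K x)"
      using integrable_mult_indicator[OF Ks u] by (simp add: mult.commute)
    have "AE x in torus_measure. u x * indicator K x = 0"
    proof (subst integral_nonneg_eq_0_iff_AE[symmetric, OF int])
      show "AE x in torus_measure. 0 \<le> u x * indicator K x"
        using K(1) by (intro AE_I2) (auto simp: indicator_def)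
    qed (rule z[OF K(2) Kt])
    then have "AE x in torus_measure. x \<notin> K"
      by eventually_elim (use K(1) in \<open>auto simp: indicator_def split: if_splits\<close>)
    then have "emeasure torus_measure K = 0"
      using Ks by (subst (asm) AE_iff_measurable[OF Ks]) (use Kt in auto)
    then show False using K(3) N[OF Kb] Kt by (simp add: Int_absorb2)
  qed
  then have "emeasure torus_measure ?A = 0" using N[OF Ab] by (simp add: Int_absorb2)
  then show ?thesis
    by (subst AE_iff_measurable[OF As]) (auto simp: not_le)
qed

theorem zero_spectrum_AE_0:
  fixes h :: "real ^ 'd \<Rightarrow> complex"
  assumes h: "h \<in> zero_spectrum"
  shows "AE x in torus_measure. h x = 0"
proof -
  have int: "integrable torus_measure h" using h unfolding zero_spectrum_def by simp
  have comp: "(LINT x|torus_measure. h x * indicator K x) = 0" if "compact K" "K \<subseteq> torus" for K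
    by (rule zero_spectrum_compact[OF h that])
  have intK: "integrable torus_measure (\<lambda>x. h x * indicator K x)" if "compact K" for K
  proof (rule integrable_mult_bounded_torus[OF int, of _ 1])
    have "K \<in> sets borel" using that by (simp add: compact_imp_closed borel_closed)
    then show "(indicator K :: _ \<Rightarrow> complex) \<in> borel_measurable borel" by simp
  qed (simp add: indicator_def)
  have re: "(LINT x|torus_measure. Re (h x) * indicator K x) = 0" if "compact K" "K \<subseteq> torus" for K
  proof -
    have "(\<lambda>x. Re (h x) * indicator K x) = (\<lambda>x. Re (h x * indicator K x))" by (auto simp: indicator_def fun_eq_iff)
    then show ?thesis using integral_Re[OF intK[OF that(1)]] comp[OF that] by simp
  qed
  have im: "(LINT x|torus_measure. Im (h x) * indicator K x) = 0" if "compact K" "K \<subseteq> torus" for K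
  proof -
    have "(\<lambda>x. Im (h x) * indicator K x) = (\<lambda>x. Im (h x * indicator K x))" by (auto simp: indicator_def fun_eq_iff)
    then show ?thesis using integral_Im[OF intK[OF that(1)]] comp[OF that] by simp
  qed
  have "AE x in torus_measure. Re (h x) \<le> 0" "AE x in torus_measure. - Re (h x) \<le> 0"
    "AE x in torus_measure. Im (h x) \<le> 0" "AE x in torus_measure. - Im (h x) \<le> 0"
    by (rule AE_le_0_if_compact_integrals_0; use int re im in simp)+
  then show ?thesis by eventually_elim (simp add: complex_eq_iff)
qed

section \<open>The Fourier series as continuous representative\<close>

text \<open>The set where the functions differ is open and meets the open cube in a null set, hence not at all. So they agree on
  the closed cube, and everywhere by periodicity.\<close>

lemma C_torus_eq_if_AE_eq:
  fixes g g' :: "real ^ 'd \<Rightarrow> complex"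
  assumes g: "g \<in> C_torus" "g' \<in> C_torus" and ae: "AE x in torus_measure. g x = g' x"
  shows "g = g'"
proof -
  have c: "continuous_on UNIV g" "continuous_on UNIV g'" using g unfolding C_torus_def by auto
  let ?D = "{x. g x \<noteq> g' x}"
  have D: "open ?D" using open_Collect_neq[OF c] .
  have "AE x in lborel. x \<in> torus \<longrightarrow> g x = g' x"
    using ae torus_borel unfolding torus_measure_def by (subst (asm) AE_restrict_space_iff) simp_all
  then have "AE x in lborel. x \<notin> ?D \<inter> box 0 1"
    by eventually_elim (use torus_sandwich(1) in auto)
  then have "emeasure lborel (?D \<inter> box 0 1) = 0"
    using D by (subst (asm) AE_iff_measurable[of "?D \<inter> box 0 1"]) auto
  then have "negligible (?D \<inter> box 0 1)"
    using D by (simp add: negligible_iff_emeasure0 emeasure_completion)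
  then have "?D \<inter> box 0 1 = {}"
    using open_not_negligible[of "?D \<inter> box 0 1"] D by (auto intro: open_Int open_box)
  then have cl: "?D \<inter> closure (box 0 1) = {}" by (simp add: open_Int_closure_eq_empty[OF D])
  have ne: "box 0 (1 :: real ^ 'd) \<noteq> {}" by (auto simp: box_ne_empty Basis_vec_def inner_axis)
  have "?D \<inter> cbox 0 1 = {}" using cl unfolding closure_box[OF ne] .
  then have cube: "g y = g' y" if "y \<in> torus" for y using torus_sandwich(2) that by blast
  show ?thesis
  proof
    fix x :: "real ^ 'd"
    define k :: "int ^ 'd" where "k = (\<chi> j. \<lfloor>x $ j\<rfloor>)"
    define y :: "real ^ 'd" where "y = (\<chi> j. frac (x $ j))"
    have x: "x = y + (\<chi> j. of_int (k $ j))"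
      unfolding y_def k_def by (simp add: vec_eq_iff frac_def)
    have "y \<in> torus" unfolding y_def torus_def by (simp add: frac_lt_1)
    then have "g y = g' y" by (rule cube)
    moreover have "g x = g y" "g' x = g' y" using g unfolding C_torus_def x by blast+
    ultimately show "g x = g' x" by simp
  qed
qed

lemma cont_rep_eqI:
  assumes "g \<in> C_torus" "AE x in torus_measure. f x = g x"
  shows "cont_rep f = g"
  unfolding cont_rep_def
proof (rule the_equality)
  fix g' assume g': "g' \<in> C_torus \<and> (AE x in torus_measure. f x = g' x)"
  show "g' = g"
  proof (rule C_torus_eq_if_AE_eq)
    show "AE x in torus_measure. g' x = g x"
      using conjunct2[OF g'] assms(2) by eventually_elim simp
  qed (use g' assms in auto)
qed (use assms in auto)

lemma L2_torus_integrable: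
  assumes "f \<in> L2_torus" shows "integrable torus_measure f"
proof (rule Bochner_Integration.integrable_bound)
  interpret prob_space "torus_measure :: (real ^ 'a) measure" by (rule prob_space_torus)
  show "integrable torus_measure (\<lambda>x. 1 + (cmod (f x))\<^sup>2)"
    using assms unfolding L2_torus_def by simp
  show "f \<in> borel_measurable torus_measure" using assms unfolding L2_torus_def by simp
  show "AE x in torus_measure. norm (f x) \<le> norm (1 + (cmod (f x))\<^sup>2)"
  proof (rule AE_I2)
    fix x
    have "2 * cmod (f x) \<le> 1 + (cmod (f x))\<^sup>2" using sum_squares_bound[of 1 "cmod (f x)"] by simp
    then have "cmod (f x) \<le> 1 + (cmod (f x))\<^sup>2" using norm_ge_zero[of "f x"] by linarith
    then show "norm (f x) \<le> norm (1 + (cmod (f x))\<^sup>2)" by simp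
  qed
qed

definition trig_sum :: "(int ^ 'd) set \<Rightarrow> (int ^ 'd \<Rightarrow> complex) \<Rightarrow> real ^ 'd \<Rightarrow> complex" where
  "trig_sum D a x = (\<Sum>k\<in>D. a k * fourier_basis k x)"

lemma continuous_trig_sum: "continuous_on S (trig_sum D a)"
  unfolding trig_sum_def by (intro continuous_intros continuous_fourier_basis)

lemma borel_measurable_trig_sum [measurable]: "trig_sum D a \<in> borel_measurable borel"
  by (rule borel_measurable_continuous_onI[OF continuous_trig_sum])

lemma norm_trig_sum_le: "cmod (trig_sum D a x) \<le> (\<Sum>k\<in>D. cmod (a k))"
  unfolding trig_sum_def by (rule order_trans[OF norm_sum]) (simp add: norm_mult)

lemma integral_trig_sum:
  assumes "finite D"
  shows "(LINT x|torus_measure. trig_sum D a x * fourier_basis (- k) x) = (if k \<in> D then a k else 0)"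
proof -
  have "(LINT x|torus_measure. trig_sum D a x * fourier_basis (- k) x)
      = (LINT x|torus_measure. (\<Sum>l\<in>D. a l * fourier_basis (l - k) x))"
    unfolding trig_sum_def sum_distrib_right
    by (intro Bochner_Integration.integral_cong sum.cong refl) (simp add: fourier_basis_diff fourier_basis_cnj)
  also have "\<dots> = (\<Sum>l\<in>D. (LINT x|torus_measure. a l * fourier_basis (l - k) x))"
    by (intro Bochner_Integration.integral_sum integrable_mult_right integrable_fourier_basis)
  also have "\<dots> = (\<Sum>l\<in>D. if k = l then a l else 0)"
    by (intro sum.cong refl) (simp add: integral_fourier_basis)
  finally show ?thesis using assms by simp
qed

lemma trig_sum_parseval:
  assumes "finite D"
  shows "(LINT x|torus_measure. (cmod (trig_sum D a x))\<^sup>2) = (\<Sum>k\<in>D. (cmod (a k))\<^sup>2)"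
proof -
  interpret prob_space "torus_measure :: (real ^ 'a) measure" by (rule prob_space_torus)
  have int: "integrable torus_measure (\<lambda>x. trig_sum D a x * fourier_basis (- k) x)" for k
    by (rule integrable_mult_fourier_basis)
      (simp add: trig_sum_def[abs_def] integrable_fourier_basis)
  have "complex_of_real (LINT x|torus_measure. (cmod (trig_sum D a x))\<^sup>2)
      = (LINT x|torus_measure. complex_of_real ((cmod (trig_sum D a x))\<^sup>2))"
    by (rule integral_complex_of_real[symmetric])
  also have "\<dots> = (LINT x|torus_measure. (\<Sum>k\<in>D. cnj (a k) * (trig_sum D a x * fourier_basis (- k) x)))"
  proof (intro Bochner_Integration.integral_cong refl)
    fix x
    have "complex_of_real ((cmod (trig_sum D a x))\<^sup>2) = trig_sum D a x * cnj (trig_sum D a x)"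
      by (rule complex_norm_square)
    also have "cnj (trig_sum D a x) = (\<Sum>k\<in>D. cnj (a k) * fourier_basis (- k) x)"
      unfolding trig_sum_def by (simp add: fourier_basis_cnj)
    finally show "complex_of_real ((cmod (trig_sum D a x))\<^sup>2) = (\<Sum>k\<in>D. cnj (a k) * (trig_sum D a x * fourier_basis (- k) x))"
      by (simp add: sum_distrib_left mult.left_commute)
  qed
  also have "\<dots> = (\<Sum>k\<in>D. (LINT x|torus_measure. cnj (a k) * (trig_sum D a x * fourier_basis (- k) x)))"
    by (intro Bochner_Integration.integral_sum integrable_mult_right int)
  also have "\<dots> = (\<Sum>k\<in>D. cnj (a k) * a k)"
    by (intro sum.cong refl) (simp add: integral_trig_sum[OF assms])
  also have "\<dots> = complex_of_real (\<Sum>k\<in>D. (cmod (a k))\<^sup>2)"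
    by (simp add: complex_norm_square mult.commute del: of_real_power)
  finally show ?thesis by (simp only: of_real_eq_iff)
qed

lemma sum_over_blocks:
  fixes \<phi> :: "'k \<Rightarrow> 'a::comm_monoid_add" and n :: nat
  assumes "finite D0" "\<And>l. finite (B l)" "\<And>l. B l \<inter> (D0 \<union> (\<Union>i<l. B i)) = {}"
  shows "(\<Sum>k\<in>D0 \<union> (\<Union>i<n. B i). \<phi> k) = (\<Sum>k\<in>D0. \<phi> k) + (\<Sum>l<n. \<Sum>k\<in>B l. \<phi> k)"
proof (induction n)
  case 0 then show ?case by simp
next
  case (Suc n)
  have "D0 \<union> (\<Union>i<Suc n. B i) = (D0 \<union> (\<Union>i<n. B i)) \<union> B n" by (auto simp: lessThan_Suc)
  moreover have "(D0 \<union> (\<Union>i<n. B i)) \<inter> B n = {}" using assms(3)[of n] by blast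
  ultimately have "(\<Sum>k\<in>D0 \<union> (\<Union>i<Suc n. B i). \<phi> k) = (\<Sum>k\<in>D0 \<union> (\<Union>i<n. B i). \<phi> k) + (\<Sum>k\<in>B n. \<phi> k)"
    using assms(1,2) by (simp add: sum.union_disjoint)
  then show ?case using Suc.IH by (simp add: add.assoc)
qed

text \<open>Absolute convergence along the blocks gives a uniform limit with the same Fourier coefficients as \<open>f\<close>, and
  functions with equal coefficients agree almost everywhere.\<close>

lemma cont_rep_fourier_series:
  fixes f :: "real ^ 'd \<Rightarrow> complex" and B :: "nat \<Rightarrow> (int ^ 'd) set"
  assumes f: "f \<in> L2_torus" and D0: "finite D0" and B: "\<And>l. finite (B l)"
    and disj: "\<And>l. B l \<inter> (D0 \<union> (\<Union>i<l. B i)) = {}" and all: "D0 \<union> (\<Union>l. B l) = UNIV"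
    and summ: "summable (\<lambda>l. \<Sum>k\<in>B l. cmod (fourier_coeff f k))"
  shows "cont_rep f \<in> C_torus" and "AE x in torus_measure. f x = cont_rep f x"
    and "\<And>x. (\<lambda>n. trig_sum (D0 \<union> (\<Union>i<n. B i)) (fourier_coeff f) x) \<longlonglongrightarrow> cont_rep f x"
    and "\<exists>M. \<forall>n x. cmod (trig_sum (D0 \<union> (\<Union>i<n. B i)) (fourier_coeff f) x) \<le> M"
proof -
  interpret prob_space "torus_measure :: (real ^ 'd) measure" by (rule prob_space_torus)
  define a where "a = fourier_coeff f"
  define D where "D n = D0 \<union> (\<Union>i<n. B i)" for n
  define S where "S n = trig_sum (D n) a" for n
  define M where "M l = (\<Sum>k\<in>B l. cmod (a k))" for l
  have finD: "finite (D n)" for n unfolding D_def using D0 B by simp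
  have summM: "summable M" using summ unfolding M_def a_def .
  have M0: "0 \<le> M l" for l unfolding M_def by (rule sum_nonneg) simp
  have S_eq: "S n x = trig_sum D0 a x + (\<Sum>l<n. trig_sum (B l) a x)" for n x
    unfolding S_def D_def trig_sum_def by (rule sum_over_blocks[OF D0 B disj])
  define G where "G x = trig_sum D0 a x + (\<Sum>l. trig_sum (B l) a x)" for x
  have unif0: "uniform_limit UNIV (\<lambda>n x. \<Sum>l<n. trig_sum (B l) a x) (\<lambda>x. \<Sum>l. trig_sum (B l) a x) sequentially"
    by (rule Weierstrass_m_test[OF _ summM]) (simp add: M_def norm_trig_sum_le)
  have unif: "uniform_limit UNIV S G sequentially"
    unfolding G_def S_eq[abs_def] by (intro uniform_limit_add uniform_limit_const unif0)
  have lim: "(\<lambda>n. S n x) \<longlonglongrightarrow> G x" for x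
    using tendsto_uniform_limitI[OF unif, of x] by simp
  have "G \<in> C_torus"
  proof -
    have "continuous_on UNIV G"
      by (rule uniform_limit_theorem[OF _ unif]) (auto simp: S_def continuous_trig_sum)
    moreover have "G (x + (\<chi> j. of_int (k $ j))) = G x" for x and k :: "int ^ 'd"
      unfolding G_def trig_sum_def by (simp add: fourier_basis_periodic)
    ultimately show ?thesis unfolding C_torus_def by blast
  qed
  note GC = this
  define Mt where "Mt = (\<Sum>k\<in>D0. cmod (a k)) + (\<Sum>l. M l)"
  have bound: "cmod (S n x) \<le> Mt" for n x
  proof -
    have "cmod (S n x) \<le> cmod (trig_sum D0 a x) + (\<Sum>l<n. cmod (trig_sum (B l) a x))"
      unfolding S_eq by (rule order_trans[OF norm_triangle_ineq]) (intro add_left_mono norm_sum)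
    also have "\<dots> \<le> (\<Sum>k\<in>D0. cmod (a k)) + (\<Sum>l<n. M l)"
      unfolding M_def by (intro add_mono sum_mono norm_trig_sum_le)
    also have "\<dots> \<le> Mt"
      unfolding Mt_def by (intro add_left_mono sum_le_suminf summM) (auto simp: M0)
    finally show ?thesis .
  qed
  have Gm: "G \<in> borel_measurable borel"
    using GC unfolding C_torus_def by (auto intro: borel_measurable_continuous_onI)
  have Gb: "cmod (G x) \<le> Mt" for x
    using tendsto_norm[OF lim] by (rule LIMSEQ_le_const2) (use bound in blast)
  have Gint: "integrable torus_measure G"
    by (rule integrable_const_bound[where B = Mt]) (simp_all add: Gb borel_measurable_torus_measure Gm)
  have coeff: "(LINT x|torus_measure. G x * fourier_basis (- k) x) = a k" for k
  proof -
    have "(\<lambda>n. LINT x|torus_measure. S n x * fourier_basis (- k) x) \<longlonglongrightarrow> (LINT x|torus_measure. G x * fourier_basis (- k) x)"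
    proof (rule integral_dominated_convergence[where w = "\<lambda>_. Mt"])
      show "(\<lambda>x. G x * fourier_basis (- k) x) \<in> borel_measurable torus_measure"
        using Gm by (intro borel_measurable_torus_measure) simp
      show "(\<lambda>x. S n x * fourier_basis (- k) x) \<in> borel_measurable torus_measure" for n
        unfolding S_def by (intro borel_measurable_torus_measure) simp
      show "AE x in torus_measure. (\<lambda>n. S n x * fourier_basis (- k) x) \<longlonglongrightarrow> G x * fourier_basis (- k) x"
        by (intro AE_I2 tendsto_intros lim)
      show "AE x in torus_measure. norm (S n x * fourier_basis (- k) x) \<le> Mt" for n
        by (intro AE_I2) (simp add: norm_mult bound)
    qed simp
    moreover have "(\<lambda>n. LINT x|torus_measure. S n x * fourier_basis (- k) x) \<longlonglongrightarrow> a k"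
    proof (rule tendsto_eventually)
      obtain n0 where "k \<in> D n0"
      proof -
        have "k \<in> D0 \<union> (\<Union>l. B l)" using all by simp
        then consider "k \<in> D0" | l where "k \<in> B l" by blast
        then show ?thesis
        proof cases
          case 1 then show ?thesis using that[of 0] unfolding D_def by simp
        next
          case (2 l) then show ?thesis using that[of "Suc l"] unfolding D_def by blast
        qed
      qed
      then have "k \<in> D n" if "n0 \<le> n" for n using that unfolding D_def by fastforce
      then have "\<forall>n\<ge>n0. (LINT x|torus_measure. S n x * fourier_basis (- k) x) = a k"
        unfolding S_def by (simp add: integral_trig_sum[OF finD])
      then show "eventually (\<lambda>n. (LINT x|torus_measure. S n x * fourier_basis (- k) x) = a k) sequentially"
        unfolding eventually_sequentially by blast
    qed
    ultimately show ?thesis by (rule LIMSEQ_unique)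
  qed
  have fint: "integrable torus_measure f" by (rule L2_torus_integrable[OF f])
  have "(\<lambda>x. f x - G x) \<in> zero_spectrum"
    unfolding zero_spectrum_def
  proof (intro CollectI conjI allI)
    show "integrable torus_measure (\<lambda>x. f x - G x)" by (rule Bochner_Integration.integrable_diff[OF fint Gint])
    fix k :: "int ^ 'd"
    have "(LINT x|torus_measure. (f x - G x) * fourier_basis k x)
        = (LINT x|torus_measure. f x * fourier_basis k x) - (LINT x|torus_measure. G x * fourier_basis k x)"
      unfolding left_diff_distrib
      by (intro Bochner_Integration.integral_diff integrable_mult_fourier_basis fint Gint)
    also have "(LINT x|torus_measure. f x * fourier_basis k x) = a (- k)" unfolding a_def fourier_coeff_def by simp
    also have "(LINT x|torus_measure. G x * fourier_basis k x) = a (- k)" using coeff[of "- k"] by simp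
    finally show "(LINT x|torus_measure. (f x - G x) * fourier_basis k x) = 0" by simp
  qed
  then have ae: "AE x in torus_measure. f x = G x"
    using zero_spectrum_AE_0 by (force elim: eventually_mono)
  have rep: "cont_rep f = G" by (rule cont_rep_eqI[OF GC ae])
  show "cont_rep f \<in> C_torus" "AE x in torus_measure. f x = cont_rep f x"
    unfolding rep by (rule GC, rule ae)
  show "\<And>x. (\<lambda>n. trig_sum (D0 \<union> (\<Union>i<n. B i)) (fourier_coeff f) x) \<longlonglongrightarrow> cont_rep f x"
    using lim unfolding rep S_def D_def a_def .
  show "\<exists>M. \<forall>n x. cmod (trig_sum (D0 \<union> (\<Union>i<n. B i)) (fourier_coeff f) x) \<le> M"
    using bound unfolding S_def D_def a_def by blast
qed

text \<open>Dominated convergence transfers the bound from the partial sums to \<open>f\<close>.\<close>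

lemma L2_torus_norm_limit_le:
  fixes f G g :: "real ^ 'd \<Rightarrow> complex"
  assumes f: "f \<in> borel_measurable torus_measure" and ae: "AE x in torus_measure. f x = G x" and G: "G \<in> borel_measurable borel"
    and S: "\<And>n. S n \<in> borel_measurable borel" and lim: "\<And>x. (\<lambda>n. S n x) \<longlonglongrightarrow> G x"
    and bound: "\<And>n x. cmod (S n x - g x) \<le> M" and g: "g \<in> borel_measurable borel"
    and le: "\<And>n. (LINT x|torus_measure. (cmod (S n x - g x))\<^sup>2) \<le> R\<^sup>2" and R: "0 \<le> R"
  shows "L2_torus_norm (\<lambda>t. f t - g t) \<le> R"
proof -
  interpret prob_space "torus_measure :: (real ^ 'd) measure" by (rule prob_space_torus)
  have gm: "g \<in> borel_measurable torus_measure" "G \<in> borel_measurable torus_measure" "\<And>n. S n \<in> borel_measurable torus_measure"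
    using g G S by (auto intro: borel_measurable_torus_measure)
  have "(LINT t|torus_measure. (cmod (f t - g t))\<^sup>2) = (LINT t|torus_measure. (cmod (G t - g t))\<^sup>2)"
  proof (rule integral_cong_AE)
    show "AE t in torus_measure. (cmod (f t - g t))\<^sup>2 = (cmod (G t - g t))\<^sup>2"
      using ae by eventually_elim simp
  qed (use f gm in simp_all)
  moreover have "(\<lambda>n. LINT x|torus_measure. (cmod (S n x - g x))\<^sup>2) \<longlonglongrightarrow> (LINT t|torus_measure. (cmod (G t - g t))\<^sup>2)"
  proof (rule integral_dominated_convergence[where w = "\<lambda>_. M\<^sup>2"])
    show "AE x in torus_measure. (\<lambda>n. (cmod (S n x - g x))\<^sup>2) \<longlonglongrightarrow> (cmod (G x - g x))\<^sup>2"
      by (intro AE_I2 tendsto_intros lim)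
    show "AE x in torus_measure. norm ((cmod (S n x - g x))\<^sup>2) \<le> M\<^sup>2" for n
      using power_mono[OF bound, of n _ 2] by (intro AE_I2) simp
  qed (use gm in simp_all)
  then have "(LINT t|torus_measure. (cmod (G t - g t))\<^sup>2) \<le> R\<^sup>2"
    by (rule LIMSEQ_le_const2) (use le in blast)
  ultimately show ?thesis
    unfolding L2_torus_norm_def using R by (simp add: real_le_lsqrt)
qed

section \<open>Penalized least squares on at most s frequencies\<close>

lemma compact_coeff_box:
  "compact {z \<in> coeff_space \<Lambda>. \<forall>k\<in>\<Lambda>. cmod (z k) \<le> R}"
proof -
  have "{z \<in> coeff_space \<Lambda>. \<forall>k\<in>\<Lambda>. cmod (z k) \<le> R} = PiE UNIV (\<lambda>k. if k \<in> \<Lambda> then cball 0 R else {0})"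
    by (auto simp: coeff_space_def PiE_iff split: if_splits)
  moreover have "compactin (product_topology (\<lambda>_. euclidean) UNIV) (PiE UNIV (\<lambda>k. if k \<in> \<Lambda> then cball (0::complex) R else {0}))"
    by (subst compactin_PiE) auto
  ultimately show ?thesis by (simp add: euclidean_product_topology)
qed

lemma continuous_lasso_objective: "continuous_on UNIV (lasso_objective lam m \<Lambda> A b)"
  unfolding lasso_objective_def L2_set_def
  by (intro continuous_intros continuous_on_product_coordinates)

lemma L2_set_midpoint_le:
  "L2_set (\<lambda>i. cmod ((u i + v i) / 2)) S \<le> (L2_set (\<lambda>i. cmod (u i)) S + L2_set (\<lambda>i. cmod (v i)) S) / 2"
proof -
  have "L2_set (\<lambda>i. cmod ((u i + v i) / 2)) S \<le> L2_set (\<lambda>i. (1/2) * (cmod (u i) + cmod (v i))) S"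
    by (rule L2_set_mono) (simp_all add: norm_divide norm_triangle_ineq)
  also have "\<dots> = (1/2) * L2_set (\<lambda>i. cmod (u i) + cmod (v i)) S"
    by (rule L2_set_right_distrib[symmetric]) simp
  also have "\<dots> \<le> (1/2) * (L2_set (\<lambda>i. cmod (u i)) S + L2_set (\<lambda>i. cmod (v i)) S)"
    by (intro mult_left_mono L2_set_triangle_ineq) simp
  finally show ?thesis by simp
qed

lemma lasso_objective_midpoint_le:
  assumes "0 \<le> lam"
  shows "lasso_objective lam m \<Lambda> A b (\<lambda>k. (z k + w k) / 2)
    \<le> (lasso_objective lam m \<Lambda> A b z + lasso_objective lam m \<Lambda> A b w) / 2"
proof -
  define r where "r z i = (\<Sum>k\<in>\<Lambda>. A i k * z k) - b i" for z i
  have "(\<Sum>k\<in>\<Lambda>. cmod ((z k + w k) / 2)) \<le> (\<Sum>k\<in>\<Lambda>. (cmod (z k) + cmod (w k)) / 2)"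
    by (intro sum_mono) (simp add: norm_divide norm_triangle_ineq)
  also have "\<dots> = ((\<Sum>k\<in>\<Lambda>. cmod (z k)) + (\<Sum>k\<in>\<Lambda>. cmod (w k))) / 2"
    by (simp only: sum_divide_distrib[symmetric] sum.distrib)
  finally have "lam * (\<Sum>k\<in>\<Lambda>. cmod ((z k + w k) / 2)) \<le> lam * (((\<Sum>k\<in>\<Lambda>. cmod (z k)) + (\<Sum>k\<in>\<Lambda>. cmod (w k))) / 2)"
    using assms by (rule mult_left_mono)
  moreover have "L2_set (\<lambda>i. cmod (r (\<lambda>k. (z k + w k) / 2) i)) {1..m}
      \<le> (L2_set (\<lambda>i. cmod (r z i)) {1..m} + L2_set (\<lambda>i. cmod (r w i)) {1..m}) / 2"
  proof -
    have "r (\<lambda>k. (z k + w k) / 2) i = (r z i + r w i) / 2" for i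
    proof -
      have "(\<Sum>k\<in>\<Lambda>. A i k * ((z k + w k) / 2)) = ((\<Sum>k\<in>\<Lambda>. A i k * z k) + (\<Sum>k\<in>\<Lambda>. A i k * w k)) / 2"
        by (simp add: sum.distrib[symmetric] sum_divide_distrib distrib_left)
      then show ?thesis unfolding r_def by (simp add: field_simps)
    qed
    then show ?thesis by (simp only: L2_set_midpoint_le)
  qed
  ultimately show ?thesis unfolding lasso_objective_def r_def by (simp add: field_simps)
qed

text \<open>Outside the box of radius \<open>R\<close> the penalty alone exceeds the objective at zero.\<close>

lemma lasso_minimizers_compact_nonempty:
  assumes "finite \<Lambda>" "0 < lam"
  shows "compact (lasso_minimizers lam m \<Lambda> A b)" and "lasso_minimizers lam m \<Lambda> A b \<noteq> {}"
proof -
  let ?J = "lasso_objective lam m \<Lambda> A b"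
  define R where "R = ?J (\<lambda>_. 0) / lam"
  define K where "K = {z \<in> coeff_space \<Lambda>. \<forall>k\<in>\<Lambda>. cmod (z k) \<le> R}"
  have J0: "0 \<le> ?J z" for z
    unfolding lasso_objective_def using assms(2) by (intro add_nonneg_nonneg mult_nonneg_nonneg sum_nonneg) auto
  have zero: "(\<lambda>_. 0) \<in> K" unfolding K_def coeff_space_def R_def using J0[of "\<lambda>_. 0"] assms(2) by simp
  have K: "compact K" unfolding K_def by (rule compact_coeff_box)
  have cont: "continuous_on K ?J" by (rule continuous_on_subset[OF continuous_lasso_objective]) simp
  obtain z0 where z0: "z0 \<in> K" "\<And>z. z \<in> K \<Longrightarrow> ?J z0 \<le> ?J z"
    using continuous_attains_inf[OF K _ cont] zero by blast
  have outside: "?J (\<lambda>_. 0) < ?J z" if z: "z \<in> coeff_space \<Lambda>" "z \<notin> K" for z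
  proof -
    obtain k where k: "k \<in> \<Lambda>" "R < cmod (z k)" using z unfolding K_def by auto
    have "cmod (z k) \<le> (\<Sum>k\<in>\<Lambda>. cmod (z k))" using k(1) assms(1) by (intro member_le_sum) auto
    then have "R < (\<Sum>k\<in>\<Lambda>. cmod (z k))" using k(2) by linarith
    then have "?J (\<lambda>_. 0) < lam * (\<Sum>k\<in>\<Lambda>. cmod (z k))"
      unfolding R_def using assms(2) by (simp add: pos_divide_less_eq mult.commute)
    also have "\<dots> \<le> ?J z" unfolding lasso_objective_def by simp
    finally show ?thesis .
  qed
  have glob: "?J z0 \<le> ?J z" if "z \<in> coeff_space \<Lambda>" for z
  proof (cases "z \<in> K")
    case False then show ?thesis using outside[OF that False] z0(2)[OF zero] by linarith
  qed (rule z0(2))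
  have z0c: "z0 \<in> coeff_space \<Lambda>" using z0(1) unfolding K_def by simp
  show "lasso_minimizers lam m \<Lambda> A b \<noteq> {}"
    using z0c glob unfolding lasso_minimizers_def by blast
  have "lasso_minimizers lam m \<Lambda> A b = K \<inter> {z. ?J z \<le> ?J z0}"
  proof (rule set_eqI)
    fix z
    show "z \<in> lasso_minimizers lam m \<Lambda> A b \<longleftrightarrow> z \<in> K \<inter> {z. ?J z \<le> ?J z0}"
    proof
      assume "z \<in> lasso_minimizers lam m \<Lambda> A b"
      then have z: "z \<in> coeff_space \<Lambda>" "\<And>w. w \<in> coeff_space \<Lambda> \<Longrightarrow> ?J z \<le> ?J w"
        unfolding lasso_minimizers_def by auto
      have "(\<lambda>_. 0) \<in> coeff_space \<Lambda>" unfolding coeff_space_def by simp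
      then have "z \<in> K" using outside[OF z(1)] z(2)[of "\<lambda>_. 0"] by fastforce
      then show "z \<in> K \<inter> {z. ?J z \<le> ?J z0}" using z(2)[OF z0c] by simp
    next
      assume z: "z \<in> K \<inter> {z. ?J z \<le> ?J z0}"
      then have "z \<in> coeff_space \<Lambda>" unfolding K_def by simp
      moreover have "?J z \<le> ?J w" if "w \<in> coeff_space \<Lambda>" for w using glob[OF that] z by simp
      ultimately show "z \<in> lasso_minimizers lam m \<Lambda> A b" unfolding lasso_minimizers_def by simp
    qed
  qed
  moreover have "closed {z. ?J z \<le> ?J z0}"
    by (rule closed_Collect_le[OF continuous_lasso_objective continuous_on_const])
  ultimately show "compact (lasso_minimizers lam m \<Lambda> A b)" using K by (simp add: compact_Int_closed)
qed

text \<open>The definite description is meaningful: the minimizers form a compact convex set, and by the parallelogram law such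
  a set has exactly one element of smallest Euclidean norm.\<close>

lemma lasso_solution_minimizes:
  assumes "finite \<Lambda>" "0 < lam"
  shows "lasso_solution lam m \<Lambda> A b \<in> lasso_minimizers lam m \<Lambda> A b"
proof -
  let ?X = "lasso_minimizers lam m \<Lambda> A b"
  let ?N = "\<lambda>z. L2_set (\<lambda>k. cmod (z k)) \<Lambda>"
  have "continuous_on ?X ?N"
    unfolding L2_set_def by (rule continuous_on_subset[of UNIV]) (intro continuous_intros continuous_on_product_coordinates, simp)
  then obtain z where z: "z \<in> ?X" "\<And>w. w \<in> ?X \<Longrightarrow> ?N z \<le> ?N w"
    using continuous_attains_inf[OF lasso_minimizers_compact_nonempty[OF assms]] by blast
  have "w = z" if w: "w \<in> ?X" "\<forall>u\<in>?X. ?N w \<le> ?N u" for w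
  proof -
    define u where "u = (\<lambda>k. (z k + w k) / 2)"
    have coeff: "z \<in> coeff_space \<Lambda>" "w \<in> coeff_space \<Lambda>" using z(1) w(1) unfolding lasso_minimizers_def by auto
    have "u \<in> coeff_space \<Lambda>" using coeff unfolding u_def coeff_space_def by simp
    moreover have "lasso_objective lam m \<Lambda> A b u \<le> lasso_objective lam m \<Lambda> A b v" if v: "v \<in> coeff_space \<Lambda>" for v
    proof -
      have "lasso_objective lam m \<Lambda> A b z \<le> lasso_objective lam m \<Lambda> A b v"
        "lasso_objective lam m \<Lambda> A b w \<le> lasso_objective lam m \<Lambda> A b v"
        using z(1) w(1) v unfolding lasso_minimizers_def by auto
      then show ?thesis
        using lasso_objective_midpoint_le[of lam m \<Lambda> A b z w] assms(2) unfolding u_def by simp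
    qed
    ultimately have uX: "u \<in> ?X" unfolding lasso_minimizers_def by simp
    have par: "(cmod (u k))\<^sup>2 = ((cmod (z k))\<^sup>2 + (cmod (w k))\<^sup>2) / 2 - (cmod (z k - w k))\<^sup>2 / 4" for k
      unfolding u_def cmod_power2 by (simp add: field_simps power2_eq_square)
    have sq: "(?N v)\<^sup>2 = (\<Sum>k\<in>\<Lambda>. (cmod (v k))\<^sup>2)" for v :: "'a \<Rightarrow> complex"
      by (rule L2_set_squared)
    have "?N z = ?N w" using z(2)[OF w(1)] w(2) z(1) by fastforce
    then have "(?N u)\<^sup>2 = (?N z)\<^sup>2 - (\<Sum>k\<in>\<Lambda>. (cmod (z k - w k))\<^sup>2) / 4"
      using sq[of z] sq[of w] unfolding sq[of u] par
      by (simp add: sum_subtractf sum.distrib sum_divide_distrib[symmetric])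
    moreover have "(?N z)\<^sup>2 \<le> (?N u)\<^sup>2" using z(2)[OF uX] by (intro power_mono) auto
    ultimately have "(\<Sum>k\<in>\<Lambda>. (cmod (z k - w k))\<^sup>2) \<le> 0" by simp
    then have "(\<Sum>k\<in>\<Lambda>. (cmod (z k - w k))\<^sup>2) = 0" by (intro antisym sum_nonneg) auto
    then have eq: "z k = w k" if "k \<in> \<Lambda>" for k
      using assms(1) that by (simp add: sum_nonneg_eq_0_iff)
    show "w = z"
    proof
      fix k show "w k = z k" using eq[of k] coeff unfolding coeff_space_def by (cases "k \<in> \<Lambda>") auto
    qed
  qed
  then have "lasso_solution lam m \<Lambda> A b = z"
    unfolding lasso_solution_def using z by (intro the_equality) blast+
  then show ?thesis using z(1) by simp
qed

lemma L1_le_sqrt_card_L2: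
  assumes "finite \<Lambda>"
  shows "(\<Sum>k\<in>\<Lambda>. cmod (v k)) \<le> sqrt (real (card \<Lambda>)) * L2_set (\<lambda>k. cmod (v k)) \<Lambda>"
proof -
  have "(\<Sum>k\<in>\<Lambda>. \<bar>1::real\<bar> * \<bar>cmod (v k)\<bar>) \<le> L2_set (\<lambda>_. 1) \<Lambda> * L2_set (\<lambda>k. cmod (v k)) \<Lambda>"
    by (rule L2_set_mult_ineq)
  then show ?thesis by (simp add: L2_set_def)
qed

text \<open>Let \<open>v = z - a\<close>. Minimality gives \<open>\<parallel>A v\<parallel> \<le> 2 * E + \<lambda> * \<parallel>v\<parallel>\<^sub>1\<close> with the residual \<open>E\<close> of \<open>a\<close>. As \<open>v\<close> has
  at most \<open>s\<close> entries, \<open>\<lambda> * \<parallel>v\<parallel>\<^sub>1 \<le> 3/14 * \<parallel>v\<parallel>\<^sub>2\<close>, which the lower bound \<open>\<parallel>A v\<parallel> \<ge> 1/2 * \<parallel>v\<parallel>\<^sub>2\<close>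
  absorbs with \<open>2/7\<close> to spare.\<close>

lemma lasso_error_le:
  assumes fin: "finite \<Lambda>" and card: "card \<Lambda> \<le> s" and s: "1 \<le> s"
    and lower: "\<And>v. L2_set (\<lambda>k. cmod (v k)) \<Lambda> / 2 \<le> L2_set (\<lambda>i. cmod (\<Sum>k\<in>\<Lambda>. A i k * v k)) {1..m}"
    and z: "z \<in> lasso_minimizers (3 / (14 * sqrt (real s))) m \<Lambda> A b" and a: "a \<in> coeff_space \<Lambda>"
  shows "L2_set (\<lambda>k. cmod (z k - a k)) \<Lambda> \<le> 7 * L2_set (\<lambda>i. cmod ((\<Sum>k\<in>\<Lambda>. A i k * a k) - b i)) {1..m}"
proof -
  define lam where "lam = 3 / (14 * sqrt (real s))"
  define E where "E = L2_set (\<lambda>i. cmod ((\<Sum>k\<in>\<Lambda>. A i k * a k) - b i)) {1..m}"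
  define F where "F = L2_set (\<lambda>i. cmod ((\<Sum>k\<in>\<Lambda>. A i k * z k) - b i)) {1..m}"
  define V where "V = L2_set (\<lambda>k. cmod (z k - a k)) \<Lambda>"
  have s0: "0 < sqrt (real s)" using s by simp
  have lam0: "0 < lam" unfolding lam_def using s0 by simp
  have opt: "lam * (\<Sum>k\<in>\<Lambda>. cmod (z k)) + F \<le> lam * (\<Sum>k\<in>\<Lambda>. cmod (a k)) + E"
    using z a unfolding lasso_minimizers_def lasso_objective_def E_def F_def lam_def by blast
  have "(\<Sum>k\<in>\<Lambda>. cmod (a k)) \<le> (\<Sum>k\<in>\<Lambda>. cmod (z k) + cmod (z k - a k))"
    by (intro sum_mono) (metis norm_minus_commute norm_triangle_sub)
  then have "(\<Sum>k\<in>\<Lambda>. cmod (a k)) \<le> (\<Sum>k\<in>\<Lambda>. cmod (z k)) + (\<Sum>k\<in>\<Lambda>. cmod (z k - a k))"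
    by (simp only: sum.distrib)
  also have "(\<Sum>k\<in>\<Lambda>. cmod (z k - a k)) \<le> sqrt (real (card \<Lambda>)) * V"
    unfolding V_def by (rule L1_le_sqrt_card_L2[OF fin])
  also have "sqrt (real (card \<Lambda>)) * V \<le> sqrt (real s) * V"
    using card unfolding V_def by (intro mult_right_mono) auto
  finally have "lam * (\<Sum>k\<in>\<Lambda>. cmod (a k)) \<le> lam * ((\<Sum>k\<in>\<Lambda>. cmod (z k)) + sqrt (real s) * V)"
    using lam0 by (intro mult_left_mono) auto
  moreover have "lam * (sqrt (real s) * V) = 3/14 * V" unfolding lam_def using s0 by simp
  ultimately have FE: "F \<le> E + 3/14 * V" using opt by (simp add: distrib_left)
  have "V / 2 \<le> L2_set (\<lambda>i. cmod (\<Sum>k\<in>\<Lambda>. A i k * (z k - a k))) {1..m}"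
    unfolding V_def by (rule lower)
  also have "\<dots> \<le> L2_set (\<lambda>i. cmod ((\<Sum>k\<in>\<Lambda>. A i k * z k) - b i) + cmod ((\<Sum>k\<in>\<Lambda>. A i k * a k) - b i)) {1..m}"
  proof (rule L2_set_mono)
    fix i
    have "(\<Sum>k\<in>\<Lambda>. A i k * (z k - a k)) = ((\<Sum>k\<in>\<Lambda>. A i k * z k) - b i) - ((\<Sum>k\<in>\<Lambda>. A i k * a k) - b i)"
      by (simp add: right_diff_distrib sum_subtractf)
    then show "cmod (\<Sum>k\<in>\<Lambda>. A i k * (z k - a k)) \<le> cmod ((\<Sum>k\<in>\<Lambda>. A i k * z k) - b i) + cmod ((\<Sum>k\<in>\<Lambda>. A i k * a k) - b i)"
      by (simp only: norm_triangle_ineq4)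
  qed simp
  also have "\<dots> \<le> F + E" unfolding F_def E_def by (rule L2_set_triangle_ineq)
  finally have "V \<le> 7 * E" using FE by simp
  then show ?thesis unfolding V_def E_def .
qed

lemma hard_threshold_trivial:
  assumes "finite \<Lambda>" "card \<Lambda> \<le> r" "z \<in> coeff_space \<Lambda>" "is_hard_threshold r \<Lambda> z w"
  shows "w = z"
proof -
  obtain S where S: "S \<subseteq> \<Lambda>" "card S = min r (card \<Lambda>)" "w = (\<lambda>k. if k \<in> S then z k else 0)"
    using assms(4) unfolding is_hard_threshold_def by blast
  have "S = \<Lambda>" using S(1,2) assms(1,2) by (intro card_subset_eq) auto
  then show ?thesis using S(3) assms(3) unfolding coeff_space_def by auto
qed

section \<open>Decay over dyadic blocks\<close>


text \<open>The factor by which the \<open>l\<close>-th block is smaller than the rate for the whole function.\<close>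

definition block_decay :: "real \<Rightarrow> real \<Rightarrow> nat \<Rightarrow> nat \<Rightarrow> real" where
  "block_decay c h r l = (real (Suc l) ^ r / (c * 2 ^ l)) powr h"

definition recovery_rate :: "real \<Rightarrow> nat \<Rightarrow> nat \<Rightarrow> real" where
  "recovery_rate h r s = ((1 + ln (real s)) ^ r / real s) powr h"

lemma summable_powr_times_power:
  fixes q E :: real
  assumes q: "0 < q" "q < 1"
  shows "summable (\<lambda>l. real (Suc l) powr E * q ^ l)"
proof -
  have "(\<lambda>l. (real (Suc (Suc l)) / real (Suc l)) powr E * q) \<longlonglongrightarrow> 1 powr E * q"
  proof (intro tendsto_intros)
    have "(\<lambda>l. 1 + inverse (real (Suc l))) \<longlonglongrightarrow> 1 + 0" by (intro tendsto_intros LIMSEQ_inverse_real_of_nat)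
    moreover have "real (Suc (Suc l)) / real (Suc l) = 1 + inverse (real (Suc l))" for l
      by (simp add: field_simps)
    ultimately show "(\<lambda>l. real (Suc (Suc l)) / real (Suc l)) \<longlonglongrightarrow> 1" by simp
  qed simp
  then have "eventually (\<lambda>l. (real (Suc (Suc l)) / real (Suc l)) powr E * q < (1 + q) / 2) sequentially"
    using q by (intro order_tendstoD(2)[of _ q]) auto
  then obtain N where N: "\<And>l. N \<le> l \<Longrightarrow> (real (Suc (Suc l)) / real (Suc l)) powr E * q < (1 + q) / 2"
    unfolding eventually_sequentially by blast
  show ?thesis
  proof (rule summable_ratio_test[of "(1 + q) / 2" N])
    fix l assume l: "N \<le> l"
    have "real (Suc (Suc l)) powr E * q ^ Suc l
        = ((real (Suc (Suc l)) / real (Suc l)) powr E * q) * (real (Suc l) powr E * q ^ l)"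
      by (simp add: powr_divide)
    also have "\<dots> \<le> (1 + q) / 2 * (real (Suc l) powr E * q ^ l)"
      using N[OF l] q by (intro mult_right_mono) auto
    finally show "norm (real (Suc (Suc l)) powr E * q ^ Suc l) \<le> (1 + q) / 2 * norm (real (Suc l) powr E * q ^ l)"
      using q by simp
  qed (use q in simp)
qed

text \<open>Up to a power of \<open>l\<close> the terms are \<open>(2 powr (1/2 - h)) ^ l\<close>.\<close>

lemma summable_block_decay:
  assumes c: "0 < c" and h: "1/2 < h"
  shows "summable (\<lambda>l. sqrt (5 * (2 ^ l * real (Suc l))) * block_decay c h r l)"
proof -
  have "sqrt (5 * (2 ^ l * real (Suc l))) * block_decay c h r l
      = sqrt 5 * c powr (- h) * (real (Suc l) powr (1/2 + real r * h) * (2 powr (1/2 - h)) ^ l)" for l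
  proof -
    have "sqrt (5 * (2 ^ l * real (Suc l))) = sqrt 5 * ((2::real) ^ l) powr (1/2) * real (Suc l) powr (1/2)"
      by (simp only: real_sqrt_mult powr_half_sqrt of_nat_0_le_iff zero_le_power zero_le_numeral mult.assoc)
    also have "((2::real) ^ l) powr (1/2) = 2 powr (real l / 2)" by (simp add: powr_realpow[symmetric] powr_powr)
    finally have a: "sqrt (5 * (2 ^ l * real (Suc l))) = sqrt 5 * 2 powr (real l / 2) * real (Suc l) powr (1/2)" .
    have "block_decay c h r l = (real (Suc l) powr real r / (c * 2 powr real l)) powr h"
      unfolding block_decay_def by (simp add: powr_realpow)
    also have "\<dots> = real (Suc l) powr (real r * h) * c powr (- h) * 2 powr (- real l * h)"
      using c by (simp add: powr_divide powr_mult powr_powr powr_minus divide_simps)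
    finally have b: "block_decay c h r l = real (Suc l) powr (real r * h) * c powr (- h) * 2 powr (- real l * h)" .
    have "(2 powr (1/2 - h)) ^ l = 2 powr (real l / 2 + - real l * h)"
      by (simp add: powr_realpow[symmetric] powr_powr algebra_simps)
    then have q: "(2 powr (1/2 - h)) ^ l = 2 powr (real l / 2) * 2 powr (- real l * h)" by (simp only: powr_add)
    show ?thesis unfolding a b q powr_add[of _ "1/2"] by (simp only: mult_ac)
  qed
  moreover have "summable (\<lambda>l. real (Suc l) powr (1/2 + real r * h) * (2 powr (1/2 - h)) ^ l)"
  proof (rule summable_powr_times_power)
    show "2 powr (1/2 - h) < 1" using h powr_less_mono[of "1/2 - h" 0 2] by simp
  qed simp
  ultimately show ?thesis by (simp only: summable_mult)
qed


text \<open>The sets \<open>\<Lambda> n\<close> need not increase with \<open>n\<close>, so all earlier sets are removed and not only the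
  last one.\<close>

definition frequency_block :: "(nat \<Rightarrow> (int ^ 'd) set) \<Rightarrow> nat \<Rightarrow> nat \<Rightarrow> (int ^ 'd) set" where
  "frequency_block \<Lambda> s l = \<Lambda> (2 ^ Suc l * s) - (\<Union>i\<le>l. \<Lambda> (2 ^ i * s))"

lemma frequency_block_Union: "\<Lambda> s \<union> (\<Union>l<n. frequency_block \<Lambda> s l) = (\<Union>i\<le>n. \<Lambda> (2 ^ i * s))"
proof (induction n)
  case 0 show ?case by simp
next
  case (Suc n)
  have "\<Lambda> s \<union> (\<Union>l<Suc n. frequency_block \<Lambda> s l) = (\<Union>i\<le>n. \<Lambda> (2 ^ i * s)) \<union> frequency_block \<Lambda> s n"
    using Suc.IH by (auto simp: lessThan_Suc)
  also have "\<dots> = (\<Union>i\<le>Suc n. \<Lambda> (2 ^ i * s))" unfolding frequency_block_def by (auto simp: atMost_Suc)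
  finally show ?case .
qed

text \<open>A lower bound \<open>1 / \<omega>\<close> for the weights on \<open>B\<close> makes the \<open>\<ell>\<^sup>2\<close> norm of the coefficients at most \<open>\<omega>\<close> times the
  Sobolev norm.\<close>

lemma L2_set_coeff_le:
  assumes f: "f \<in> H_mix \<alpha>" and B: "finite B" and w: "\<And>k. k \<in> B \<Longrightarrow> 1 \<le> \<omega> * mixed_weight (($) \<alpha>) k" and \<omega>: "0 \<le> \<omega>"
  shows "L2_set (\<lambda>k. cmod (fourier_coeff f k)) B \<le> \<omega> * H_mix_norm \<alpha> f"
proof -
  have sm: "mix_weighted \<alpha> f summable_on UNIV" using f unfolding H_mix_def by simp
  have nn: "0 \<le> mix_weighted \<alpha> f k" for k unfolding mix_weighted_def by (intro mult_nonneg_nonneg prod_nonneg) auto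
  have eq: "mix_weighted \<alpha> f k = (mixed_weight (($) \<alpha>) k)\<^sup>2 * (cmod (fourier_coeff f k))\<^sup>2" for k
    unfolding mix_weighted_def mixed_weight_def
    by (simp add: power2_eq_square prod.distrib[symmetric] powr_add[symmetric] mult_2[symmetric])
  have "(\<Sum>k\<in>B. (cmod (fourier_coeff f k))\<^sup>2) \<le> (\<Sum>k\<in>B. \<omega>\<^sup>2 * mix_weighted \<alpha> f k)"
  proof (rule sum_mono)
    fix k assume "k \<in> B"
    then have "1 \<le> (\<omega> * mixed_weight (($) \<alpha>) k)\<^sup>2" using w by (simp add: one_le_power)
    then have "1 * (cmod (fourier_coeff f k))\<^sup>2 \<le> (\<omega> * mixed_weight (($) \<alpha>) k)\<^sup>2 * (cmod (fourier_coeff f k))\<^sup>2"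
      by (rule mult_right_mono) simp
    then show "(cmod (fourier_coeff f k))\<^sup>2 \<le> \<omega>\<^sup>2 * mix_weighted \<alpha> f k"
      unfolding eq by (simp add: power_mult_distrib mult.assoc)
  qed
  also have "\<dots> = \<omega>\<^sup>2 * (\<Sum>k\<in>B. mix_weighted \<alpha> f k)" by (rule sum_distrib_left[symmetric])
  also have "\<dots> \<le> \<omega>\<^sup>2 * (\<Sum>\<^sub>\<infinity>k. mix_weighted \<alpha> f k)"
    by (intro mult_left_mono finite_sum_le_infsum sm B) (auto simp: nn)
  finally have "sqrt (\<Sum>k\<in>B. (cmod (fourier_coeff f k))\<^sup>2) \<le> sqrt (\<omega>\<^sup>2 * (\<Sum>\<^sub>\<infinity>k. mix_weighted \<alpha> f k))"
    by (rule real_sqrt_le_mono)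
  then show ?thesis using \<omega> unfolding L2_set_def H_mix_norm_def by (simp add: real_sqrt_mult)
qed

text \<open>The logarithm of \<open>2 ^ l * s\<close> is split multiplicatively, \<open>1 + ln (2 ^ l * s) \<le> (l + 1) * (1 + ln s)\<close>, so that the
  dependence on \<open>s\<close> and on \<open>l\<close> separates.\<close>

lemma block_weight_bound:
  assumes c: "0 < c" and h: "0 < h" and s: "1 \<le> s"
    and W: "(c * real (2 ^ l * s) / (1 + ln (real (2 ^ l * s))) ^ r) powr h \<le> W"
  shows "1 \<le> recovery_rate h r s * block_decay c h r l * W"
proof -
  define N where "N = real (2 ^ l * s)"
  have s1: "1 \<le> real s" using s by simp
  have N1: "1 \<le> N" unfolding N_def using mult_mono[of 1 "2 ^ l" 1 "real s"] s1 by simp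
  have "ln N = real l * ln 2 + ln (real s)" unfolding N_def using s1 by (simp add: ln_mult ln_realpow)
  also have "real l * ln 2 \<le> real l * 1" using ln_2_less_1 by (intro mult_left_mono) auto
  finally have "1 + ln N \<le> 1 + real l + ln (real s)" by simp
  also have "\<dots> \<le> real (Suc l) * (1 + ln (real s))" using s1 by (simp add: algebra_simps)
  finally have lg: "1 + ln N \<le> real (Suc l) * (1 + ln (real s))" .
  have l0: "0 \<le> ln N" using N1 by simp
  have "(1 + ln N) ^ r \<le> (real (Suc l) * (1 + ln (real s))) ^ r" using lg l0 by (intro power_mono) auto
  then have "(1 + ln N) ^ r / (c * N) \<le> (real (Suc l) * (1 + ln (real s))) ^ r / (c * N)"
    using c N1 by (intro divide_right_mono) auto
  also have "\<dots> = ((1 + ln (real s)) ^ r / real s) * (real (Suc l) ^ r / (c * 2 ^ l))"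
    unfolding N_def by (simp add: power_mult_distrib mult_ac)
  finally have le: "(1 + ln N) ^ r / (c * N) \<le> ((1 + ln (real s)) ^ r / real s) * (real (Suc l) ^ r / (c * 2 ^ l))" .
  have G: "0 < (1 + ln N) ^ r" using l0 by (intro zero_less_power) simp
  have cN: "0 < c * N" using c N1 by simp
  have cancel: "(u / v) * (v / u) = 1" if "0 < u" "0 < v" for u v :: real using that by simp
  have "1 = (((1 + ln N) ^ r / (c * N)) * (c * N / (1 + ln N) ^ r)) powr h"
    unfolding cancel[OF G cN] by simp
  also have "\<dots> = ((1 + ln N) ^ r / (c * N)) powr h * (c * N / (1 + ln N) ^ r) powr h"
    by (rule powr_mult)
  also have "\<dots> \<le> (((1 + ln (real s)) ^ r / real s) * (real (Suc l) ^ r / (c * 2 ^ l))) powr h * W"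
    using le W h G cN unfolding N_def[symmetric] by (intro mult_mono powr_mono2) auto
  also have "\<dots> = recovery_rate h r s * block_decay c h r l * W"
    unfolding recovery_rate_def block_decay_def using s1 c by (subst powr_mult) auto
  finally show ?thesis .
qed

section \<open>The recovery error\<close>

lemma L2_set_norm_sum_le:
  fixes n :: nat
  shows "L2_set (\<lambda>i. cmod (\<Sum>l<n. u l i)) S \<le> (\<Sum>l<n. L2_set (\<lambda>i. cmod (u l i)) S)"
proof (induction n)
  case 0 then show ?case by (simp add: L2_set_def)
next
  case (Suc n)
  have "L2_set (\<lambda>i. cmod (\<Sum>l<Suc n. u l i)) S \<le> L2_set (\<lambda>i. cmod (\<Sum>l<n. u l i) + cmod (u n i)) S"
    by (rule L2_set_mono) (simp_all add: norm_triangle_ineq)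
  also have "\<dots> \<le> L2_set (\<lambda>i. cmod (\<Sum>l<n. u l i)) S + L2_set (\<lambda>i. cmod (u n i)) S"
    by (rule L2_set_triangle_ineq)
  finally show ?case using Suc.IH by simp
qed

lemma sampled_trig_sum_norm:
  "(L2_set (\<lambda>i. cmod (of_real (1 / sqrt (real m)) * trig_sum B v (x i))) {1..m})\<^sup>2
    = (\<Sum>i=1..m. (cmod (\<Sum>k\<in>B. fourier_basis k (x i) * v k))\<^sup>2) / real m"
  unfolding L2_set_squared trig_sum_def norm_mult norm_of_real power_mult_distrib power2_abs sum_divide_distrib
  by (intro sum.cong refl) (simp add: power_divide mult.commute)

lemma near_isometry_lower:
  assumes "near_isometry (1/2) B m x"
  shows "L2_set (\<lambda>k. cmod (v k)) B / 2
    \<le> L2_set (\<lambda>i. cmod (of_real (1 / sqrt (real m)) * trig_sum B v (x i))) {1..m}"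
proof (rule power2_le_imp_le)
  let ?T = "\<Sum>i=1..m. (cmod (\<Sum>k\<in>B. fourier_basis k (x i) * v k))\<^sup>2"
  let ?V = "\<Sum>k\<in>B. (cmod (v k))\<^sup>2"
  have "\<bar>?T / real m - ?V\<bar> \<le> 1/2 * ?V" using assms unfolding near_isometry_def by blast
  moreover have "0 \<le> ?V" by (intro sum_nonneg) simp
  ultimately have "?V / 4 \<le> ?T / real m" by linarith
  then show "(L2_set (\<lambda>k. cmod (v k)) B / 2)\<^sup>2
    \<le> (L2_set (\<lambda>i. cmod (of_real (1 / sqrt (real m)) * trig_sum B v (x i))) {1..m})\<^sup>2"
    unfolding sampled_trig_sum_norm unfolding power_divide L2_set_squared by simp
qed simp

lemma near_isometry_upper:
  assumes "near_isometry (4 * t) B m x" "1 \<le> t"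
  shows "L2_set (\<lambda>i. cmod (of_real (1 / sqrt (real m)) * trig_sum B v (x i))) {1..m}
    \<le> sqrt (5 * t) * L2_set (\<lambda>k. cmod (v k)) B"
proof (rule power2_le_imp_le)
  let ?T = "\<Sum>i=1..m. (cmod (\<Sum>k\<in>B. fourier_basis k (x i) * v k))\<^sup>2"
  let ?V = "\<Sum>k\<in>B. (cmod (v k))\<^sup>2"
  have "\<bar>?T / real m - ?V\<bar> \<le> 4 * t * ?V" using assms unfolding near_isometry_def by blast
  then have "?T / real m \<le> 4 * t * ?V + 1 * ?V" by linarith
  also have "\<dots> \<le> 4 * t * ?V + t * ?V" using assms(2) by (intro add_left_mono mult_right_mono sum_nonneg) auto
  finally have "?T / real m \<le> 5 * t * ?V" by simp
  then show "(L2_set (\<lambda>i. cmod (of_real (1 / sqrt (real m)) * trig_sum B v (x i))) {1..m})\<^sup>2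
    \<le> (sqrt (5 * t) * L2_set (\<lambda>k. cmod (v k)) B)\<^sup>2"
    using assms(2) unfolding sampled_trig_sum_norm unfolding power_mult_distrib L2_set_squared by simp
qed (use assms(2) in simp)

text \<open>The coefficients on \<open>\<Lambda> s\<close> are recovered up to seven times the sampled residual, and both the residual and the part of
  \<open>f\<close> outside \<open>\<Lambda> s\<close> are bounded by the sum \<open>\<Sigma>\<close> over the blocks.\<close>

lemma recovery_error_le:
  fixes \<Lambda> :: "nat \<Rightarrow> (int ^ 'd) set" and f :: "real ^ 'd \<Rightarrow> complex"
  assumes \<Lambda>: "\<And>n. finite (\<Lambda> n)" "\<And>n. card (\<Lambda> n) \<le> n" "\<And>k. \<exists>N. \<forall>n\<ge>N. k \<in> \<Lambda> n"
    and c: "0 < c" and h: "1/2 < min_smoothness \<alpha>"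
    and W: "\<And>n k. 1 \<le> n \<Longrightarrow> k \<notin> \<Lambda> n \<Longrightarrow>
        (c * real n / (1 + ln (real n)) ^ (min_multiplicity \<alpha> - 1)) powr min_smoothness \<alpha>
          \<le> mixed_weight (($) \<alpha>) k"
    and s: "1 \<le> s"
    and iso: "near_isometry (1/2) (\<Lambda> s) m x"
      "\<And>l. near_isometry (4 * (2 ^ l * real (Suc l))) (frequency_block \<Lambda> s l) m x"
    and f: "f \<in> H_mix \<alpha>" and g: "g \<in> sparse_recovery s (\<Lambda> s) m x (\<lambda>i. cont_rep f (x i))"
  defines "\<Sigma> \<equiv> \<Sum>l. sqrt (5 * (2 ^ l * real (Suc l))) * block_decay c (min_smoothness \<alpha>) (min_multiplicity \<alpha> - 1) l"
  shows "L2_torus_norm (\<lambda>t. f t - g t)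
    \<le> 8 * (\<Sigma> * recovery_rate (min_smoothness \<alpha>) (min_multiplicity \<alpha> - 1) s * H_mix_norm \<alpha> f)"
proof -
  define a where "a = fourier_coeff f"
  define B where "B = frequency_block \<Lambda> s"
  define D where "D n = \<Lambda> s \<union> (\<Union>l<n. B l)" for n
  define \<rho> where "\<rho> = recovery_rate (min_smoothness \<alpha>) (min_multiplicity \<alpha> - 1) s"
  define \<kappa> where "\<kappa> = block_decay c (min_smoothness \<alpha>) (min_multiplicity \<alpha> - 1)"
  define \<tau> where "\<tau> l = sqrt (5 * (2 ^ l * real (Suc l)))" for l
  define H where "H = H_mix_norm \<alpha> f"
  define Q where "Q = \<Sigma> * \<rho> * H"
  have t1: "1 \<le> 2 ^ l * real (Suc l)" for l using mult_mono[of 1 "2 ^ l" 1 "real (Suc l)"] by simp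
  have \<tau>1: "1 \<le> \<tau> l" for l unfolding \<tau>_def using t1[of l] by simp
  have \<rho>0: "0 \<le> \<rho>" unfolding \<rho>_def recovery_rate_def by simp
  have \<kappa>0: "0 \<le> \<kappa> l" for l unfolding \<kappa>_def block_decay_def by simp
  have H0: "0 \<le> H" unfolding H_def H_mix_norm_def
    by (intro real_sqrt_ge_zero infsum_nonneg) (auto simp: mix_weighted_def intro!: mult_nonneg_nonneg prod_nonneg)
  have summ: "summable (\<lambda>l. \<tau> l * \<kappa> l)"
    unfolding \<tau>_def \<kappa>_def using summable_block_decay[OF c h] .
  have \<Sigma>: "\<Sigma> = (\<Sum>l. \<tau> l * \<kappa> l)" unfolding \<Sigma>_def \<tau>_def \<kappa>_def ..
  have part: "(\<Sum>l<n. \<tau> l * \<kappa> l) \<le> \<Sigma>" for n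
  proof -
    have "0 \<le> \<tau> l * \<kappa> l" for l using \<tau>1[of l] \<kappa>0[of l] by simp
    then show ?thesis unfolding \<Sigma> by (intro sum_le_suminf summ) auto
  qed
  have \<Sigma>0: "0 \<le> \<Sigma>" using part[of 0] by simp
  have Q0: "0 \<le> Q" unfolding Q_def using \<Sigma>0 \<rho>0 H0 by simp
  have finB: "finite (B l)" and cardB: "card (B l) \<le> 2 ^ Suc l * s" for l
  proof -
    show "finite (B l)" unfolding B_def frequency_block_def using \<Lambda>(1) by simp
    have "card (B l) \<le> card (\<Lambda> (2 ^ Suc l * s))"
      unfolding B_def frequency_block_def by (intro card_mono \<Lambda>(1)) blast
    then show "card (B l) \<le> 2 ^ Suc l * s" using \<Lambda>(2) by (rule order_trans)
  qed
  have disj: "B l \<inter> (\<Lambda> s \<union> (\<Union>i<l. B i)) = {}" for l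
    unfolding B_def frequency_block_Union unfolding frequency_block_def by blast
  have all: "\<Lambda> s \<union> (\<Union>l. B l) = UNIV"
  proof -
    have "k \<in> \<Lambda> s \<union> (\<Union>l. B l)" for k
    proof -
      obtain N where N: "\<And>n. N \<le> n \<Longrightarrow> k \<in> \<Lambda> n" using \<Lambda>(3)[of k] by blast
      have "N \<le> 2 ^ N" using less_exp[of N] by simp
      also have "2 ^ N * 1 \<le> 2 ^ N * s" using s by (rule mult_le_mono2)
      finally have "k \<in> \<Lambda> (2 ^ N * s)" using N by simp
      then have "k \<in> (\<Union>i\<le>N. \<Lambda> (2 ^ i * s))" by blast
      then have "k \<in> \<Lambda> s \<union> (\<Union>l<N. B l)" unfolding B_def frequency_block_Union .
      then show ?thesis by blast
    qed
    then show ?thesis by blast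
  qed
  have blk: "L2_set (\<lambda>k. cmod (a k)) (B l) \<le> \<rho> * \<kappa> l * H" for l
    unfolding a_def H_def
  proof (rule L2_set_coeff_le[OF f finB])
    fix k assume "k \<in> B l"
    then have "k \<notin> \<Lambda> (2 ^ l * s)" unfolding B_def frequency_block_def by blast
    moreover have "1 \<le> 2 ^ l * s" using s by simp
    ultimately show "1 \<le> \<rho> * \<kappa> l * mixed_weight (($) \<alpha>) k"
      unfolding \<rho>_def \<kappa>_def using h by (intro block_weight_bound[OF c _ s] W) auto
  qed (use \<rho>0 \<kappa>0 in simp)
  have abs_summ: "summable (\<lambda>l. \<Sum>k\<in>B l. cmod (a k))"
  proof (rule summable_comparison_test'[where N = 0])
    show "summable (\<lambda>l. sqrt (real s) * \<rho> * H * (\<tau> l * \<kappa> l))" by (rule summable_mult[OF summ])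
    fix l
    have "(\<Sum>k\<in>B l. cmod (a k)) \<le> sqrt (real (card (B l))) * L2_set (\<lambda>k. cmod (a k)) (B l)"
      by (rule L1_le_sqrt_card_L2[OF finB])
    also have "\<dots> \<le> (sqrt (real s) * \<tau> l) * (\<rho> * \<kappa> l * H)"
    proof (intro mult_mono blk)
      have "real (card (B l)) \<le> real (2 ^ Suc l * s)" using cardB by (rule of_nat_mono)
      also have "\<dots> = real s * (2 * (2 ^ l * 1))" by simp
      also have "\<dots> \<le> real s * (5 * (2 ^ l * real (Suc l)))"
        by (intro mult_left_mono mult_mono) auto
      finally show "sqrt (real (card (B l))) \<le> sqrt (real s) * \<tau> l"
        unfolding \<tau>_def real_sqrt_mult[symmetric] by (rule real_sqrt_le_mono)
    qed (use \<tau>1[of l] in auto)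
    finally show "norm (\<Sum>k\<in>B l. cmod (a k)) \<le> sqrt (real s) * \<rho> * H * (\<tau> l * \<kappa> l)"
      by (simp add: mult_ac sum_nonneg)
  qed
  have fL2: "f \<in> L2_torus" using f unfolding H_mix_def by simp
  note series = cont_rep_fourier_series[OF fL2 \<Lambda>(1) finB disj all abs_summ[unfolded a_def], folded a_def D_def]
  define A where "A i k = of_real (1 / sqrt (real m)) * fourier_basis k (x i)" for i k
  define b where "b i = of_real (1 / sqrt (real m)) * cont_rep f (x i)" for i
  have Av: "(\<Sum>k\<in>\<Lambda> s. A i k * v k) = of_real (1 / sqrt (real m)) * trig_sum (\<Lambda> s) v (x i)" for i v
    unfolding A_def trig_sum_def sum_distrib_left by (intro sum.cong refl) (simp only: mult_ac)
  have Sn: "trig_sum (D n) v t = trig_sum (\<Lambda> s) v t + (\<Sum>l<n. trig_sum (B l) v t)" for n v t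
    unfolding trig_sum_def D_def by (rule sum_over_blocks[OF \<Lambda>(1) finB disj])
  have residual: "L2_set (\<lambda>i. cmod ((\<Sum>k\<in>\<Lambda> s. A i k * a k) - b i)) {1..m} \<le> Q"
  proof -
    have "(\<lambda>n. L2_set (\<lambda>i. cmod ((\<Sum>k\<in>\<Lambda> s. A i k * a k) - of_real (1 / sqrt (real m)) * trig_sum (D n) a (x i))) {1..m})
        \<longlonglongrightarrow> L2_set (\<lambda>i. cmod ((\<Sum>k\<in>\<Lambda> s. A i k * a k) - b i)) {1..m}"
      unfolding L2_set_def b_def by (intro tendsto_intros series(3))
    moreover have "L2_set (\<lambda>i. cmod ((\<Sum>k\<in>\<Lambda> s. A i k * a k) - of_real (1 / sqrt (real m)) * trig_sum (D n) a (x i))) {1..m} \<le> Q" for n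
    proof -
      have "cmod ((\<Sum>k\<in>\<Lambda> s. A i k * a k) - of_real (1 / sqrt (real m)) * trig_sum (D n) a (x i))
          = cmod (\<Sum>l<n. of_real (1 / sqrt (real m)) * trig_sum (B l) a (x i))" for i
        unfolding Av Sn distrib_left sum_distrib_left
        by (subst norm_minus_commute) simp
      then have "L2_set (\<lambda>i. cmod ((\<Sum>k\<in>\<Lambda> s. A i k * a k) - of_real (1 / sqrt (real m)) * trig_sum (D n) a (x i))) {1..m}
          = L2_set (\<lambda>i. cmod (\<Sum>l<n. of_real (1 / sqrt (real m)) * trig_sum (B l) a (x i))) {1..m}" by (simp only:)
      also have "\<dots> \<le> (\<Sum>l<n. L2_set (\<lambda>i. cmod (of_real (1 / sqrt (real m)) * trig_sum (B l) a (x i))) {1..m})"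
        by (rule L2_set_norm_sum_le)
      also have "\<dots> \<le> (\<Sum>l<n. \<tau> l * (\<rho> * \<kappa> l * H))"
      proof (rule sum_mono)
        fix l
        have "L2_set (\<lambda>i. cmod (of_real (1 / sqrt (real m)) * trig_sum (B l) a (x i))) {1..m}
            \<le> \<tau> l * L2_set (\<lambda>k. cmod (a k)) (B l)"
          unfolding \<tau>_def B_def by (rule near_isometry_upper[OF iso(2) t1])
        also have "\<dots> \<le> \<tau> l * (\<rho> * \<kappa> l * H)" using \<tau>1[of l] by (intro mult_left_mono blk) simp
        finally show "L2_set (\<lambda>i. cmod (of_real (1 / sqrt (real m)) * trig_sum (B l) a (x i))) {1..m} \<le> \<tau> l * (\<rho> * \<kappa> l * H)" .
      qed
      also have "\<dots> = (\<Sum>l<n. \<tau> l * \<kappa> l) * (\<rho> * H)"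
        unfolding sum_distrib_right by (intro sum.cong refl) (simp only: mult_ac)
      also have "\<dots> \<le> \<Sigma> * (\<rho> * H)" using part \<rho>0 H0 by (intro mult_right_mono) auto
      finally show ?thesis unfolding Q_def by (simp only: mult.assoc)
    qed
    ultimately show ?thesis by (intro LIMSEQ_le_const2) blast+
  qed
  define z where "z = lasso_solution (3 / (14 * sqrt (real s))) m (\<Lambda> s) A b"
  have lam: "0 < 3 / (14 * sqrt (real s))" using s by simp
  have zmin: "z \<in> lasso_minimizers (3 / (14 * sqrt (real s))) m (\<Lambda> s) A b"
    unfolding z_def by (rule lasso_solution_minimizes[OF \<Lambda>(1) lam])
  have zc: "z \<in> coeff_space (\<Lambda> s)" using zmin unfolding lasso_minimizers_def by simp
  obtain w where gw: "g = (\<lambda>t. \<Sum>k\<in>\<Lambda> s. w k * fourier_basis k t)" and w: "is_hard_threshold (2 * s) (\<Lambda> s) z w"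
    using g unfolding sparse_recovery_def Let_def z_def A_def[abs_def] b_def[abs_def] by blast
  have "card (\<Lambda> s) \<le> 2 * s" using \<Lambda>(2)[of s] by simp
  from hard_threshold_trivial[OF \<Lambda>(1) this zc w] have gz: "g = trig_sum (\<Lambda> s) z"
    unfolding gw trig_sum_def[abs_def] by simp
  define a0 where "a0 k = (if k \<in> \<Lambda> s then a k else 0)" for k
  have a0c: "a0 \<in> coeff_space (\<Lambda> s)" unfolding a0_def coeff_space_def by simp
  have "L2_set (\<lambda>k. cmod (z k - a0 k)) (\<Lambda> s) \<le> 7 * L2_set (\<lambda>i. cmod ((\<Sum>k\<in>\<Lambda> s. A i k * a0 k) - b i)) {1..m}"
  proof (rule lasso_error_le[OF \<Lambda>(1) \<Lambda>(2) s _ zmin a0c])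
    fix v
    show "L2_set (\<lambda>k. cmod (v k)) (\<Lambda> s) / 2 \<le> L2_set (\<lambda>i. cmod (\<Sum>k\<in>\<Lambda> s. A i k * v k)) {1..m}"
      unfolding Av by (rule near_isometry_lower[OF iso(1)])
  qed
  also have "(\<lambda>i. cmod ((\<Sum>k\<in>\<Lambda> s. A i k * a0 k) - b i)) = (\<lambda>i. cmod ((\<Sum>k\<in>\<Lambda> s. A i k * a k) - b i))"
    unfolding a0_def by simp
  also have "7 * L2_set (\<lambda>i. cmod ((\<Sum>k\<in>\<Lambda> s. A i k * a k) - b i)) {1..m} \<le> 7 * Q" using residual by simp
  finally have "L2_set (\<lambda>k. cmod (z k - a0 k)) (\<Lambda> s) \<le> 7 * Q" .
  moreover have "L2_set (\<lambda>k. cmod (z k - a0 k)) (\<Lambda> s) = L2_set (\<lambda>k. cmod (a k - z k)) (\<Lambda> s)"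
    by (rule L2_set_cong) (simp_all add: a0_def norm_minus_commute)
  ultimately have main: "L2_set (\<lambda>k. cmod (a k - z k)) (\<Lambda> s) \<le> 7 * Q" by simp
  have zoff: "z k = 0" if "k \<in> B l" for k l
  proof -
    have "k \<notin> \<Lambda> s" using that disj[of l] by blast
    then show ?thesis using zc unfolding coeff_space_def by simp
  qed
  have diff: "trig_sum (D n) a t - g t = trig_sum (D n) (\<lambda>k. a k - z k) t" for n t
  proof -
    have "trig_sum (B l) z t = 0" for l unfolding trig_sum_def by (intro sum.neutral) (simp add: zoff)
    then have "g t = trig_sum (D n) z t" unfolding gz Sn by simp
    then show ?thesis unfolding trig_sum_def by (simp add: left_diff_distrib sum_subtractf)
  qed
  obtain M where M: "\<And>n t. cmod (trig_sum (D n) a t) \<le> M" using series(4) by blast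
  have "L2_torus_norm (\<lambda>t. f t - g t) \<le> 8 * Q"
  proof (rule L2_torus_norm_limit_le[OF _ series(2) _ _ series(3)])
    show "f \<in> borel_measurable torus_measure" using fL2 unfolding L2_torus_def by simp
    show "cont_rep f \<in> borel_measurable borel"
      using series(1) unfolding C_torus_def by (auto intro: borel_measurable_continuous_onI)
    show "trig_sum (D n) a \<in> borel_measurable borel" for n by simp
    show "g \<in> borel_measurable borel" unfolding gz by simp
    show "cmod (trig_sum (D n) a t - g t) \<le> M + (\<Sum>k\<in>\<Lambda> s. cmod (z k))" for n t
      unfolding gz by (rule order_trans[OF norm_triangle_ineq4]) (intro add_mono M norm_trig_sum_le)
    show "0 \<le> 8 * Q" using Q0 by simp
    fix n
    have finD: "finite (D n)" unfolding D_def using \<Lambda>(1) finB by simp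
    have "(LINT t|torus_measure. (cmod (trig_sum (D n) a t - g t))\<^sup>2) = (\<Sum>k\<in>D n. (cmod (a k - z k))\<^sup>2)"
      unfolding diff by (rule trig_sum_parseval[OF finD])
    also have "\<dots> = (\<Sum>k\<in>\<Lambda> s. (cmod (a k - z k))\<^sup>2) + (\<Sum>l<n. \<Sum>k\<in>B l. (cmod (a k - z k))\<^sup>2)"
      unfolding D_def by (rule sum_over_blocks[OF \<Lambda>(1) finB disj])
    also have "(\<Sum>k\<in>\<Lambda> s. (cmod (a k - z k))\<^sup>2) = (L2_set (\<lambda>k. cmod (a k - z k)) (\<Lambda> s))\<^sup>2"
      by (rule L2_set_squared[symmetric])
    also have "\<dots> \<le> (7 * Q)\<^sup>2" using main by (intro power_mono) auto
    also have "(\<Sum>l<n. \<Sum>k\<in>B l. (cmod (a k - z k))\<^sup>2) = (\<Sum>l<n. (L2_set (\<lambda>k. cmod (a k)) (B l))\<^sup>2)"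
      unfolding L2_set_squared by (intro sum.cong refl) (simp add: zoff)
    also have "\<dots> = (L2_set (\<lambda>l. L2_set (\<lambda>k. cmod (a k)) (B l)) {..<n})\<^sup>2" by (rule L2_set_squared[symmetric])
    also have "\<dots> \<le> Q\<^sup>2"
    proof (rule power_mono)
      have "L2_set (\<lambda>l. L2_set (\<lambda>k. cmod (a k)) (B l)) {..<n} \<le> (\<Sum>l<n. L2_set (\<lambda>k. cmod (a k)) (B l))"
        by (rule L2_set_le_sum) simp
      also have "\<dots> \<le> (\<Sum>l<n. (\<tau> l * \<kappa> l) * (\<rho> * H))"
      proof (rule sum_mono)
        fix l
        have "1 * (\<rho> * \<kappa> l * H) \<le> \<tau> l * (\<rho> * \<kappa> l * H)"
          using \<tau>1[of l] \<rho>0 \<kappa>0[of l] H0 by (intro mult_right_mono mult_nonneg_nonneg)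
        then show "L2_set (\<lambda>k. cmod (a k)) (B l) \<le> (\<tau> l * \<kappa> l) * (\<rho> * H)"
          using blk[of l] by (simp add: mult_ac)
      qed
      also have "\<dots> = (\<Sum>l<n. \<tau> l * \<kappa> l) * (\<rho> * H)" by (rule sum_distrib_right[symmetric])
      also have "\<dots> \<le> \<Sigma> * (\<rho> * H)" using part \<rho>0 H0 by (intro mult_right_mono) auto
      finally show "L2_set (\<lambda>l. L2_set (\<lambda>k. cmod (a k)) (B l)) {..<n} \<le> Q" unfolding Q_def by (simp only: mult.assoc)
    qed simp
    finally have "(LINT t|torus_measure. (cmod (trig_sum (D n) a t - g t))\<^sup>2) \<le> (7 * Q)\<^sup>2 + Q\<^sup>2" by simp
    also have "\<dots> \<le> (8 * Q)\<^sup>2" by (simp add: power_mult_distrib)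
    finally show "(LINT t|torus_measure. (cmod (trig_sum (D n) a t - g t))\<^sup>2) \<le> (8 * Q)\<^sup>2" .
  qed
  then show ?thesis unfolding Q_def \<rho>_def H_def .
qed

text \<open>For \<open>s \<ge> 2\<close> the difference between \<open>ln s\<close> and \<open>1 + ln s\<close> is a constant factor. For \<open>s = 1\<close> the
  logarithm vanishes, and the bound needs exponent zero, where \<open>0 ^ 0 = 1\<close>.\<close>

lemma recovery_rate_le:
  assumes s: "1 \<le> s" and h: "0 < h" and r: "s = 1 \<longrightarrow> r = 0"
  shows "recovery_rate h r s \<le> (3 ^ r) powr h * (ln (real s) ^ r / real s) powr h"
proof (cases "s = 1")
  case True
  then show ?thesis using r unfolding recovery_rate_def by simp
next
  case False
  then have s2: "2 \<le> real s" using s by simp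
  have "ln 2 \<le> ln (real s)" using s2 by simp
  then have "1 + ln (real s) \<le> 3 * ln (real s)" using ln2_ge_two_thirds by linarith
  then have "(1 + ln (real s)) ^ r \<le> (3 * ln (real s)) ^ r" using s2 by (intro power_mono) auto
  then have "(1 + ln (real s)) ^ r / real s \<le> 3 ^ r * (ln (real s) ^ r / real s)"
    using s2 by (simp add: power_mult_distrib divide_right_mono)
  then have "recovery_rate h r s \<le> (3 ^ r * (ln (real s) ^ r / real s)) powr h"
    unfolding recovery_rate_def using h s2 by (intro powr_mono2) auto
  then show ?thesis by (simp only: powr_mult)
qed

lemma sparse_recovery_sparse:
  assumes "finite \<Lambda>" "g \<in> sparse_recovery s \<Lambda> m x y"
  shows "sparse_combination (2 * s) \<Lambda> g"
proof -
  obtain z c where g: "g = (\<lambda>t. \<Sum>k\<in>\<Lambda>. c k * fourier_basis k t)" and c: "is_hard_threshold (2 * s) \<Lambda> z c"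
    using assms(2) unfolding sparse_recovery_def Let_def by blast
  obtain S where S: "S \<subseteq> \<Lambda>" "card S = min (2 * s) (card \<Lambda>)" "c = (\<lambda>k. if k \<in> S then z k else 0)"
    using c unfolding is_hard_threshold_def by blast
  have "g = (\<lambda>t. \<Sum>k\<in>S. c k * fourier_basis k t)"
    unfolding g using S assms(1) by (intro ext sum.mono_neutral_right) auto
  then show ?thesis unfolding sparse_combination_def using S assms(1) by (intro exI[of _ S] exI[of _ c]) (auto intro: finite_subset)
qed

text \<open>The event and the sets \<open>\<Lambda> s\<close> are found before \<open>\<alpha>\<close> is given; only the constant \<open>C \<alpha>\<close> is chosen
  for each \<open>\<alpha>\<close>.\<close>

theorem theorem1p5:
  "\<exists>c > (0::real). \<exists>C :: real ^ 'd \<Rightarrow> real. \<exists>\<Lambda> :: nat \<Rightarrow> (int ^ 'd) set.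
     (\<forall>\<alpha>. (\<forall>j. \<alpha> $ j > 1/2) \<longrightarrow> C \<alpha> > 0) \<and>
     (\<forall>s\<ge>1. finite (\<Lambda> s) \<and>
        real (card (\<Lambda> s)) \<le> real s * (ln (exp 1 * real s)) ^ (CARD('d) - 1)) \<and>
     (\<forall>s\<ge>1. \<forall>\<epsilon>. 0 < \<epsilon> \<and> \<epsilon> < 1 \<longrightarrow>
       (\<forall>m :: nat. real m \<ge> c * real s * ((ln (2 * real s)) ^ 3 + ln (2 / \<epsilon>)) \<longrightarrow>
         (\<exists>E \<in> sets (PiM {1..m} (\<lambda>_. torus_measure :: (real ^ 'd) measure)).
            measure (PiM {1..m} (\<lambda>_. torus_measure :: (real ^ 'd) measure)) E \<ge> 1 - \<epsilon> \<and>
            (\<forall>x \<in> E. \<forall>\<alpha>. (\<forall>j. \<alpha> $ j > 1/2) \<longrightarrow>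
              (\<forall>f \<in> H_mix \<alpha>. \<forall>g \<in> sparse_recovery s (\<Lambda> s) m x (\<lambda>i. cont_rep f (x i)).
                 sparse_combination (2 * s) (\<Lambda> s) g \<and>
                 ((s = 1 \<longrightarrow> min_multiplicity \<alpha> = 1) \<longrightarrow>
                  L2_torus_norm (\<lambda>t. f t - g t)
                    \<le> C \<alpha> * ((ln (real s)) ^ (min_multiplicity \<alpha> - 1) / real s)
                                 powr (min_smoothness \<alpha>) * H_mix_norm \<alpha> f))))))"
proof -
  obtain \<Lambda> :: "nat \<Rightarrow> (int ^ 'd) set" where
    \<Lambda>: "\<And>n. finite (\<Lambda> n)" "\<And>n. card (\<Lambda> n) \<le> n" "\<And>k. \<exists>N. \<forall>n\<ge>N. k \<in> \<Lambda> n"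
    and W: "\<And>\<alpha> :: real ^ 'd. (\<forall>j. 0 < \<alpha> $ j) \<Longrightarrow> \<exists>c>0. \<forall>n\<ge>1. \<forall>k. k \<notin> \<Lambda> n \<longrightarrow>
        (c * real n / (1 + ln (real n)) ^ (min_multiplicity \<alpha> - 1)) powr min_smoothness \<alpha>
          \<le> mixed_weight (($) \<alpha>) k"
    using universal_frequency_sets[where 'd = 'd] by (elim exE conjE) blast
  define err where "err \<alpha> K \<longleftrightarrow> (\<forall>s\<ge>1. \<forall>m x. near_isometry (1/2) (\<Lambda> s) m x \<longrightarrow>
      (\<forall>l. near_isometry (4 * (2 ^ l * real (Suc l))) (frequency_block \<Lambda> s l) m x) \<longrightarrow>
      (\<forall>f \<in> H_mix \<alpha>. \<forall>g \<in> sparse_recovery s (\<Lambda> s) m x (\<lambda>i. cont_rep f (x i)).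
        (s = 1 \<longrightarrow> min_multiplicity \<alpha> = 1) \<longrightarrow>
        L2_torus_norm (\<lambda>t. f t - g t) \<le> K * ((ln (real s)) ^ (min_multiplicity \<alpha> - 1) / real s)
          powr (min_smoothness \<alpha>) * H_mix_norm \<alpha> f))" for \<alpha> :: "real ^ 'd" and K
  have "\<exists>K>0. err \<alpha> K" if \<alpha>: "\<forall>j. \<alpha> $ j > 1/2" for \<alpha> :: "real ^ 'd"
  proof -
    have "\<forall>j. 0 < \<alpha> $ j" using \<alpha> by (auto intro: less_trans[of 0 "1/2"])
    from W[OF this] obtain c where c: "0 < c" and Wc: "\<And>n k. 1 \<le> n \<Longrightarrow> k \<notin> \<Lambda> n \<Longrightarrow>
        (c * real n / (1 + ln (real n)) ^ (min_multiplicity \<alpha> - 1)) powr min_smoothness \<alpha>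
          \<le> mixed_weight (($) \<alpha>) k" by blast
    define h where "h = min_smoothness \<alpha>"
    define r where "r = min_multiplicity \<alpha> - 1"
    have "h \<in> range (($) \<alpha>)" unfolding h_def min_smoothness_def by (rule Min_in) auto
    then have h: "1/2 < h" using \<alpha> by auto
    define \<Sigma> where "\<Sigma> = (\<Sum>l. sqrt (5 * (2 ^ l * real (Suc l))) * block_decay c h r l)"
    have \<Sigma>0: "0 \<le> \<Sigma>" unfolding \<Sigma>_def
      by (intro suminf_nonneg summable_block_decay c h mult_nonneg_nonneg) (simp_all add: block_decay_def)
    \<comment> \<open>The summand 1 only makes the constant positive.\<close>
    define K where "K = 8 * \<Sigma> * (3 ^ r) powr h + 1"
    have "err \<alpha> K"
      unfolding err_def
    proof (intro allI impI ballI)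
      fix s m x f g
      assume s: "1 \<le> s" and iso: "near_isometry (1/2) (\<Lambda> s) m x"
        "\<forall>l. near_isometry (4 * (2 ^ l * real (Suc l))) (frequency_block \<Lambda> s l) m x"
        and f: "f \<in> H_mix \<alpha>" and g: "g \<in> sparse_recovery s (\<Lambda> s) m x (\<lambda>i. cont_rep f (x i))"
        and p: "s = 1 \<longrightarrow> min_multiplicity \<alpha> = 1"
      define H where "H = H_mix_norm \<alpha> f"
      have H0: "0 \<le> H" unfolding H_def H_mix_norm_def
        by (intro real_sqrt_ge_zero infsum_nonneg) (auto simp: mix_weighted_def intro!: mult_nonneg_nonneg prod_nonneg)
      define R where "R = (ln (real s) ^ r / real s) powr h"
      have "L2_torus_norm (\<lambda>t. f t - g t) \<le> 8 * (\<Sigma> * recovery_rate h r s * H)"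
        unfolding \<Sigma>_def h_def r_def H_def
        using h iso(2) by (intro recovery_error_le[OF \<Lambda> c _ Wc s iso(1) _ f g]) (auto simp: h_def)
      also have "\<dots> \<le> 8 * (\<Sigma> * ((3 ^ r) powr h * R) * H)"
        unfolding R_def using \<Sigma>0 H0 s h p
        by (intro mult_left_mono mult_right_mono recovery_rate_le) (auto simp: r_def)
      also have "\<dots> = (8 * \<Sigma> * (3 ^ r) powr h) * (R * H)" by (simp only: mult_ac)
      also have "\<dots> \<le> K * (R * H)" unfolding K_def R_def using H0 by (intro mult_right_mono) auto
      finally show "L2_torus_norm (\<lambda>t. f t - g t) \<le> K * ((ln (real s)) ^ (min_multiplicity \<alpha> - 1) / real s)
          powr (min_smoothness \<alpha>) * H_mix_norm \<alpha> f"
        unfolding R_def H_def h_def r_def by (simp only: mult.assoc)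
    qed
    moreover have "0 < K" unfolding K_def using \<Sigma>0 by (intro add_nonneg_pos mult_nonneg_nonneg) auto
    ultimately show ?thesis by blast
  qed
  then have "\<forall>\<alpha>. \<exists>K. (\<forall>j. \<alpha> $ j > 1/2) \<longrightarrow> 0 < K \<and> err \<alpha> K" by blast
  then obtain C where C: "\<And>\<alpha>. (\<forall>j. \<alpha> $ j > 1/2) \<Longrightarrow> 0 < C \<alpha> \<and> err \<alpha> (C \<alpha>)"
    using choice[of "\<lambda>\<alpha> K. (\<forall>j. \<alpha> $ j > 1/2) \<longrightarrow> 0 < K \<and> err \<alpha> K"] by blast
  have size: "real (card (\<Lambda> s)) \<le> real s * (ln (exp 1 * real s)) ^ (CARD('d) - 1)" if s: "1 \<le> s" for s
  proof -
    have "ln (exp 1 * real s) = 1 + ln (real s)" using s by (simp add: ln_mult)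
    then have "1 \<le> (ln (exp 1 * real s)) ^ (CARD('d) - 1)" using s by (intro one_le_power) simp
    then have "real s * 1 \<le> real s * (ln (exp 1 * real s)) ^ (CARD('d) - 1)" by (intro mult_left_mono) auto
    moreover have "real (card (\<Lambda> s)) \<le> real s" using \<Lambda>(2) by (rule of_nat_mono)
    ultimately show ?thesis by simp
  qed
  have sampling: "\<exists>E \<in> sets (PiM {1..m} (\<lambda>_. torus_measure :: (real ^ 'd) measure)).
            measure (PiM {1..m} (\<lambda>_. torus_measure :: (real ^ 'd) measure)) E \<ge> 1 - \<epsilon> \<and>
            (\<forall>x \<in> E. \<forall>\<alpha>. (\<forall>j. \<alpha> $ j > 1/2) \<longrightarrow>
              (\<forall>f \<in> H_mix \<alpha>. \<forall>g \<in> sparse_recovery s (\<Lambda> s) m x (\<lambda>i. cont_rep f (x i)).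
                 sparse_combination (2 * s) (\<Lambda> s) g \<and>
                 ((s = 1 \<longrightarrow> min_multiplicity \<alpha> = 1) \<longrightarrow>
                  L2_torus_norm (\<lambda>t. f t - g t)
                    \<le> C \<alpha> * ((ln (real s)) ^ (min_multiplicity \<alpha> - 1) / real s)
                                 powr (min_smoothness \<alpha>) * H_mix_norm \<alpha> f)))"
    if s: "1 \<le> s" and \<epsilon>: "0 < \<epsilon> \<and> \<epsilon> < 1"
      and m: "real m \<ge> 400 * real s * ((ln (2 * real s)) ^ 3 + ln (2 / \<epsilon>))" for s m \<epsilon>
  proof -
    have finB: "finite (frequency_block \<Lambda> s l)" for l unfolding frequency_block_def using \<Lambda>(1) by simp
    have cardB: "card (frequency_block \<Lambda> s l) \<le> 2 ^ Suc l * s" for l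
    proof -
      have "card (frequency_block \<Lambda> s l) \<le> card (\<Lambda> (2 ^ Suc l * s))"
        unfolding frequency_block_def by (intro card_mono \<Lambda>(1)) blast
      then show ?thesis using \<Lambda>(2) by (rule order_trans)
    qed
    obtain E where E: "E \<in> sets (sample_measure m)" "measure (sample_measure m) E \<ge> 1 - \<epsilon>"
      and iso: "\<And>x. x \<in> E \<Longrightarrow> near_isometry (1/2) (\<Lambda> s) m x"
        "\<And>x l. x \<in> E \<Longrightarrow> near_isometry (4 * (2 ^ l * real (Suc l))) (frequency_block \<Lambda> s l) m x"
      using simultaneous_near_isometry[OF s \<Lambda>(1) \<Lambda>(2) finB cardB conjunct1[OF \<epsilon>] conjunct2[OF \<epsilon>] m] by blast
    have "sparse_combination (2 * s) (\<Lambda> s) g \<and>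
        ((s = 1 \<longrightarrow> min_multiplicity \<alpha> = 1) \<longrightarrow>
         L2_torus_norm (\<lambda>t. f t - g t) \<le> C \<alpha> * ((ln (real s)) ^ (min_multiplicity \<alpha> - 1) / real s)
            powr (min_smoothness \<alpha>) * H_mix_norm \<alpha> f)"
      if x: "x \<in> E" and \<alpha>: "\<forall>j. \<alpha> $ j > 1/2" and f: "f \<in> H_mix \<alpha>"
        and g: "g \<in> sparse_recovery s (\<Lambda> s) m x (\<lambda>i. cont_rep f (x i))" for x \<alpha> f g
    proof
      show "sparse_combination (2 * s) (\<Lambda> s) g" by (rule sparse_recovery_sparse[OF \<Lambda>(1) g])
      show "(s = 1 \<longrightarrow> min_multiplicity \<alpha> = 1) \<longrightarrow>
         L2_torus_norm (\<lambda>t. f t - g t) \<le> C \<alpha> * ((ln (real s)) ^ (min_multiplicity \<alpha> - 1) / real s)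
            powr (min_smoothness \<alpha>) * H_mix_norm \<alpha> f"
        using C[OF \<alpha>] iso[OF x] s f g unfolding err_def by blast
    qed
    then show ?thesis using E by blast
  qed
  show ?thesis
  proof (rule exI[of _ 400], intro conjI, simp, rule exI[of _ C], rule exI[of _ \<Lambda>], intro conjI)
    show "\<forall>\<alpha>. (\<forall>j. \<alpha> $ j > 1/2) \<longrightarrow> C \<alpha> > 0" using C by blast
    show "\<forall>s\<ge>1. finite (\<Lambda> s) \<and> real (card (\<Lambda> s)) \<le> real s * (ln (exp 1 * real s)) ^ (CARD('d) - 1)"
      using \<Lambda>(1) size by blast
  qed (use sampling in blast)
qed

end
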